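(* Let $G=(V,E)$ be a semialgebraic graph. Then the following are equivalent: (1) $\chi_\ell(G)\le \aleph_0$; (2) $\mathrm{Col}(G)\le \aleph_0$; (3) there is $m<\omega$ such that $G$ does not contain a $K(m,m)$; (4) $G$ does not contain a $K(2^{\aleph_0},2^{\aleph_0})$.
   Context: A graph $G=(V,E)$ consists of a (possibly infinite) vertex set $V$ and a symmetric, irreflexive relation $E\subseteq V^2$. A coloring $\varphi$ of $G$ (a function with domain $V$) is proper if $\varphi(x)\ne\varphi(y)$ whenever $\langle x,y\rangle\in E$. For a cardinal $\kappa$, a $\kappa$-listing of $G$ is a function $\Lambda$ on $V$ such that $\Lambda(x)$ is a set with $|\Lambda(x)|=\kappa$ for every $x\in V$; a $\Lambda$-coloring is a coloring $\varphi$ with $\varphi(x)\in\Lambda(x)$ for all $x\in V$. The list-chromatic number $\chi_\ell(G)$ is the least cardinal $\kappa$ such that for every $\kappa$-listing $\Lambda$ of $G$ there is a proper $\Lambda$-coloring of $G$. The coloring number $\mathrm{Col}(G)$ is the least cardinal $\kappa$ for which there is a well-ordering $\prec$ of $V$ such that $|\{y\in V:\langle x,y\rangle\in E \text{ and } y\prec x\}|<\kappa$ for every $x\in V$. $G_1=(V_1,E_1)$ is a subgraph of $G_2=(V_2,E_2)$ if $V_1\subseteq V_2$ and $E_1\subseteq E_2$ (not necessarily induced); $G_2$ contains a $G_1$ if $G_2$ has a subgraph isomorphic to $G_1$. $K(\kappa,\lambda)$ is the complete bipartite graph with parts of cardinality $\kappa$ and $\lambda$. A set $X\subseteq\mathbb{R}^n$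 is semialgebraic if it is definable in the ordered field $(\mathbb{R},+,\cdot,0,1,\le)$ by a first-order formula in which parameters from $\mathbb{R}$ are allowed. A graph $(V,E)$, with $V\subseteq\mathbb{R}^n$ for some $n<\omega$ and $E\subseteq V^2\subseteq\mathbb{R}^{2n}$, is semialgebraic if both $V$ and $E$ are semialgebraic. *)

theory Defs
  imports Complex_Main
begin

unbundle cardinal_syntax

section \<open>Graphs\<close>

definition graph :: "'a set \<Rightarrow> 'a rel \<Rightarrow> bool" where
  "graph V E \<longleftrightarrow> E \<subseteq> V \<times> V \<and> sym E \<and> irrefl E"

definition subgraph :: "'a set \<Rightarrow> 'a rel \<Rightarrow> 'a set \<Rightarrow> 'a rel \<Rightarrow> bool" where
  "subgraph V\<^sub>1 E\<^sub>1 V\<^sub>2 E\<^sub>2 \<longleftrightarrow>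
     graph V\<^sub>1 E\<^sub>1 \<and> graph V\<^sub>2 E\<^sub>2 \<and> V\<^sub>1 \<subseteq> V\<^sub>2 \<and> E\<^sub>1 \<subseteq> E\<^sub>2"

definition graph_isomorphic :: "'a set \<Rightarrow> 'a rel \<Rightarrow> 'b set \<Rightarrow> 'b rel \<Rightarrow> bool" where
  "graph_isomorphic V E W F \<longleftrightarrow>
     (\<exists>f. bij_betw f V W \<and> (\<forall>x\<in>V. \<forall>y\<in>V. (x, y) \<in> E \<longleftrightarrow> (f x, f y) \<in> F))"

definition contains_graph :: "'a set \<times> 'a rel \<Rightarrow> 'b set \<times> 'b rel \<Rightarrow> bool" where
  "contains_graph G H \<longleftrightarrow>
     (\<exists>V\<^sub>1 E\<^sub>1. subgraph V\<^sub>1 E\<^sub>1 (fst G) (snd G) \<and> graph_isomorphic V\<^sub>1 E\<^sub>1 (fst H) (snd H))"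

text \<open>\<open>complete_bipartite A B\<close> is the graph $K(|A|, |B|)$.\<close>

definition complete_bipartite :: "'a set \<Rightarrow> 'b set \<Rightarrow> ('a + 'b) set \<times> ('a + 'b) rel" where
  "complete_bipartite A B =
     (A <+> B, (Inl ` A \<times> Inr ` B) \<union> (Inr ` B \<times> Inl ` A))"

section \<open>Cardinal-valued invariants\<close>

text \<open>
  As in the library, a cardinal is a relation \<open>\<kappa>\<close> with \<open>Card_order \<kappa>\<close>, and equality of
  cardinals is \<open>=o\<close>.  Hence \<open>least_cardinal P\<close>, where \<open>P\<close> is invariant under \<open>=o\<close>, is
  determined up to \<open>=o\<close> only.  The type of \<open>\<kappa>\<close> restricts the minimum to cardinals not
  exceeding that of a type; for both invariants below this type is the vertex type, and the
  lemmas \<open>list_chromatic_number_least\<close> and \<open>coloring_number_least\<close> show that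
  larger cardinals cannot matter.
\<close>

definition is_least_cardinal :: "('k rel \<Rightarrow> bool) \<Rightarrow> 'k rel \<Rightarrow> bool" where
  "is_least_cardinal P \<kappa> \<longleftrightarrow>
     Card_order \<kappa> \<and> P \<kappa> \<and> (\<forall>\<mu>. Card_order \<mu> \<and> P \<mu> \<longrightarrow> \<kappa> \<le>o \<mu>)"

definition least_cardinal :: "('k rel \<Rightarrow> bool) \<Rightarrow> 'k rel" where
  "least_cardinal P = (SOME \<kappa>. is_least_cardinal P \<kappa>)"

definition listing :: "'a set \<Rightarrow> 'k rel \<Rightarrow> ('a \<Rightarrow> 'c set) \<Rightarrow> bool" where
  "listing V \<kappa> \<Lambda> \<longleftrightarrow> (\<forall>x\<in>V. |\<Lambda> x| =o \<kappa>)"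

definition list_coloring :: "'a set \<Rightarrow> ('a \<Rightarrow> 'c set) \<Rightarrow> ('a \<Rightarrow> 'c) \<Rightarrow> bool" where
  "list_coloring V \<Lambda> \<phi> \<longleftrightarrow> (\<forall>x\<in>V. \<phi> x \<in> \<Lambda> x)"

definition proper_coloring :: "'a set \<Rightarrow> 'a rel \<Rightarrow> ('a \<Rightarrow> 'c) \<Rightarrow> bool" where
  "proper_coloring V E \<phi> \<longleftrightarrow> (\<forall>x\<in>V. \<forall>y\<in>V. (x, y) \<in> E \<longrightarrow> \<phi> x \<noteq> \<phi> y)"

text \<open>
  The colors have to be taken from some fixed type.  A \<open>\<kappa>\<close>-listing of a subset of \<open>'a\<close>,
  \<open>\<kappa> :: 'k rel\<close>, involves no more colors than the type
  \<open>'a \<times> 'k\<close> has elements, so that type is large enough; lemma \<open>choosable_any_color_type\<close> confirms this.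
\<close>

definition choosable :: "'a set \<Rightarrow> 'a rel \<Rightarrow> 'k rel \<Rightarrow> bool" where
  "choosable V E \<kappa> \<longleftrightarrow>
     (\<forall>\<Lambda> :: 'a \<Rightarrow> ('a \<times> 'k) set. listing V \<kappa> \<Lambda> \<longrightarrow>
        (\<exists>\<phi>. list_coloring V \<Lambda> \<phi> \<and> proper_coloring V E \<phi>))"

definition list_chromatic_number :: "'a set \<Rightarrow> 'a rel \<Rightarrow> 'a rel" where
  "list_chromatic_number V E = least_cardinal (choosable V E)"

definition has_small_back_degrees :: "'a set \<Rightarrow> 'a rel \<Rightarrow> 'k rel \<Rightarrow> bool" where
  "has_small_back_degrees V E \<kappa> \<longleftrightarrow>
     (\<exists>r. well_order_on V r \<and> (\<forall>x\<in>V. |{y \<in> V. (x, y) \<in> E \<and> y \<in> underS r x}| <o \<kappa>))"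

definition coloring_number :: "'a set \<Rightarrow> 'a rel \<Rightarrow> 'a rel" where
  "coloring_number V E = least_cardinal (has_small_back_degrees V E)"

section \<open>Semialgebraic sets and graphs\<close>

text \<open>
  First-order formulas, with real parameters, in the language $+, \cdot, 0, 1, \le$ of ordered
  rings (the remaining connectives and the universal quantifier being definable).
\<close>

datatype tm = Var nat | Param real | Zero | One | Plus tm tm | Times tm tm

datatype fm = Eq tm tm | Leq tm tm | Neg fm | And fm fm | Exi nat fm

primrec tm_val :: "(nat \<Rightarrow> real) \<Rightarrow> tm \<Rightarrow> real" where
  "tm_val e (Var i) = e i"
| "tm_val e (Param c) = c"
| "tm_val e Zero = 0"
| "tm_val e One = 1"
| "tm_val e (Plus s t) = tm_val e s + tm_val e t"
| "tm_val e (Times s t) = tm_val e s * tm_val e t"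

primrec sat :: "(nat \<Rightarrow> real) \<Rightarrow> fm \<Rightarrow> bool" where
  "sat e (Eq s t) \<longleftrightarrow> tm_val e s = tm_val e t"
| "sat e (Leq s t) \<longleftrightarrow> tm_val e s \<le> tm_val e t"
| "sat e (Neg p) \<longleftrightarrow> \<not> sat e p"
| "sat e (And p q) \<longleftrightarrow> sat e p \<and> sat e q"
| "sat e (Exi i p) \<longleftrightarrow> (\<exists>c. sat (e(i := c)) p)"

primrec tm_vars :: "tm \<Rightarrow> nat set" where
  "tm_vars (Var i) = {i}"
| "tm_vars (Param c) = {}"
| "tm_vars Zero = {}"
| "tm_vars One = {}"
| "tm_vars (Plus s t) = tm_vars s \<union> tm_vars t"
| "tm_vars (Times s t) = tm_vars s \<union> tm_vars t"

primrec free_vars :: "fm \<Rightarrow> nat set" where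
  "free_vars (Eq s t) = tm_vars s \<union> tm_vars t"
| "free_vars (Leq s t) = tm_vars s \<union> tm_vars t"
| "free_vars (Neg p) = free_vars p"
| "free_vars (And p q) = free_vars p \<union> free_vars q"
| "free_vars (Exi i p) = free_vars p - {i}"

text \<open>
  Points of $\mathbb{R}^n$ are lists of length \<open>n\<close>, so that \<open>n\<close> may be any natural number
  and $\mathbb{R}^n \times \mathbb{R}^n$ is identified with $\mathbb{R}^{2n}$ by concatenation.
  The values \<open>xs ! i\<close> with \<open>i \<ge> n\<close> are irrelevant since they are never used for a free
  variable.
\<close>

definition semialgebraic :: "nat \<Rightarrow> real list set \<Rightarrow> bool" where
  "semialgebraic n X \<longleftrightarrow>
     (\<exists>p. free_vars p \<subseteq> {..<n} \<and> X = {xs. length xs = n \<and> sat (\<lambda>i. xs ! i) p})"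

definition semialgebraic_graph :: "nat \<Rightarrow> real list set \<Rightarrow> real list rel \<Rightarrow> bool" where
  "semialgebraic_graph n V E \<longleftrightarrow>
     graph V E \<and> semialgebraic n V \<and> semialgebraic (2 * n) {xs @ ys | xs ys. (xs, ys) \<in> E}"

section \<open>The invariants are well defined\<close>

lemma is_least_cardinal_least_cardinal:
  assumes "Card_order \<kappa>" "P \<kappa>"
  shows "is_least_cardinal P (least_cardinal P)"
proof -
  let ?R = "{\<mu>. Card_order \<mu> \<and> P \<mu>}"
  have "?R \<noteq> {}" using assms by blast
  then obtain \<mu> where "\<mu> \<in> ?R" "\<forall>\<mu>'\<in>?R. \<mu> \<le>o \<mu>'"
    using exists_minim_Card_order[of ?R] by blast
  then have "is_least_cardinal P \<mu>" by (auto simp: is_least_cardinal_def)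
  then show ?thesis unfolding least_cardinal_def by (rule someI)
qed

lemma choosable_any_color_type:
  fixes \<kappa> :: "'k rel" and \<Lambda> :: "'a \<Rightarrow> 'c set"
  assumes "Card_order \<kappa>" and ch: "choosable V E \<kappa>" and L: "listing V \<kappa> \<Lambda>"
  obtains \<phi> where "list_coloring V \<Lambda> \<phi>" "proper_coloring V E \<phi>"
proof -
  have "\<exists>h. bij_betw h (\<Lambda> x) (Field \<kappa>)" if "x \<in> V" for x
  proof -
    have "|\<Lambda> x| =o |Field \<kappa>|"
      using L that card_of_Field_ordIso[OF assms(1)] ordIso_symmetric ordIso_transitive
      unfolding listing_def by blast
    then show ?thesis by (simp add: card_of_ordIso)
  qed
  then obtain h where h: "\<And>x. x \<in> V \<Longrightarrow> bij_betw (h x) (\<Lambda> x) (Field \<kappa>)" by metis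
  let ?U = "\<Union>x\<in>V. \<Lambda> x"
  have "\<exists>x. x \<in> V \<and> c \<in> \<Lambda> x" if "c \<in> ?U" for c using that by blast
  then obtain k where k: "\<And>c. c \<in> ?U \<Longrightarrow> k c \<in> V \<and> c \<in> \<Lambda> (k c)" by metis
  define g where "g c = (k c, h (k c) c)" for c
  have inj: "inj_on g ?U"
  proof (rule inj_onI)
    fix c d assume cd: "c \<in> ?U" "d \<in> ?U" "g c = g d"
    then have "k c = k d" "h (k c) c = h (k c) d" by (auto simp: g_def)
    then show "c = d"
      using k[OF cd(1)] k[OF cd(2)] h[of "k c"] by (metis bij_betw_def inj_onD)
  qed
  have injx: "inj_on g (\<Lambda> x)" if "x \<in> V" for x
    using inj that by (meson UN_upper inj_on_subset)
  have "listing V \<kappa> (\<lambda>x. g ` \<Lambda> x)"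
    unfolding listing_def
  proof
    fix x assume x: "x \<in> V"
    have "|g ` \<Lambda> x| =o |\<Lambda> x|"
      using injx[OF x] by (meson bij_betw_imageI card_of_ordIso ordIso_symmetric)
    then show "|g ` \<Lambda> x| =o \<kappa>" using L x unfolding listing_def by (meson ordIso_transitive)
  qed
  then obtain \<psi> where \<psi>: "list_coloring V (\<lambda>x. g ` \<Lambda> x) \<psi>" "proper_coloring V E \<psi>"
    using ch unfolding choosable_def by blast
  have "\<exists>c. c \<in> \<Lambda> x \<and> g c = \<psi> x" if "x \<in> V" for x
    using \<psi>(1) that unfolding list_coloring_def by (metis (no_types, lifting) imageE)
  then obtain \<phi> where \<phi>: "\<And>x. x \<in> V \<Longrightarrow> \<phi> x \<in> \<Lambda> x \<and> g (\<phi> x) = \<psi> x" by metis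
  have "list_coloring V \<Lambda> \<phi>" using \<phi> by (auto simp: list_coloring_def)
  moreover have "proper_coloring V E \<phi>"
    using \<phi> \<psi>(2) unfolding proper_coloring_def by metis
  ultimately show ?thesis by (rule that)
qed

lemma choosable_ordIso:
  fixes \<kappa> :: "'k rel" and \<mu> :: "'l rel"
  assumes "Card_order \<kappa>" "\<kappa> =o \<mu>" "choosable V E \<kappa>"
  shows "choosable V E \<mu>"
  unfolding choosable_def
proof (intro allI impI)
  fix \<Lambda> :: "'a \<Rightarrow> ('a \<times> 'l) set" assume "listing V \<mu> \<Lambda>"
  then have "listing V \<kappa> \<Lambda>"
    using assms(2) unfolding listing_def by (meson ordIso_symmetric ordIso_transitive)
  then show "\<exists>\<phi>. list_coloring V \<Lambda> \<phi> \<and> proper_coloring V E \<phi>"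
    using choosable_any_color_type[OF assms(1,3)] by metis
qed

lemma choosable_card_vertices:
  assumes "graph V E"
  shows "choosable V E |V|"
  unfolding choosable_def
proof (intro allI impI)
  fix \<Lambda> :: "'a \<Rightarrow> ('a \<times> 'a) set" assume L: "listing V |V| \<Lambda>"
  let ?r = "|V|"
  define R where "R = ?r - Id"
  have wo: "Well_order ?r" using card_of_Well_order .
  then have wf: "wf R" unfolding R_def well_order_on_def by blast
  define F where "F f x = (SOME c. c \<in> \<Lambda> x \<and> c \<notin> f ` underS ?r x)"
    for f :: "'a \<Rightarrow> 'a \<times> 'a" and x
  define \<phi> where "\<phi> = wfrec R F"
  have eq: "\<phi> x = F \<phi> x" for x
  proof -
    have "\<phi> x = F (cut \<phi> R x) x" unfolding \<phi>_def using wf by (simp add: wfrec)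
    also have "cut \<phi> R x ` underS ?r x = \<phi> ` underS ?r x"
      by (rule image_cong) (auto simp: cut_def R_def underS_def)
    then have "F (cut \<phi> R x) x = F \<phi> x" by (simp add: F_def)
    finally show ?thesis .
  qed
  have \<phi>: "\<phi> x \<in> \<Lambda> x \<and> \<phi> x \<notin> \<phi> ` underS ?r x" if x: "x \<in> V" for x
  proof -
    have "|\<phi> ` underS ?r x| <o |V|"
      using card_of_underS[OF card_of_Card_order, of x V] x card_of_image ordLeq_ordLess_trans
      by (metis Field_card_of)
    moreover have "|V| =o |\<Lambda> x|"
      using L x unfolding listing_def by (meson ordIso_symmetric)
    ultimately have "|\<phi> ` underS ?r x| <o |\<Lambda> x|" by (rule ordLess_ordIso_trans)
    then have "\<not> \<Lambda> x \<subseteq> \<phi> ` underS ?r x"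
      using card_of_mono1 not_ordLess_ordLeq by blast
    then have "\<exists>c. c \<in> \<Lambda> x \<and> c \<notin> \<phi> ` underS ?r x" by blast
    then show ?thesis unfolding eq[of x] F_def by (rule someI_ex)
  qed
  have "\<phi> x \<noteq> \<phi> y" if xy: "x \<in> V" "y \<in> V" "(x, y) \<in> E" for x y
  proof -
    have "x \<noteq> y" using assms xy by (auto simp: graph_def irrefl_def)
    moreover have "total_on V ?r"
      using card_of_well_order_on[of V]
      unfolding well_order_on_def linear_order_on_def by blast
    ultimately have "x \<in> underS ?r y \<or> y \<in> underS ?r x"
      using xy by (auto simp: underS_def total_on_def)
    then show ?thesis using \<phi>[OF xy(1)] \<phi>[OF xy(2)] by (metis imageI)
  qed
  then show "\<exists>\<phi>. list_coloring V \<Lambda> \<phi> \<and> proper_coloring V E \<phi>"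
    using \<phi> by (auto simp: list_coloring_def proper_coloring_def intro!: exI[of _ \<phi>])
qed

lemma has_small_back_degrees_ordIso:
  fixes \<kappa> :: "'k rel" and \<mu> :: "'l rel"
  assumes "\<kappa> =o \<mu>" "has_small_back_degrees V E \<kappa>"
  shows "has_small_back_degrees V E \<mu>"
  using assms unfolding has_small_back_degrees_def by (meson ordLess_ordIso_trans)

lemma has_small_back_degrees_card_vertices: "has_small_back_degrees V E |V|"
  unfolding has_small_back_degrees_def
proof (intro exI conjI ballI)
  show "well_order_on V |V|" by (rule card_of_well_order_on)
  fix x assume "x \<in> V"
  then have "|underS |V| x| <o |V|"
    using card_of_underS[OF card_of_Card_order, of x V] by (simp add: Field_card_of)
  then show "|{y \<in> V. (x, y) \<in> E \<and> y \<in> underS |V| x}| <o |V|"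
    by (rule ordLeq_ordLess_trans[rotated]) (rule card_of_mono1, blast)
qed

lemma least_cardinal_ordLeq:
  fixes P :: "'k rel \<Rightarrow> bool" and \<mu> :: "'l rel"
  assumes "is_least_cardinal P \<kappa>" "Card_order \<mu>"
    and P: "\<And>\<mu>'. Card_order \<mu>' \<Longrightarrow> \<mu> =o \<mu>' \<Longrightarrow> P \<mu>'"
  shows "\<kappa> \<le>o \<mu>"
proof (cases "|UNIV :: 'k set| \<le>o |Field \<mu>|")
  case True
  have "\<kappa> =o |Field \<kappa>|"
    using assms(1) ordIso_symmetric[OF card_of_Field_ordIso[of \<kappa>]]
    unfolding is_least_cardinal_def by blast
  moreover have "|Field \<kappa>| \<le>o |UNIV :: 'k set|" by (rule card_of_mono1) simp
  ultimately have "\<kappa> \<le>o |UNIV :: 'k set|" by (rule ordIso_ordLeq_trans)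
  then have "\<kappa> \<le>o |Field \<mu>|" using True by (rule ordLeq_transitive)
  then show ?thesis using card_of_Field_ordIso[OF assms(2)] by (rule ordLeq_ordIso_trans)
next
  case False
  then have "|Field \<mu>| \<le>o |UNIV :: 'k set|"
    using ordLeq_total[OF card_of_Well_order card_of_Well_order] by blast
  then obtain f :: "'l \<Rightarrow> 'k" where f: "inj_on f (Field \<mu>)"
    using card_of_ordLeq by metis
  then have "|Field \<mu>| =o |f ` Field \<mu>|" by (meson bij_betw_imageI card_of_ordIso)
  then have iso: "\<mu> =o |f ` Field \<mu>|"
    by (rule ordIso_transitive[OF ordIso_symmetric[OF card_of_Field_ordIso[OF assms(2)]]])
  then have "\<kappa> \<le>o |f ` Field \<mu>|"
    using P[OF card_of_Card_order iso] assms(1) card_of_Card_order[of "f ` Field \<mu>"]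
    unfolding is_least_cardinal_def by blast
  then show ?thesis using ordIso_symmetric[OF iso] by (rule ordLeq_ordIso_trans)
qed

lemma list_chromatic_number_is_least:
  "graph V E \<Longrightarrow> is_least_cardinal (choosable V E) (list_chromatic_number V E)"
  unfolding list_chromatic_number_def
  using is_least_cardinal_least_cardinal[of "|V|" "choosable V E"]
    card_of_Card_order choosable_card_vertices by blast

lemma coloring_number_is_least:
  "is_least_cardinal (has_small_back_degrees V E) (coloring_number V E)"
  unfolding coloring_number_def
  using is_least_cardinal_least_cardinal[of "|V|" "has_small_back_degrees V E"]
    card_of_Card_order has_small_back_degrees_card_vertices by blast

lemma list_chromatic_number_least:
  fixes \<mu> :: "'k rel"
  assumes "graph V E" "Card_order \<mu>" "choosable V E \<mu>"
  shows "list_chromatic_number V E \<le>o \<mu>"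
  using list_chromatic_number_is_least[OF assms(1)] assms(2)
  by (rule least_cardinal_ordLeq) (rule choosable_ordIso[OF assms(2) _ assms(3)])

lemma coloring_number_least:
  fixes \<mu> :: "'k rel"
  assumes "Card_order \<mu>" "has_small_back_degrees V E \<mu>"
  shows "coloring_number V E \<le>o \<mu>"
  using coloring_number_is_least assms(1)
  by (rule least_cardinal_ordLeq) (rule has_small_back_degrees_ordIso[OF _ assms(2)])

end

theory Submission
  imports Defs "HOL-Analysis.Abstract_Topology_2" "HOL-Computational_Algebra.Polynomial"
begin

text \<open>
  The four conditions are linked in a cycle: finite back degrees give countable list colorings,
  these exclude \<open>K(2\<^sup>\<omega>, 2\<^sup>\<omega>)\<close>, a semialgebraic graph without \<open>K(2\<^sup>\<omega>, 2\<^sup>\<omega>)\<close> omits some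
  \<open>K(m, m)\<close>, and a graph without \<open>K(m, m)\<close> has finite back degrees in a suitable well-order. Only
  the third implication uses that the graph is semialgebraic.

  Finite back degrees allow a greedy coloring from infinite lists
  (\<open>choosable_if_finite_back_degrees\<close>). The graph \<open>K(\<omega>, 2\<^sup>\<omega>)\<close> is not colorable from all
  countable lists: give disjoint countable lists to the countable side and, for each way of choosing
  one color from each of them, a vertex of the other side whose list is the set of chosen colors
  (\<open>not_choosable_if_contains_continuum\<close>). That omitting \<open>K(m, m)\<close> bounds the coloring number is a
  theorem of Erdos and Hajnal (\<open>erdos_hajnal_coloring_number\<close>): cut the vertex set into smaller
  pieces along a chain of sets closed under common neighbors of \<open>m\<close> vertices. Then each vertex has
  fewer than \<open>m\<close> neighbors in the closed set preceding its piece, and induction on the cardinality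
  treats the pieces.

  The core is that a semialgebraic relation \<open>E\<close> containing arbitrarily large finite \<open>K(m, m)\<close>
  contains \<open>K(2\<^sup>\<omega>, 2\<^sup>\<omega>)\<close> (\<open>semialg_complete_bipartite\<close>). By \<open>uniform_cells\<close>, there are finitely
  many semialgebraic families of cells such that, whenever \<open>A\<close> is finite and \<open>E(a, b)\<close> holds for all
  \<open>a \<in> A\<close>, the point \<open>b\<close> lies in a cell that is defined from boundedly many elements of \<open>A\<close> and is
  entirely related to every \<open>a \<in> A\<close>. For fixed \<open>A\<close> there are only polynomially many such cells, so
  among sufficiently many points \<open>b\<close> many lie in the same cell. Semialgebraic families enjoy uniform
  finiteness (\<open>semialg_uniform_finiteness\<close>): a member with more points than a bound depending only
  on the family has continuum many. Applied to the cells and to the sets of common neighbors of the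
  cells, this turns a large finite complete bipartite graph into one of size continuum.

  Both results rest on one fact about the line, \<open>semialg_alternates_bounded\<close>: as one real variable
  runs from left to right, a semialgebraic condition changes its truth value only boundedly often,
  uniformly in the other variables. This is clear for Boolean combinations of polynomial
  inequalities, and \<open>semialg_ex\<close>, the Tarski-Seidenberg theorem, reduces first-order formulas to
  these. Quantifier elimination is obtained without manipulating formulas, following Cohen and
  Hoermander: the signs of finitely many polynomials in the parameters determine, up to an order
  isomorphism of the line, the signs that a given finite family of polynomials takes along the line
  (\<open>signs_determined\<close>).
\<close>

section \<open>Polynomial functions and semialgebraic predicates\<close>

text \<open>
  Tuples of real variables are elements of arbitrary types built from the reals by pairs and indexed
  families. Thus no variable needs a name: quantification over one more real variable is a passage
  from a type to its product with the reals. A family may be infinite, since a polynomial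
  involves only finitely many of its members.
\<close>

class coordinates =
  fixes coords :: "('a \<Rightarrow> real) set"

instantiation real :: coordinates
begin
definition coords_real :: "(real \<Rightarrow> real) set" where "coords_real = {\<lambda>x. x}"
instance ..
end

instantiation prod :: (coordinates, coordinates) coordinates
begin
definition coords_prod :: "('a \<times> 'b \<Rightarrow> real) set" where
  "coords_prod = (\<lambda>x. x \<circ> fst) ` coords \<union> (\<lambda>x. x \<circ> snd) ` coords"
instance ..
end

instantiation "fun" :: (type, coordinates) coordinates
begin
definition coords_fun :: "(('a \<Rightarrow> 'b) \<Rightarrow> real) set" where
  "coords_fun = {\<lambda>f. x (f i) | x i. x \<in> coords}"
instance ..
end

inductive polyfun :: "('a::coordinates \<Rightarrow> real) \<Rightarrow> bool" where
  coord: "x \<in> coords \<Longrightarrow> polyfun x"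
| const: "polyfun (\<lambda>e. c)"
| add: "polyfun p \<Longrightarrow> polyfun q \<Longrightarrow> polyfun (\<lambda>e. p e + q e)"
| mult: "polyfun p \<Longrightarrow> polyfun q \<Longrightarrow> polyfun (\<lambda>e. p e * q e)"

text \<open>
  The maps along which polynomial functions, and hence semialgebraic predicates, can be pulled back.
\<close>

definition polymap :: "('a::coordinates \<Rightarrow> 'b::coordinates) \<Rightarrow> bool" where
  "polymap f \<longleftrightarrow> (\<forall>x\<in>coords. polyfun (\<lambda>e. x (f e)))"

lemma polyfun_comp: "polyfun p \<Longrightarrow> polymap f \<Longrightarrow> polyfun (\<lambda>e. p (f e))"
  by (induction p rule: polyfun.induct) (auto simp: polymap_def intro: polyfun.intros)

lemma polymap_real: "polymap (p :: 'a::coordinates \<Rightarrow> real) \<longleftrightarrow> polyfun p"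
  by (auto simp: polymap_def coords_real_def)

lemma polymap_id: "polymap (\<lambda>e. e)"
  by (auto simp: polymap_def intro: polyfun.coord)

lemma polymap_Pair: "polymap f \<Longrightarrow> polymap g \<Longrightarrow> polymap (\<lambda>e. (f e, g e))"
  by (auto simp: polymap_def coords_prod_def)

lemma polymap_fst: "polymap f \<Longrightarrow> polymap (\<lambda>e. fst (f e))"
  by (force simp: polymap_def coords_prod_def)

lemma polymap_snd: "polymap f \<Longrightarrow> polymap (\<lambda>e. snd (f e))"
  by (force simp: polymap_def coords_prod_def)

lemma polymap_apply: "polymap f \<Longrightarrow> polymap (\<lambda>e. f e i)"
  by (auto simp: polymap_def coords_fun_def)

lemma polymap_abs: "(\<And>i. polymap (\<lambda>e. f e i)) \<Longrightarrow> polymap (\<lambda>e i. f e i)"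
  by (auto simp: polymap_def coords_fun_def)

lemma polymap_If:
  "(b \<Longrightarrow> polymap f) \<Longrightarrow> (\<not> b \<Longrightarrow> polymap g) \<Longrightarrow> polymap (\<lambda>e. if b then f e else g e)"
  by (cases b) auto

lemma polymap_const: "polymap (\<lambda>e. c)"
  by (auto simp: polymap_def intro: polyfun.const)

lemma polymap_fun_upd: "polymap f \<Longrightarrow> polymap g \<Longrightarrow> polymap (\<lambda>e. (f e)(i := g e))"
  by (auto simp: fun_upd_def intro!: polymap_abs polymap_If intro: polymap_apply)

text \<open>
  The order of this list matters to proofs that apply the first matching rule repeatedly: by
  higher-order unification the last rule fits almost every goal, and it undoes the rule before it, so
  all other rules have to be tried first.
\<close>

lemmas polymap_rules = polymap_id polymap_const polymap_Pair polymap_fst polymap_snd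
  polymap_fun_upd polymap_abs polymap_apply

lemma polyfun_minus: "polyfun p \<Longrightarrow> polyfun (\<lambda>e. - p e)"
  using polyfun.mult[OF polyfun.const[of "-1"]] by fastforce

lemma polyfun_diff: "polyfun p \<Longrightarrow> polyfun q \<Longrightarrow> polyfun (\<lambda>e. p e - q e)"
  using polyfun.add[OF _ polyfun_minus] by fastforce

lemma polyfun_if: "(b \<Longrightarrow> polyfun p) \<Longrightarrow> (\<not> b \<Longrightarrow> polyfun q) \<Longrightarrow> polyfun (\<lambda>e. if b then p e else q e)"
  by (cases b) auto

lemmas polyfun_arith = polyfun.const polyfun.add polyfun.mult polyfun_diff polyfun_if

lemma polyfun_sum: "(\<And>i. i \<in> A \<Longrightarrow> polyfun (f i)) \<Longrightarrow> polyfun (\<lambda>e. \<Sum>i\<in>A. f i e)"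
proof (induction A rule: infinite_finite_induct)
  case (insert x F)
  then show ?case using polyfun.add[of "f x" "\<lambda>e. \<Sum>i\<in>F. f i e"] by simp
qed (auto intro: polyfun.const)

definition same_signs :: "('a \<Rightarrow> real) set \<Rightarrow> 'a \<Rightarrow> 'a \<Rightarrow> bool" where
  "same_signs G e e' \<longleftrightarrow> (\<forall>p\<in>G. sgn (p e) = sgn (p e'))"

lemma same_signs_sym: "same_signs G e e' \<Longrightarrow> same_signs G e' e"
  by (auto simp: same_signs_def)

lemma same_signs_Un: "same_signs (G \<union> H) e e' \<longleftrightarrow> same_signs G e e' \<and> same_signs H e e'"
  by (auto simp: same_signs_def)

text \<open>
  The truth value depends only on the signs of finitely many polynomials. As there are only finitely
  many sign patterns, this amounts to being a Boolean combination of polynomial inequalities with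
  real coefficients, but needs no syntax of formulas: closure under Boolean operations and under
  polynomial substitution is immediate.
\<close>

definition semialg :: "('a::coordinates \<Rightarrow> bool) \<Rightarrow> bool" where
  "semialg P \<longleftrightarrow> (\<exists>G. finite G \<and> (\<forall>p\<in>G. polyfun p) \<and> (\<forall>e e'. same_signs G e e' \<longrightarrow> P e = P e'))"

named_theorems semialg_intros

lemma semialg_const [semialg_intros]: "semialg (\<lambda>e. b)"
  unfolding semialg_def by (rule exI[of _ "{}"]) auto

lemma semialg_not [semialg_intros]: "semialg P \<Longrightarrow> semialg (\<lambda>e. \<not> P e)"
  unfolding semialg_def by meson

lemma semialg_conj [semialg_intros]:
  assumes "semialg P" "semialg Q" shows "semialg (\<lambda>e. P e \<and> Q e)"
proof -
  obtain G H where "finite G" "\<forall>p\<in>G. polyfun p" "\<And>e e'. same_signs G e e' \<Longrightarrow> P e = P e'"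
    "finite H" "\<forall>p\<in>H. polyfun p" "\<And>e e'. same_signs H e e' \<Longrightarrow> Q e = Q e'"
    using assms unfolding semialg_def by blast
  then show ?thesis
    unfolding semialg_def by (intro exI[of _ "G \<union> H"]) (auto simp: same_signs_Un)
qed

lemma semialg_imp [semialg_intros]: "semialg P \<Longrightarrow> semialg Q \<Longrightarrow> semialg (\<lambda>e. P e \<longrightarrow> Q e)"
  using semialg_not[OF semialg_conj[OF _ semialg_not], of P Q] by simp

lemma semialg_comp: "semialg P \<Longrightarrow> polymap f \<Longrightarrow> semialg (\<lambda>e. P (f e))"
  unfolding semialg_def
proof (elim exE conjE)
  fix G assume G: "finite G" "\<forall>p\<in>G. polyfun p" "\<forall>e e'. same_signs G e e' \<longrightarrow> P e = P e'"
    and f: "polymap f"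
  then show "\<exists>G. finite G \<and> (\<forall>p\<in>G. polyfun p) \<and>
      (\<forall>e e'. same_signs G e e' \<longrightarrow> P (f e) = P (f e'))"
    by (intro exI[of _ "(\<lambda>p e. p (f e)) ` G"]) (auto simp: same_signs_def polyfun_comp)
qed

lemma semialg_less [semialg_intros]:
  assumes "polymap p" "polymap q" shows "semialg (\<lambda>e. p e < (q e :: real))"
  unfolding semialg_def
proof (intro exI[of _ "{\<lambda>e. q e - p e}"] conjI allI impI)
  fix e e' assume "same_signs {\<lambda>e. q e - p e} e e'"
  then have "sgn (q e - p e) = sgn (q e' - p e')" by (simp add: same_signs_def)
  then show "(p e < q e) = (p e' < q e')" by (auto simp: sgn_if split: if_splits)
qed (use assms in \<open>auto simp: polymap_real intro: polyfun_diff\<close>)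

lemma semialg_le [semialg_intros]:
  "polymap p \<Longrightarrow> polymap q \<Longrightarrow> semialg (\<lambda>e. p e \<le> (q e :: real))"
  using semialg_not[OF semialg_less[of q p]] by (simp add: not_less)

lemma semialg_eq [semialg_intros]:
  "polymap p \<Longrightarrow> polymap q \<Longrightarrow> semialg (\<lambda>e. p e = (q e :: real))"
  using semialg_conj[OF semialg_le semialg_le, of p q q p] by (simp add: order_eq_iff)

section \<open>Polynomials with polynomial coefficients\<close>

text \<open>
  Polynomials in one distinguished variable whose coefficients are polynomial functions of the
  parameters. Only the bound on the degree is uniform; the degree itself may drop at special
  parameters.
\<close>

definition param_poly :: "nat \<Rightarrow> ('a::coordinates \<Rightarrow> real poly) \<Rightarrow> bool" where
  "param_poly d F \<longleftrightarrow> (\<forall>k. polyfun (\<lambda>e. coeff (F e) k)) \<and> (\<forall>e. degree (F e) \<le> d)"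

lemma param_poly_mono: "param_poly d F \<Longrightarrow> d \<le> d' \<Longrightarrow> param_poly d' F"
  by (auto simp: param_poly_def intro: order_trans)

lemma param_poly_const: "polyfun p \<Longrightarrow> param_poly 0 (\<lambda>e. [:p e:])"
  unfolding param_poly_def
proof (intro conjI allI)
  fix k assume "polyfun p"
  then show "polyfun (\<lambda>e. coeff [:p e:] k)" by (cases k) (auto intro: polyfun.const)
qed simp

lemma param_poly_add:
  "param_poly d F \<Longrightarrow> param_poly d' G \<Longrightarrow> param_poly (max d d') (\<lambda>e. F e + G e)"
  by (auto simp: param_poly_def intro!: polyfun.add degree_add_le
      intro: max.coboundedI1 max.coboundedI2)

lemma param_poly_mult:
  assumes "param_poly d F" "param_poly d' G" shows "param_poly (d + d') (\<lambda>e. F e * G e)"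
proof -
  have "degree (F e * G e) \<le> d + d'" for e
    using degree_mult_le[of "F e" "G e"] assms unfolding param_poly_def
    by (meson add_mono order_trans)
  moreover have "polyfun (\<lambda>e. coeff (F e * G e) k)" for k
    unfolding coeff_mult using assms
    by (intro polyfun_sum polyfun.mult) (auto simp: param_poly_def)
  ultimately show ?thesis by (simp add: param_poly_def)
qed

lemma param_poly_pderiv:
  assumes "param_poly d F" shows "param_poly (d - 1) (\<lambda>e. pderiv (F e))"
  using assms unfolding param_poly_def
  by (auto simp: coeff_pderiv degree_pderiv diff_le_mono intro!: polyfun_arith)

text \<open>
  Division with remainder by a polynomial \<open>H\<close> of exact degree \<open>j + 1\<close>, with coefficients that stay
  polynomial in the parameters. To avoid denominators, the dividend is multiplied by the square of
  the leading coefficient in each step; a square, so that no sign changes. The degree of \<open>H\<close>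
  depends on the parameter; \<open>R\<close> is a remainder only where this degree is \<open>j + 1\<close>.
\<close>

lemma pseudo_remainder:
  fixes F H :: "'a::coordinates \<Rightarrow> real poly"
  assumes "param_poly d F" "param_poly d' H"
  obtains R where "param_poly j R"
    "\<And>e. degree (H e) = Suc j \<Longrightarrow> \<exists>s q. s > 0 \<and> smult s (F e) = q * H e + R e"
  using assms(1)
proof (induction d arbitrary: F thesis)
  case 0
  show ?case
  proof (rule "0.prems"(1)[of F])
    show "param_poly j F" using 0 param_poly_mono by blast
    fix e
    show "\<exists>s q. s > 0 \<and> smult s (F e) = q * H e + F e"
      by (intro exI[of _ 1] exI[of _ 0]) auto
  qed
next
  case (Suc d)
  show ?case
  proof (cases "Suc d \<le> j")
    case True
    show ?thesis
    proof (rule Suc.prems(1)[of F])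
      show "param_poly j F" using Suc.prems True param_poly_mono by blast
      fix e
      show "\<exists>s q. s > 0 \<and> smult s (F e) = q * H e + F e"
        by (intro exI[of _ 1] exI[of _ 0]) auto
    qed
  next
    case False
    then have jd: "j \<le> d" by simp
    let ?c = "\<lambda>e. coeff (H e) (Suc j)"
    let ?q = "\<lambda>e. monom (?c e * coeff (F e) (Suc d)) (d - j)"
    define F1 where "F1 e = smult (?c e * ?c e) (F e) - ?q e * H e" for e
    have coeff_H: "polyfun (\<lambda>e. coeff (H e) k)" for k using assms(2) by (simp add: param_poly_def)
    have coeff_F: "polyfun (\<lambda>e. coeff (F e) k)" for k using Suc.prems by (simp add: param_poly_def)
    have "polyfun (\<lambda>e. coeff (F1 e) k)" for k
      unfolding F1_def by (auto simp: coeff_monom_mult intro!: polyfun_arith coeff_H coeff_F)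
    \<comment> \<open>Cutting off enforces the degree bound at the parameters where \<open>H\<close> has another
      degree than \<open>j + 1\<close>.\<close>
    then have "param_poly d (\<lambda>e. poly_cutoff (Suc d) (F1 e))"
      by (auto simp: param_poly_def coeff_poly_cutoff intro!: degree_le polyfun_arith)
    from Suc.IH[OF _ this] obtain R where R: "param_poly j R"
      "\<And>e. degree (H e) = Suc j \<Longrightarrow> \<exists>s q. s > 0 \<and> smult s (poly_cutoff (Suc d) (F1 e)) = q * H e + R e"
      by blast
    show ?thesis
    proof (rule Suc.prems(1)[OF R(1)])
      fix e assume deg: "degree (H e) = Suc j"
      have cut: "poly_cutoff (Suc d) (F1 e) = F1 e"
      proof (rule poly_eqI)
        fix k
        have "coeff (F1 e) k = 0" if "k \<ge> Suc d"
        proof (cases "k = Suc d")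
          case True
          then show ?thesis using jd by (simp add: F1_def coeff_monom_mult Suc_diff_le)
        next
          case False
          then have "k > Suc d" using that by simp
          moreover have "degree (F e) \<le> Suc d" using Suc.prems by (simp add: param_poly_def)
          ultimately show ?thesis
            using jd deg by (simp add: F1_def coeff_monom_mult coeff_eq_0)
        qed
        then show "coeff (poly_cutoff (Suc d) (F1 e)) k = coeff (F1 e) k"
          by (auto simp: coeff_poly_cutoff)
      qed
      obtain s q where s: "s > 0" "smult s (F1 e) = q * H e + R e" using R(2)[OF deg] cut by auto
      have "?c e \<noteq> 0" using deg by (metis degree_0 leading_coeff_0_iff nat.distinct(1))
      then have "s * (?c e * ?c e) > 0"
        using s(1) not_real_square_gt_zero by (metis mult_pos_pos)
      moreover have "smult (s * (?c e * ?c e)) (F e) = (q + smult s (?q e)) * H e + R e"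
      proof -
        have "smult (s * (?c e * ?c e)) (F e) = smult s (F1 e) + smult s (?q e * H e)"
          unfolding F1_def by (simp add: smult_diff_right)
        then show ?thesis unfolding s(2) by (simp add: algebra_simps)
      qed
      ultimately show "\<exists>s q. s > 0 \<and> smult s (F e) = q * H e + R e" by blast
    qed
  qed
qed

text \<open>
  The distinguished variable is the last one, that is, the second component of the pair.
\<close>

lemma polyfun_as_param_poly:
  fixes p :: "'a::coordinates \<times> real \<Rightarrow> real"
  assumes "polyfun p"
  obtains d F where "param_poly d F" "\<And>e c. p (e, c) = poly (F e) c"
  using assms
proof (induction p arbitrary: thesis rule: polyfun.induct)
  case (coord x)
  then consider (1) y where "y \<in> coords" "x = (\<lambda>z. y (fst z))" | (2) "x = snd"
    by (auto simp: coords_prod_def coords_real_def o_def)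
  then show ?case
  proof cases
    case 1
    then show ?thesis using coord(2)[OF param_poly_const[OF polyfun.coord[OF 1(1)]]] by simp
  next
    case 2
    have "param_poly 1 (\<lambda>e::'a. [:0, 1:])"
      by (auto simp: param_poly_def intro: polyfun.const)
    then show ?thesis using coord(2) 2 by auto
  qed
next
  case (const c)
  then show ?case using param_poly_const[OF polyfun.const[of c]] by force
next
  case (add p q)
  obtain d F d' H where "param_poly d F" "\<And>e c. p (e, c) = poly (F e) c"
    "param_poly d' H" "\<And>e c. q (e, c) = poly (H e) c" using add.IH by metis
  then show ?case by (intro add.prems[OF param_poly_add]) auto
next
  case (mult p q)
  obtain d F d' H where "param_poly d F" "\<And>e c. p (e, c) = poly (F e) c"
    "param_poly d' H" "\<And>e c. q (e, c) = poly (H e) c" using mult.IH by metis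
  then show ?case by (intro mult.prems[OF param_poly_mult]) auto
qed

section \<open>Transferring signs of real polynomials along the line\<close>

text \<open>
  A finite partial order isomorphism of the line extends to a total one: continue affinely between
  neighboring points, here one point at a time from left to right.
\<close>

lemma strict_mono_extension:
  fixes \<phi> :: "real \<Rightarrow> real"
  assumes "finite W" "strict_mono_on W \<phi>"
  shows "\<exists>h. strict_mono h \<and> surj h \<and> (\<forall>w\<in>W. h w = \<phi> w)"
  using assms
proof (induction W rule: finite_linorder_max_induct)
  case empty
  show ?case by (intro exI[of _ "\<lambda>x. x"]) (auto simp: strict_mono_def)
next
  case (insert b A)
  show ?case
  proof (cases "A = {}")
    case True
    have "surj (\<lambda>x::real. x - b + \<phi> b)" by (rule surjI[of _ "\<lambda>y. y + b - \<phi> b"]) simp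
    with True show ?thesis
      by (intro exI[of _ "\<lambda>x. x - b + \<phi> b"]) (auto simp: strict_mono_def)
  next
    case False
    define m where "m = Max A"
    have m: "m \<in> A" "\<And>a. a \<in> A \<Longrightarrow> a \<le> m" using False insert.hyps by (auto simp: m_def)
    then have mb: "m < b" "\<phi> m < \<phi> b"
      using insert by (auto simp: strict_mono_on_def)
    obtain h where h: "strict_mono h" "surj h" "\<forall>w\<in>A. h w = \<phi> w"
      using insert.IH insert.prems by (auto simp: strict_mono_on_def)
    define s where "s = (\<phi> b - \<phi> m) / (b - m)"
    have s: "s > 0" using mb by (simp add: s_def)
    define h' where "h' x = (if x \<le> m then h x else h m + s * (x - m))" for x
    have "h' x < h' y" if "x < y" for x y
    proof (cases "y \<le> m")
      case True
      then show ?thesis using that h(1) by (auto simp: h'_def strict_mono_def)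
    next
      case y: False
      show ?thesis
      proof (cases "x \<le> m")
        case True
        then have "h x \<le> h m" using h(1) by (simp add: strict_mono_less_eq)
        moreover have "s * (y - m) > 0" using s y by simp
        ultimately show ?thesis using True y by (simp add: h'_def)
      next
        case False
        then show ?thesis using that y s by (simp add: h'_def)
      qed
    qed
    then have "strict_mono h'" by (simp add: strict_mono_def)
    moreover have "\<exists>x. h' x = y" for y
    proof (cases "y \<le> h m")
      case True
      obtain x where "h x = y" using h(2) by (metis surjD)
      moreover from this True have "x \<le> m" using strict_mono_less_eq[OF h(1)] by blast
      ultimately show ?thesis by (auto simp: h'_def)
    next
      case False
      then have "m + (y - h m) / s > m" using s by simp
      then have "h' (m + (y - h m) / s) = y" using s by (simp add: h'_def)
      then show ?thesis ..
    qed
    then have "surj h'" unfolding surj_def by metis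
    moreover have "h' w = \<phi> w" if "w \<in> insert b A" for w
    proof (cases "w = b")
      case True
      then show ?thesis using mb h(3) m by (simp add: h'_def s_def)
    next
      case False
      then show ?thesis using that m h(3) by (auto simp: h'_def)
    qed
    ultimately show ?thesis by blast
  qed
qed

text \<open>
  Either \<open>x\<close> and \<open>y\<close> are the same element of \<open>Z\<close>, or they lie in the same component of the
  complement of \<open>Z\<close>.
\<close>

definition same_gap :: "real set \<Rightarrow> real \<Rightarrow> real \<Rightarrow> bool" where
  "same_gap Z x y \<longleftrightarrow> (\<forall>z\<in>Z. (z < x \<longleftrightarrow> z < y) \<and> (x < z \<longleftrightarrow> y < z))"

lemma same_gap_refl [simp]: "same_gap Z x x" by (simp add: same_gap_def)
lemma same_gap_sym: "same_gap Z x y \<Longrightarrow> same_gap Z y x" by (simp add: same_gap_def)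
lemma same_gap_trans: "same_gap Z x y \<Longrightarrow> same_gap Z y w \<Longrightarrow> same_gap Z x w"
  by (simp add: same_gap_def)
lemma same_gap_in_iff: "same_gap Z x y \<Longrightarrow> x \<in> Z \<longleftrightarrow> y \<in> Z"
  unfolding same_gap_def by (metis linorder_neq_iff)

lemma same_gap_between:
  "same_gap Z w x \<Longrightarrow> same_gap Z w y \<Longrightarrow> x \<le> t \<Longrightarrow> t \<le> y \<Longrightarrow> same_gap Z w t"
  unfolding same_gap_def by (smt (verit, best))

lemma same_gap_image:
  "strict_mono (h :: real \<Rightarrow> real) \<Longrightarrow> same_gap (h ` Z) (h x) (h y) \<longleftrightarrow> same_gap Z x y"
  by (simp add: same_gap_def strict_mono_less)

lemma same_gap_uminus: "same_gap (uminus ` Z) (- x) (- y) \<longleftrightarrow> same_gap Z x y"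
  by (auto simp: same_gap_def)

lemma same_gap_left:
  assumes "x \<notin> Z" "\<And>w. w \<in> Z \<Longrightarrow> w < x \<Longrightarrow> w < t" "t \<le> x"
  shows "same_gap Z x t"
  unfolding same_gap_def
proof
  fix z assume "z \<in> Z"
  with assms(1) assms(2)[of z] assms(3) show "(z < x \<longleftrightarrow> z < t) \<and> (x < z \<longleftrightarrow> t < z)"
    by (cases "z < x") (auto simp: less_le)
qed

lemma poly_sgn_change:
  fixes p :: "real poly"
  assumes "sgn (poly p a) \<noteq> sgn (poly p b)" "a \<le> b"
  obtains x where "a \<le> x" "x \<le> b" "poly p x = 0"
proof -
  have "\<exists>x. a \<le> x \<and> x \<le> b \<and> poly p x = 0"
  proof (cases "poly p a = 0 \<or> poly p b = 0")
    case False
    then have "poly p a * poly p b < 0" "a < b"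
      using assms by (auto simp: sgn_if mult_less_0_iff le_less split: if_splits)
    then show ?thesis using poly_IVT[of a b p] by (meson less_imp_le)
  qed (use assms in auto)
  then show ?thesis using that by blast
qed

text \<open>
  By the intermediate value theorem: a change of sign would produce a root strictly inside a gap.
\<close>

lemma poly_sgn_same_gap:
  assumes "\<And>z. poly p z = 0 \<Longrightarrow> z \<in> Z" "same_gap Z x y" "x \<notin> Z"
  shows "sgn (poly p x) = sgn (poly p y)"
proof (rule ccontr)
  assume ne: "sgn (poly p x) \<noteq> sgn (poly p y)"
  have "\<exists>r. poly p r = 0 \<and> same_gap Z x r"
  proof (cases "x \<le> y")
    case True
    from poly_sgn_change[OF ne this] show ?thesis
      using same_gap_between[OF same_gap_refl assms(2)] by metis
  next
    case False
    then have "y \<le> x" by simp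
    from poly_sgn_change[OF ne[symmetric] this] show ?thesis
      using same_gap_between[OF assms(2) same_gap_refl] by metis
  qed
  then show False using assms same_gap_in_iff by blast
qed

lemma poly_increasing_if_pderiv_pos:
  fixes p :: "real poly"
  assumes "a < b" "\<And>x. a < x \<Longrightarrow> x < b \<Longrightarrow> poly (pderiv p) x > 0"
  shows "poly p a < poly p b"
proof -
  obtain x where "a < x" "x < b" "poly p b - poly p a = (b - a) * poly (pderiv p) x"
    using poly_MVT[OF assms(1)] by blast
  moreover have "(b - a) * poly (pderiv p) x > 0" using assms calculation by simp
  ultimately show ?thesis by simp
qed

text \<open>
  This is where polynomials differ from other increasing functions, which may stay negative: a
  positive derivative forces a positive leading coefficient, so the polynomial becomes positive far to
  the right.
\<close>

lemma poly_pos_if_pderiv_pos_at_top: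
  fixes p :: "real poly"
  assumes "\<And>x. x \<ge> a \<Longrightarrow> poly (pderiv p) x > 0"
  shows "\<exists>x\<ge>a. poly p x > 0"
proof -
  have "pderiv p \<noteq> 0" using assms[of a] by auto
  then have deg: "degree p \<noteq> 0" "lead_coeff p \<noteq> 0" by (auto simp: pderiv_eq_0_iff)
  have lc: "lead_coeff (pderiv p) = of_nat (degree p) * lead_coeff p"
    using deg by (simp add: degree_pderiv coeff_pderiv)
  have "lead_coeff p > 0"
  proof (rule ccontr)
    assume "\<not> lead_coeff p > 0"
    then have "lead_coeff p < 0" using deg by linarith
    then have "lead_coeff (pderiv p) < 0" unfolding lc using deg by (simp add: mult_pos_neg)
    then have "lead_coeff (- pderiv p) > 0" by simp
    then obtain n where "\<And>x. x \<ge> n \<Longrightarrow> poly (- pderiv p) x > 0"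
      using poly_pinfty_gt_lc[of "- pderiv p"] by (metis less_le_trans)
    from this[of "max n a"] assms[of "max n a"] show False by simp
  qed
  then obtain n where "\<And>x. x \<ge> n \<Longrightarrow> poly p x > 0"
    using poly_pinfty_gt_lc[of p] by (metis less_le_trans)
  then show ?thesis by (meson max.cobounded1 max.cobounded2)
qed

text \<open>
  The half turn of the graph about the origin exchanges left and right as well as positive and negative
  values, but keeps the sign of the derivative. It yields statements about left ends and positive
  values from their mirror images.
\<close>

definition point_reflection :: "real poly \<Rightarrow> real poly" where
  "point_reflection p = - pcompose p [:0, - 1:]"

lemma poly_point_reflection [simp]: "poly (point_reflection p) x = - poly p (- x)"
  by (simp add: point_reflection_def poly_pcompose)

lemma poly_pderiv_point_reflection [simp]:
  "poly (pderiv (point_reflection p)) x = poly (pderiv p) (- x)"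
  by (simp add: point_reflection_def pderiv_minus pderiv_pcompose poly_pcompose pderiv_pCons)

lemma poly_neg_if_pderiv_pos_at_bot:
  fixes p :: "real poly"
  assumes "\<And>x. x \<le> a \<Longrightarrow> poly (pderiv p) x > 0"
  shows "\<exists>x\<le>a. poly p x < 0"
proof -
  have "\<exists>x\<ge>-a. poly (point_reflection p) x > 0"
    by (rule poly_pos_if_pderiv_pos_at_top) (simp add: assms)
  then show ?thesis by (metis minus_le_iff neg_0_less_iff_less poly_point_reflection)
qed

text \<open>
  The polynomials \<open>p\<close> and \<open>p'\<close> increase on corresponding gaps of \<open>Z\<close> and of its image under \<open>h0\<close>, and
  they have the same signs at the ends of these gaps. An increasing polynomial takes a negative value on a
  gap precisely if it is negative at the left end, or if there is no left end; and this criterion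
  depends only on the data that \<open>p\<close> and \<open>p'\<close> share.
\<close>

lemma transfer_negative:
  fixes p p' :: "real poly"
  assumes Z: "finite Z" "x \<notin> Z" and h0: "strict_mono h0"
    and D: "\<And>y. same_gap Z x y \<Longrightarrow> poly (pderiv p) y > 0"
    and D': "\<And>y. same_gap (h0 ` Z) (h0 x) y \<Longrightarrow> poly (pderiv p') y > 0"
    and pp: "\<And>z. z \<in> Z \<Longrightarrow> sgn (poly p z) = sgn (poly p' (h0 z))"
    and px: "poly p x < 0"
  shows "\<exists>y. same_gap (h0 ` Z) (h0 x) y \<and> poly p' y < 0"
proof (cases "{z\<in>Z. z < x} = {}")
  case True
  have nin: "h0 x \<notin> h0 ` Z" using Z h0 by (auto simp: strict_mono_eq)
  have gap: "same_gap (h0 ` Z) (h0 x) y" if "y \<le> h0 x" for y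
    using True by (intro same_gap_left[OF nin _ that]) (auto simp: strict_mono_less[OF h0])
  then have "\<exists>y\<le>h0 x. poly p' y < 0"
    by (intro poly_neg_if_pderiv_pos_at_bot D')
  then show ?thesis using gap by blast
next
  case False
  define z where "z = Max {z\<in>Z. z < x}"
  have z: "z \<in> Z" "z < x" "\<And>w. w \<in> Z \<Longrightarrow> w < x \<Longrightarrow> w \<le> z"
    using False Z Max_in[of "{z\<in>Z. z < x}"] by (auto simp: z_def)
  have "same_gap Z x t" if "z < t" "t \<le> x" for t
    using z that Z by (intro same_gap_left) force+
  then have "poly p z < poly p x"
    using z by (intro poly_increasing_if_pderiv_pos D) auto
  then have neg: "poly p' (h0 z) < 0"
    using pp[OF z(1)] px by (simp add: sgn_if split: if_splits)
  have nin: "h0 x \<notin> h0 ` Z" using Z h0 by (auto simp: strict_mono_eq)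
  have gap: "same_gap (h0 ` Z) (h0 x) t" if "h0 z < t" "t \<le> h0 x" for t
  proof (rule same_gap_left[OF nin _ that(2)])
    fix w assume "w \<in> h0 ` Z" "w < h0 x"
    then obtain v where "w = h0 v" "v \<in> Z" "v < x" by (auto simp: strict_mono_less[OF h0])
    then have "w \<le> h0 z" using z(3) h0 by (simp add: strict_mono_less_eq)
    then show "w < t" using that by simp
  qed
  show ?thesis
  proof (cases "poly p' (h0 x) < 0")
    case True
    then show ?thesis using same_gap_refl by blast
  next
    case False
    \<comment> \<open>Any level strictly between the negative value at the left end and \<open>0\<close> is
      attained inside the gap.\<close>
    let ?c = "poly p' (h0 z) / 2"
    have "\<exists>r. h0 z < r \<and> r < h0 x \<and> poly (p' - [:?c:]) r = 0"
      using neg False z(2) h0 by (intro poly_IVT_pos) (auto simp: strict_mono_less)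
    then obtain r where r: "h0 z < r" "r < h0 x" "poly p' r = ?c" by auto
    then show ?thesis using gap[of r] neg by auto
  qed
qed

lemma transfer_positive:
  fixes p p' :: "real poly"
  assumes Z: "finite Z" "x \<notin> Z" and h0: "strict_mono h0"
    and D: "\<And>y. same_gap Z x y \<Longrightarrow> poly (pderiv p) y > 0"
    and D': "\<And>y. same_gap (h0 ` Z) (h0 x) y \<Longrightarrow> poly (pderiv p') y > 0"
    and pp: "\<And>z. z \<in> Z \<Longrightarrow> sgn (poly p z) = sgn (poly p' (h0 z))"
    and px: "poly p x > 0"
  shows "\<exists>y. same_gap (h0 ` Z) (h0 x) y \<and> poly p' y > 0"
proof -
  define h where "h x = - h0 (- x)" for x
  have h: "strict_mono h" using h0 by (auto simp: strict_mono_def h_def)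
  have im: "h ` uminus ` Z = uminus ` h0 ` Z" by (auto simp: h_def image_image)
  have gap: "same_gap (uminus ` A) (- a) b \<longleftrightarrow> same_gap A a (- b)" for A a b
    using same_gap_uminus[of A a "- b"] by simp
  have "\<exists>y. same_gap (h ` uminus ` Z) (h (- x)) y \<and> poly (point_reflection p') y < 0"
  proof (rule transfer_negative[where p = "point_reflection p"])
    show "- x \<notin> uminus ` Z" using Z by auto
    show "poly (pderiv (point_reflection p')) y > 0"
      if "same_gap (h ` uminus ` Z) (h (- x)) y" for y
      using that unfolding im by (simp add: h_def gap D')
    show "sgn (poly (point_reflection p) z) = sgn (poly (point_reflection p') (h z))"
      if "z \<in> uminus ` Z" for z
      using that pp by (auto simp: h_def sgn_minus)
  qed (use Z h px in \<open>simp_all add: gap D\<close>)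
  then show ?thesis unfolding im by (auto simp: h_def gap)
qed

text \<open>
  The value zero is attained inside a gap precisely if both negative and positive values are.
\<close>

lemma transfer_sign_increasing:
  fixes p p' :: "real poly"
  assumes Z: "finite Z" "x \<notin> Z" and h0: "strict_mono h0"
    and D: "\<And>y. same_gap Z x y \<Longrightarrow> poly (pderiv p) y > 0"
    and D': "\<And>y. same_gap (h0 ` Z) (h0 x) y \<Longrightarrow> poly (pderiv p') y > 0"
    and pp: "\<And>z. z \<in> Z \<Longrightarrow> sgn (poly p z) = sgn (poly p' (h0 z))"
  shows "\<exists>y. same_gap (h0 ` Z) (h0 x) y \<and> sgn (poly p' y) = sgn (poly p x)"
proof -
  have same: "same_gap Z x t \<Longrightarrow> same_gap Z t y \<longleftrightarrow> same_gap Z x y"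
    "same_gap Z x t \<Longrightarrow> same_gap (h0 ` Z) (h0 t) y \<longleftrightarrow> same_gap (h0 ` Z) (h0 x) y" for t y
    by (meson same_gap_sym same_gap_trans same_gap_image[OF h0])+
  have nin: "same_gap Z x t \<Longrightarrow> t \<notin> Z" for t using same_gap_in_iff Z by blast
  have neg: "\<exists>y. same_gap (h0 ` Z) (h0 x) y \<and> poly p' y < 0"
    if "same_gap Z x t" "poly p t < 0" for t
    using transfer_negative[OF Z(1) nin[OF that(1)] h0 _ _ pp that(2)] D D' same[OF that(1)] by blast
  have pos: "\<exists>y. same_gap (h0 ` Z) (h0 x) y \<and> poly p' y > 0"
    if "same_gap Z x t" "poly p t > 0" for t
    using transfer_positive[OF Z(1) nin[OF that(1)] h0 _ _ pp that(2)] D D' same[OF that(1)] by blast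
  consider "poly p x < 0" | "poly p x > 0" | "poly p x = 0" by linarith
  then show ?thesis
  proof cases
    case 1
    then show ?thesis using neg[OF same_gap_refl] by auto
  next
    case 2
    then show ?thesis using pos[OF same_gap_refl] by auto
  next
    case 3
    obtain a b where ab: "a < x" "x < b" "same_gap Z x a" "same_gap Z x b"
    proof -
      \<comment> \<open>At most half the distance to the nearest point of \<open>Z\<close>; the inserted
        \<open>1\<close> takes care of an empty \<open>Z\<close>.\<close>
      define d where "d = Min (insert 1 ((\<lambda>z. \<bar>z - x\<bar>) ` Z)) / 2"
      have "Min (insert 1 ((\<lambda>z. \<bar>z - x\<bar>) ` Z)) > 0"
        using Z by (subst Min_gr_iff) auto
      moreover have "Min (insert 1 ((\<lambda>z. \<bar>z - x\<bar>) ` Z)) \<le> \<bar>z - x\<bar>" if "z \<in> Z" for z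
        using Z that by (intro Min_le) auto
      ultimately have d: "d > 0" "\<And>z. z \<in> Z \<Longrightarrow> d < \<bar>z - x\<bar>"
        unfolding d_def by (simp, smt (verit) field_sum_of_halves)
      show ?thesis
      proof (rule that[of "x - d" "x + d"])
        show "same_gap Z x (x - d)" "same_gap Z x (x + d)"
          unfolding same_gap_def using d by (smt (verit))+
      qed (use d in auto)
    qed
    have "poly p a < poly p x" "poly p x < poly p b"
      using ab same_gap_between[OF ab(3) same_gap_refl] same_gap_between[OF same_gap_refl ab(4)]
      by (auto intro!: poly_increasing_if_pderiv_pos D)
    then obtain u v where uv: "same_gap (h0 ` Z) (h0 x) u" "poly p' u < 0"
      "same_gap (h0 ` Z) (h0 x) v" "poly p' v > 0"
      using neg[OF ab(3)] pos[OF ab(4)] 3 by auto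
    have "\<exists>r. poly p' r = 0 \<and> same_gap (h0 ` Z) (h0 x) r"
    proof (cases "u \<le> v")
      case True
      have "sgn (poly p' u) \<noteq> sgn (poly p' v)" using uv by simp
      from poly_sgn_change[OF this True] show ?thesis
        using same_gap_between[OF uv(1,3)] by metis
    next
      case False
      then have "v \<le> u" by simp
      have "sgn (poly p' v) \<noteq> sgn (poly p' u)" using uv by simp
      from poly_sgn_change[OF this \<open>v \<le> u\<close>] show ?thesis
        using same_gap_between[OF uv(3,1)] by metis
    qed
    then show ?thesis using 3 by auto
  qed
qed

lemma transfer_sign:
  fixes p p' :: "real poly"
  assumes Z: "finite Z" "x \<notin> Z" and h0: "strict_mono h0"
    and roots: "\<And>z. poly (pderiv p) z = 0 \<Longrightarrow> z \<in> Z"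
    and roots': "\<And>z. poly (pderiv p') z = 0 \<Longrightarrow> z \<in> h0 ` Z"
    and D: "sgn (poly (pderiv p) x) = sgn (poly (pderiv p') (h0 x))"
    and pp: "\<And>z. z \<in> Z \<Longrightarrow> sgn (poly p z) = sgn (poly p' (h0 z))"
  shows "\<exists>y. same_gap (h0 ` Z) (h0 x) y \<and> sgn (poly p' y) = sgn (poly p x)"
proof -
  have nin: "h0 x \<notin> h0 ` Z" using Z h0 by (auto simp: strict_mono_eq)
  have s: "same_gap Z x y \<Longrightarrow> sgn (poly (pderiv p) y) = sgn (poly (pderiv p) x)" for y
    using poly_sgn_same_gap[OF roots _ Z(2)] by metis
  have s': "same_gap (h0 ` Z) (h0 x) y \<Longrightarrow> sgn (poly (pderiv p') y) = sgn (poly (pderiv p) x)" for y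
    using poly_sgn_same_gap[OF roots' _ nin] D by metis
  have "poly (pderiv p) x \<noteq> 0" using roots Z by blast
  then consider "poly (pderiv p) x > 0" | "poly (pderiv p) x < 0" by linarith
  then show ?thesis
  proof cases
    case 1
    show ?thesis
    proof (rule transfer_sign_increasing[OF Z h0])
      show "poly (pderiv p) y > 0" if "same_gap Z x y" for y
        using s[OF that] 1 by (simp add: sgn_1_pos)
      show "poly (pderiv p') y > 0" if "same_gap (h0 ` Z) (h0 x) y" for y
        using s'[OF that] 1 by (simp add: sgn_1_pos)
    qed (fact pp)
  next
    case 2
    have "\<exists>y. same_gap (h0 ` Z) (h0 x) y \<and> sgn (poly (- p') y) = sgn (poly (- p) x)"
    proof (rule transfer_sign_increasing[OF Z h0])
      show "poly (pderiv (- p)) y > 0" if "same_gap Z x y" for y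
        using s[OF that] 2 by (simp add: sgn_1_neg pderiv_minus)
      show "poly (pderiv (- p')) y > 0" if "same_gap (h0 ` Z) (h0 x) y" for y
        using s'[OF that] 2 by (simp add: sgn_1_neg pderiv_minus)
    qed (simp add: pp sgn_minus)
    then show ?thesis by (simp add: sgn_minus)
  qed
qed

lemma poly_monotone_in_gap:
  fixes p :: "real poly"
  assumes "x \<notin> Z" "\<And>z. poly (pderiv p) z = 0 \<Longrightarrow> z \<in> Z" "same_gap Z x y" "x < y"
  shows "sgn (poly p y - poly p x) = sgn (poly (pderiv p) x)"
proof -
  obtain t where t: "x < t" "t < y" "poly p y - poly p x = (y - x) * poly (pderiv p) t"
    using poly_MVT[OF assms(4)] by blast
  then have "sgn (poly p y - poly p x) = sgn (poly (pderiv p) t)"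
    using assms(4) by (simp add: sgn_mult)
  also have "same_gap Z x t" using same_gap_between[OF same_gap_refl assms(3), of t] t by simp
  then have "sgn (poly (pderiv p) t) = sgn (poly (pderiv p) x)"
    using poly_sgn_same_gap[OF assms(2) _ assms(1)] by metis
  finally show ?thesis .
qed

text \<open>
  An order isomorphism \<open>h0\<close> that respects the roots and the sign of the derivative of \<open>p\<close>, and respects
  the sign of \<open>p\<close> at the points of \<open>Z\<close>, can be changed inside the gaps of \<open>Z\<close> so as to respect the
  sign of \<open>p\<close> everywhere. In each gap \<open>p\<close> is strictly monotone and has at most one root, and by
  \<open>transfer_sign\<close> it has one precisely if \<open>p'\<close> has one in the corresponding gap. Mapping roots to roots
  and extending the finite map gives the desired isomorphism.
\<close>

lemma extend_sign_isomorphism: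
  fixes p p' :: "real poly"
  assumes Z: "finite Z" and h0: "strict_mono h0" "surj h0"
    and roots: "\<And>z. poly (pderiv p) z = 0 \<Longrightarrow> z \<in> Z"
    and roots': "\<And>z. poly (pderiv p') z = 0 \<Longrightarrow> z \<in> h0 ` Z"
    and D: "\<And>x. sgn (poly (pderiv p) x) = sgn (poly (pderiv p') (h0 x))"
    and pp: "\<And>z. z \<in> Z \<Longrightarrow> sgn (poly p z) = sgn (poly p' (h0 z))"
  obtains h where "strict_mono h" "surj h" "\<And>x. same_gap (h0 ` Z) (h0 x) (h x)"
    "\<And>x. sgn (poly p x) = sgn (poly p' (h x))"
proof -
  let ?Z' = "h0 ` Z"
  have nin: "h0 x \<notin> ?Z' \<longleftrightarrow> x \<notin> Z" for x using h0(1) by (auto simp: strict_mono_eq)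
  have T: "\<exists>y. same_gap ?Z' (h0 x) y \<and> sgn (poly p' y) = sgn (poly p x)" if "x \<notin> Z" for x
    by (rule transfer_sign[OF Z that h0(1) roots roots' D pp])
  define k where "k = inv h0"
  have hk: "h0 (k y) = y" for y using h0(2) by (simp add: k_def surj_f_inv_f)
  have kh: "k (h0 x) = x" for x using h0(1) by (simp add: k_def strict_mono_imp_inj_on)
  have k: "strict_mono k" using hk h0(1) by (metis strict_monoI strict_mono_less)
  have kZ: "k ` ?Z' = Z" by (simp add: image_image kh)
  have T': "\<exists>x. same_gap Z (k y) x \<and> sgn (poly p x) = sgn (poly p' y)" if "y \<notin> ?Z'" for y
  proof -
    have "sgn (poly p' z) = sgn (poly p (k z))" if "z \<in> ?Z'" for z
      using that pp by (auto simp: kh)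
    then show ?thesis
      using transfer_sign[of ?Z' y k p' p] that Z k roots roots' D by (simp add: kZ hk)
  qed
  have mono: "sgn (poly p y - poly p x) = sgn (poly (pderiv p) x)"
    if "x \<notin> Z" "same_gap Z x y" "x < y" for x y
    using poly_monotone_in_gap[OF that(1) roots that(2,3)] .
  have mono': "sgn (poly p' y - poly p' x) = sgn (poly (pderiv p') x)"
    if "x \<notin> ?Z'" "same_gap ?Z' x y" "x < y" for x y
    using poly_monotone_in_gap[OF that(1) roots' that(2,3)] .
  have uniq: "x = y" if "x \<notin> Z" "same_gap Z x y" "poly p x = 0" "poly p y = 0" for x y
  proof (rule ccontr)
    assume "x \<noteq> y"
    then consider "x < y" | "y < x" by linarith
    then show False
    proof cases
      case 1
      then show False using mono[OF that(1,2)] roots[of x] that by (simp add: sgn_eq_0_iff)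
    next
      case 2
      have "y \<notin> Z" using that same_gap_in_iff by blast
      then show False using mono[OF _ same_gap_sym[OF that(2)] 2] roots[of y] \<open>y \<notin> Z\<close> that by (simp add: sgn_eq_0_iff)
    qed
  qed
  have "\<exists>x. x \<notin> Z" using Z ex_new_if_finite infinite_UNIV_char_0 by blast
  then have "p \<noteq> 0" using roots by fastforce
  define Y where "Y = {x. x \<notin> Z \<and> poly p x = 0}"
  have Y: "finite Y" using poly_roots_finite[OF \<open>p \<noteq> 0\<close>] by (rule finite_subset[rotated]) (auto simp: Y_def)
  define \<phi> where "\<phi> w = (if w \<in> Z then h0 w else SOME y. same_gap ?Z' (h0 w) y \<and> poly p' y = 0)" for w
  have \<phi>Y: "same_gap ?Z' (h0 w) (\<phi> w) \<and> poly p' (\<phi> w) = 0" if "w \<in> Y" for w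
  proof -
    have "\<exists>y. same_gap ?Z' (h0 w) y \<and> poly p' y = 0"
      using T[of w] that by (auto simp: Y_def sgn_0_0)
    from someI_ex[OF this] show ?thesis using that by (simp add: \<phi>_def Y_def)
  qed
  have \<phi>Z: "\<phi> w = h0 w" if "w \<in> Z" for w using that by (simp add: \<phi>_def)
  have \<phi>gap: "same_gap ?Z' (h0 w) (\<phi> w)" if "w \<in> Z \<union> Y" for w using that \<phi>Y \<phi>Z by auto
  have "\<phi> a < \<phi> b" if ab: "a \<in> Z \<union> Y" "b \<in> Z \<union> Y" "a < b" for a b
  proof -
    have lt: "h0 a < h0 b" using ab h0 by (simp add: strict_mono_less)
    consider "a \<in> Z" | "b \<in> Z" | "a \<in> Y" "b \<in> Y" using ab by blast
    then show ?thesis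
    proof cases
      case 1
      then show ?thesis using \<phi>gap[OF ab(2)] lt by (auto simp: same_gap_def \<phi>Z)
    next
      case 2
      then show ?thesis using \<phi>gap[OF ab(1)] lt by (auto simp: same_gap_def \<phi>Z)
    next
      case 3
      then have "\<not> same_gap Z a b" using uniq[of a b] ab by (auto simp: Y_def)
      then obtain z where z: "z \<in> Z" "a < z" "z < b"
        using ab 3 unfolding same_gap_def Y_def by (metis (mono_tags, lifting) less_trans linorder_neqE mem_Collect_eq)
      then have "h0 a < h0 z" "h0 z < h0 b" using h0 by (auto simp: strict_mono_less)
      then have "\<phi> a < h0 z" "h0 z < \<phi> b"
        using \<phi>gap[OF ab(1)] \<phi>gap[OF ab(2)] z by (auto simp: same_gap_def)
      then show ?thesis by simp
    qed
  qed
  then have "strict_mono_on (Z \<union> Y) \<phi>" by (auto simp: strict_mono_on_def)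
  with strict_mono_extension[of "Z \<union> Y" \<phi>] Z Y obtain h where
    h: "strict_mono h" "surj h" "\<And>w. w \<in> Z \<union> Y \<Longrightarrow> h w = \<phi> w" by auto
  have gap: "same_gap ?Z' (h0 x) (h x)" for x
    unfolding same_gap_def
  proof safe
    fix z assume "z \<in> Z"
    then have "h z = h0 z" using h(3) \<phi>Z by simp
    then show "h0 z < h0 x \<Longrightarrow> h0 z < h x" "h0 z < h x \<Longrightarrow> h0 z < h0 x"
      "h0 x < h0 z \<Longrightarrow> h x < h0 z" "h x < h0 z \<Longrightarrow> h0 x < h0 z"
      using h(1) h0(1) by (metis strict_mono_less)+
  qed
  have "sgn (poly p x) = sgn (poly p' (h x))" for x
  proof -
    consider "x \<in> Z" | "x \<in> Y" | "x \<notin> Z" "x \<notin> Y" by blast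
    then show ?thesis
    proof cases
      case 1
      then show ?thesis using pp h(3) \<phi>Z by simp
    next
      case 2
      then show ?thesis using h(3)[of x] \<phi>Y[of x] by (simp add: Y_def)
    next
      case 3
      have hx: "h x \<notin> ?Z'" using same_gap_in_iff[OF gap] nin 3 by metis
      show ?thesis
      proof (cases "\<exists>y\<in>Y. same_gap Z x y")
        case True
        then obtain y where y: "y \<in> Y" "same_gap Z x y" by blast
        have hy: "poly p y = 0" "poly p' (h y) = 0" "h y \<notin> ?Z'" "y \<notin> Z"
          using y(1) h(3)[of y] \<phi>Y[of y] same_gap_in_iff[OF gap, of y] nin by (auto simp: Y_def)
        have hgap: "same_gap ?Z' (h x) (h y)"
          by (meson gap same_gap_image[OF h0(1)] same_gap_sym same_gap_trans y(2))
        have Dx: "sgn (poly (pderiv p) x) = sgn (poly (pderiv p') (h x))"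
          using D[of x] poly_sgn_same_gap[OF roots' gap] nin 3 by metis
        have Dy: "sgn (poly (pderiv p) y) = sgn (poly (pderiv p') (h y))"
          using D[of y] poly_sgn_same_gap[OF roots' gap] nin hy by metis
        consider "x < y" | "y < x" using 3 y by (metis linorder_neqE)
        then show ?thesis
        proof cases
          case 1
          then have "h x < h y" using h(1) by (simp add: strict_mono_less)
          then have "sgn (0 - poly p x) = sgn (0 - poly p' (h x))"
            using mono[OF 3(1) y(2) 1] mono'[OF hx hgap] Dx hy by simp
          then show ?thesis by (simp add: sgn_minus)
        next
          case 2
          then have "h y < h x" using h(1) by (simp add: strict_mono_less)
          then show ?thesis
            using mono[OF hy(4) same_gap_sym[OF y(2)] 2] mono'[OF hy(3) same_gap_sym[OF hgap]] Dy hy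
            by simp
        qed
      next
        case False
        show ?thesis
        proof (rule ccontr)
          assume ne: "sgn (poly p x) \<noteq> sgn (poly p' (h x))"
          obtain y where y: "same_gap ?Z' (h0 x) y" "sgn (poly p' y) = sgn (poly p x)"
            using T 3 by blast
          have "\<exists>r. poly p' r = 0 \<and> same_gap ?Z' (h0 x) r"
          proof (cases "y \<le> h x")
            case True
            have "sgn (poly p' y) \<noteq> sgn (poly p' (h x))" using ne y by simp
            from poly_sgn_change[OF this True] show ?thesis
              using same_gap_between[OF y(1) gap] by metis
          next
            case False
            have "sgn (poly p' (h x)) \<noteq> sgn (poly p' y)" using ne y by simp
            from poly_sgn_change[OF this] False show ?thesis
              using same_gap_between[OF gap y(1)] by (metis less_imp_le not_less)
          qed
          then obtain r where r: "poly p' r = 0" "same_gap ?Z' (h0 x) r" by blast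
          then have "r \<notin> ?Z'" using same_gap_in_iff nin 3 by metis
          then obtain w where w: "same_gap Z (k r) w" "poly p w = 0"
            using T'[of r] r by (auto simp: sgn_0_0)
          have "same_gap Z x (k r)" using r(2) same_gap_image[OF h0(1), of Z x "k r"] by (simp add: hk)
          then have "same_gap Z x w" using w same_gap_trans by blast
          then show False using False w 3 same_gap_in_iff[of Z x w] by (auto simp: Y_def)
        qed
      qed
    qed
  qed
  then show ?thesis using that h gap by blast
qed

section \<open>Quantifier elimination\<close>

text \<open>
  The signs of finitely many polynomials in the parameters determine, up to an order isomorphism of
  the line, the signs that the members of \<open>fs\<close> take along the line.
\<close>

definition signs_determined :: "('a::coordinates \<Rightarrow> real poly) set \<Rightarrow> bool" where
  "signs_determined fs \<longleftrightarrow> (\<exists>G. finite G \<and> (\<forall>p\<in>G. polyfun p) \<and>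
     (\<forall>e e'. same_signs G e e' \<longrightarrow> (\<exists>h. strict_mono h \<and> surj h \<and>
        (\<forall>F\<in>fs. \<forall>x. sgn (poly (F e) x) = sgn (poly (F e') (h x))))))"

lemma poly_eq_coeff_0: "degree p = 0 \<Longrightarrow> poly p x = coeff p 0"
  by (elim degree_eq_zeroE) simp

lemma signs_determined_mono: "signs_determined fs \<Longrightarrow> gs \<subseteq> fs \<Longrightarrow> signs_determined gs"
  unfolding signs_determined_def by (meson subsetD)

text \<open>
  The step of Cohen and Hoermander. At a root of \<open>g\<close>, the polynomial \<open>f\<close> has the sign of its remainder
  modulo \<open>g\<close>. So an isomorphism for the derivative of \<open>f\<close>, the other polynomials and all remainders
  respects the sign of \<open>f\<close> at all roots of these polynomials, and \<open>extend_sign_isomorphism\<close> applies.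
  The coefficients of the divisors join the sign conditions in order to fix the degrees, on which the
  choice of the remainder depends.
\<close>

lemma signs_determined_insert:
  fixes gs rs :: "('a::coordinates \<Rightarrow> real poly) set"
  assumes gs: "finite gs" "\<And>g. g \<in> gs \<Longrightarrow> param_poly d g"
    and f: "polyfun (\<lambda>e. coeff (f e) 0)" "(\<lambda>e. pderiv (f e)) \<in> gs"
    and rs: "\<And>g j. g \<in> gs \<Longrightarrow> j < d \<Longrightarrow> \<exists>R\<in>rs. \<forall>e. degree (g e) = Suc j \<longrightarrow>
      (\<exists>s q. s > 0 \<and> smult s (f e) = q * g e + R e)"
    and det: "signs_determined (gs \<union> rs)"
  shows "signs_determined (insert f gs)"
proof -
  obtain G0 where G0: "finite G0" "\<forall>p\<in>G0. polyfun p"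
    "\<And>e e'. same_signs G0 e e' \<Longrightarrow> \<exists>h. strict_mono h \<and> surj h \<and>
      (\<forall>F\<in>gs \<union> rs. \<forall>x. sgn (poly (F e) x) = sgn (poly (F e') (h x)))"
    using det unfolding signs_determined_def by blast
  define C where "C = (\<lambda>(g, k) e. coeff (g e) k) ` (gs \<times> {..d})"
  define G where "G = insert (\<lambda>e. coeff (f e) 0) (G0 \<union> C)"
  have "finite G" using G0 gs by (simp add: G_def C_def)
  moreover have "\<forall>p\<in>G. polyfun p" using G0 gs f by (auto simp: G_def C_def param_poly_def)
  moreover have "\<exists>h. strict_mono h \<and> surj h \<and>
      (\<forall>F\<in>insert f gs. \<forall>x. sgn (poly (F e) x) = sgn (poly (F e') (h x)))"
    if same: "same_signs G e e'" for e e'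
  proof -
    have "same_signs G0 e e'" using same by (simp add: G_def same_signs_def)
    then obtain h0 where h0: "strict_mono h0" "surj h0"
      "\<And>F x. F \<in> gs \<union> rs \<Longrightarrow> sgn (poly (F e) x) = sgn (poly (F e') (h0 x))"
      using G0 by blast
    have coeffs: "coeff (g e) k = 0 \<longleftrightarrow> coeff (g e') k = 0" if "g \<in> gs" for g k
    proof (cases "k \<le> d")
      case True
      then have "(\<lambda>e. coeff (g e) k) \<in> C" using that by (auto simp: C_def intro!: rev_image_eqI)
      moreover have "\<forall>p\<in>C. sgn (p e) = sgn (p e')" using same by (simp add: G_def same_signs_def)
      ultimately have "sgn (coeff (g e) k) = sgn (coeff (g e') k)" by (rule bspec[rotated])
      then show ?thesis by (metis sgn_0_0)
    next
      case False
      then show ?thesis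
        using gs(2)[OF that] by (metis coeff_eq_0 le_less_trans not_less param_poly_def)
    qed
    have deg: "degree (g e) = degree (g e')" if "g \<in> gs" for g
      unfolding degree_def using coeffs[OF that] by simp
    have zero: "g e = 0 \<longleftrightarrow> g e' = 0" if "g \<in> gs" for g
      using coeffs[OF that] by (auto simp: poly_eq_iff)
    have f0: "sgn (coeff (f e) 0) = sgn (coeff (f e') 0)"
      using same by (simp add: G_def same_signs_def)
    define Z where "Z = {x. \<exists>g\<in>gs. g e \<noteq> 0 \<and> poly (g e) x = 0}"
    have "Z = (\<Union>g\<in>{g\<in>gs. g e \<noteq> 0}. {x. poly (g e) x = 0})" by (auto simp: Z_def)
    then have finZ: "finite Z" using gs by (simp add: poly_roots_finite)
    have root_iff: "poly (g e') (h0 x) = 0 \<longleftrightarrow> poly (g e) x = 0" if "g \<in> gs" for g x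
      using h0(3)[of g x] that by (metis UnI1 sgn_0_0)
    have roots': "y \<in> h0 ` Z" if "g \<in> gs" "g e' \<noteq> 0" "poly (g e') y = 0" for g y
    proof -
      obtain x where "y = h0 x" using h0(2) by (metis surjD)
      then show ?thesis using that root_iff zero by (auto simp: Z_def)
    qed
    let ?f' = "\<lambda>e. pderiv (f e)"
    show ?thesis
    proof (cases "pderiv (f e) = 0")
      case True
      then have "degree (f e) = 0" "degree (f e') = 0" using zero[OF f(2)] by (simp_all add: pderiv_eq_0_iff)
      then have "poly (f e) x = coeff (f e) 0" "poly (f e') x = coeff (f e') 0" for x
        by (auto intro: poly_eq_coeff_0)
      then show ?thesis using h0 f0 by (intro exI[of _ h0]) auto
    next
      case False
      have pp: "sgn (poly (f e) z) = sgn (poly (f e') (h0 z))" if "z \<in> Z" for z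
      proof -
        obtain g where g: "g \<in> gs" "g e \<noteq> 0" "poly (g e) z = 0" using \<open>z \<in> Z\<close> by (auto simp: Z_def)
        have "degree (g e) \<noteq> 0"
        proof
          assume "degree (g e) = 0"
          then obtain c where "g e = [:c:]" by (rule degree_eq_zeroE)
          then show False using g by simp
        qed
        then obtain j where j: "degree (g e) = Suc j" using not0_implies_Suc by blast
        then have "j < d" using gs(2)[OF g(1)] by (metis Suc_le_eq param_poly_def)
        then obtain R where R: "R \<in> rs" "\<And>e. degree (g e) = Suc j \<Longrightarrow>
            (\<exists>s q. s > 0 \<and> smult s (f e) = q * g e + R e)" using rs g(1) by blast
        have sgnR: "sgn (poly (f e) x) = sgn (poly (R e) x)"
          if deg: "degree (g e) = Suc j" and root: "poly (g e) x = 0" for e x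
        proof -
          obtain s q where sq: "s > 0" "smult s (f e) = q * g e + R e" using R(2)[OF deg] by blast
          have "s * poly (f e) x = poly (R e) x" using root arg_cong[OF sq(2), of "\<lambda>p. poly p x"] by simp
          then show ?thesis using sq(1) by (metis mult_1 sgn_mult sgn_pos)
        qed
        show ?thesis
          using sgnR[OF j g(3)] sgnR[of e' "h0 z"] j deg[OF g(1)] root_iff[OF g(1)] g(3) h0(3)[of R z] R(1)
          by simp
      qed
      obtain h where h: "strict_mono h" "surj h" "\<And>x. same_gap (h0 ` Z) (h0 x) (h x)"
        "\<And>x. sgn (poly (f e) x) = sgn (poly (f e') (h x))"
      proof (rule extend_sign_isomorphism[OF finZ h0(1,2) _ _ _ pp])
        show "z \<in> Z" if "poly (pderiv (f e)) z = 0" for z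
          using that False f(2) by (auto simp: Z_def)
        show "z \<in> h0 ` Z" if "poly (pderiv (f e')) z = 0" for z
          using roots'[OF f(2)] that False zero[OF f(2)] by simp
        show "sgn (poly (pderiv (f e)) x) = sgn (poly (pderiv (f e')) (h0 x))" for x
          using h0(3)[of ?f' x] f(2) by simp
      qed (assumption, rule that)
      have "sgn (poly (g e) x) = sgn (poly (g e') (h x))" if g: "g \<in> gs" for g x
      proof (cases "x \<in> Z \<or> g e = 0")
        case True
        have "h x = h0 x" if "x \<in> Z"
          using h(3)[of x] that unfolding same_gap_def by (meson imageI linorder_neqE order_less_irrefl)
        then show ?thesis using True h0(3)[of g x] zero[OF g] g by (metis UnI1 poly_0)
      next
        case False
        then have nin: "h0 x \<notin> h0 ` Z" using h0(1) by (auto simp: strict_mono_eq)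
        have "g e' \<noteq> 0" using False zero[OF g] by simp
        from poly_sgn_same_gap[OF roots'[OF g this] h(3) nin]
        show ?thesis using h0(3)[of g x] g by simp
      qed
      then show ?thesis using h by blast
    qed
  qed
  ultimately show ?thesis unfolding signs_determined_def by blast
qed

text \<open>
  Induction on the maximal degree and then on the number of polynomials of this degree. One of them is
  replaced by its derivative and its remainders, all of which have smaller degree.
\<close>

theorem signs_determined:
  assumes "finite fs" "\<And>F. F \<in> fs \<Longrightarrow> param_poly d F"
  shows "signs_determined fs"
  using assms
proof (induction d arbitrary: fs)
  case 0
  have "poly (F e) x = coeff (F e) 0" if "F \<in> fs" for F e x
  proof -
    have "degree (F e) = 0" using 0 that by (auto simp: param_poly_def)
    then show ?thesis by (rule poly_eq_coeff_0)
  qed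
  then show ?case
    unfolding signs_determined_def using 0
    by (intro exI[of _ "(\<lambda>F e. coeff (F e) 0) ` fs"])
      (auto simp: same_signs_def param_poly_def strict_mono_def intro!: exI[of _ "\<lambda>x. x"])
next
  case (Suc d)
  have "signs_determined (S \<union> T)" if "finite T" "\<And>F. F \<in> T \<Longrightarrow> param_poly (Suc d) F"
    "finite S" "\<And>F. F \<in> S \<Longrightarrow> param_poly d F" for S T :: "('a \<Rightarrow> real poly) set"
    using that
  proof (induction T arbitrary: S rule: finite_induct)
    case empty
    then show ?case using Suc.IH[of S] by simp
  next
    case (insert f T)
    let ?f' = "\<lambda>e. pderiv (f e)"
    define gs where "gs = insert ?f' (S \<union> T)"
    have f: "param_poly (Suc d) f" using insert.prems by simp
    have f': "param_poly d ?f'" using param_poly_pderiv[OF f] by simp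
    have gs: "param_poly (Suc d) g" if "g \<in> gs" for g
      using that insert.prems f' param_poly_mono[of d _ "Suc d"] by (auto simp: gs_def)
    have "\<exists>R. param_poly j R \<and> (\<forall>e. degree (g e) = Suc j \<longrightarrow>
        (\<exists>s q. s > 0 \<and> smult s (f e) = q * g e + R e))" if "g \<in> gs" for g j
      using pseudo_remainder[OF f gs[OF that], of j] by metis
    then obtain R where R: "\<And>g j. g \<in> gs \<Longrightarrow> param_poly j (R g j)"
      "\<And>g j e. g \<in> gs \<Longrightarrow> degree (g e) = Suc j \<Longrightarrow>
        (\<exists>s q. s > 0 \<and> smult s (f e) = q * g e + R g j e)" by metis
    define rs where "rs = (\<lambda>(g, j). R g j) ` (gs \<times> {..<Suc d})"
    have fin: "finite gs" "finite rs" using insert by (auto simp: gs_def rs_def)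
    have "signs_determined ((insert ?f' S \<union> rs) \<union> T)"
    proof (rule insert.IH)
      show "param_poly d F" if "F \<in> insert ?f' S \<union> rs" for F
        using that insert.prems f' param_poly_mono[OF R(1)] by (auto simp: rs_def)
    qed (use insert fin in auto)
    then have "signs_determined (gs \<union> rs)"
      by (rule signs_determined_mono) (auto simp: gs_def)
    then have "signs_determined (insert f gs)"
    proof (rule signs_determined_insert[rotated -1])
      show "\<exists>R\<in>rs. \<forall>e. degree (g e) = Suc j \<longrightarrow> (\<exists>s q. s > 0 \<and> smult s (f e) = q * g e + R e)"
        if "g \<in> gs" "j < Suc d" for g j
        using that R(2)[OF that(1)] by (intro bexI[of _ "R g j"]) (auto simp: rs_def)
    qed (use fin gs f in \<open>auto simp: gs_def param_poly_def\<close>)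
    then show ?case by (rule signs_determined_mono) (auto simp: gs_def)
  qed
  from this[of fs "{}"] Suc.prems show ?case by simp
qed

lemma semialg_fibre_polys:
  fixes Q :: "'a::coordinates \<times> real \<Rightarrow> bool"
  assumes "semialg Q"
  obtains fs d where "finite fs" "\<And>F. F \<in> fs \<Longrightarrow> param_poly d F"
    "\<And>e e' c c'. (\<And>F. F \<in> fs \<Longrightarrow> sgn (poly (F e) c) = sgn (poly (F e') c')) \<Longrightarrow> Q (e, c) = Q (e', c')"
proof -
  obtain G where G: "finite G" "\<And>p. p \<in> G \<Longrightarrow> polyfun p"
    "\<And>z z'. same_signs G z z' \<Longrightarrow> Q z = Q z'"
    using assms unfolding semialg_def by blast
  have "\<exists>d F. param_poly d F \<and> (\<forall>e c. p (e, c) = poly (F e) c)" if "p \<in> G" for p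
    using polyfun_as_param_poly[OF G(2)[OF that]] by metis
  then obtain d F where F: "\<And>p. p \<in> G \<Longrightarrow> param_poly (d p) (F p)"
    "\<And>p e c. p \<in> G \<Longrightarrow> p (e, c) = poly (F p e) c" by metis
  have "d p \<le> (\<Sum>p\<in>G. d p)" if "p \<in> G" for p using that G(1) by (simp add: member_le_sum)
  then have "param_poly (\<Sum>p\<in>G. d p) H" if "H \<in> F ` G" for H using that F(1) param_poly_mono by blast
  moreover have "Q (e, c) = Q (e', c')"
    if "\<And>H. H \<in> F ` G \<Longrightarrow> sgn (poly (H e) c) = sgn (poly (H e') c')" for e e' c c'
    proof (rule G(3))
    show "same_signs G (e, c) (e', c')"
      unfolding same_signs_def
    proof
      fix p assume p: "p \<in> G"
      then show "sgn (p (e, c)) = sgn (p (e', c'))"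
        using that[of "F p"] F(2)[OF p] by simp
    qed
  qed
  ultimately show ?thesis by (rule that[OF finite_imageI[OF G(1)]])
qed

text \<open>
  The Tarski-Seidenberg theorem. A witness \<open>c\<close> for the parameter \<open>e\<close> is carried by the order isomorphism
  to a witness for any parameter that satisfies the same sign conditions.
\<close>

theorem semialg_ex [semialg_intros]:
  fixes Q :: "'a::coordinates \<Rightarrow> real \<Rightarrow> bool"
  assumes "semialg (\<lambda>z. Q (fst z) (snd z))"
  shows "semialg (\<lambda>e. \<exists>c. Q e c)"
proof -
  obtain fs d where fs: "finite fs" "\<And>F. F \<in> fs \<Longrightarrow> param_poly d F"
    "\<And>e e' c c'. (\<And>F. F \<in> fs \<Longrightarrow> sgn (poly (F e) c) = sgn (poly (F e') c')) \<Longrightarrow> Q e c = Q e' c'"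
    using semialg_fibre_polys[OF assms] by (metis fst_conv snd_conv)
  have "signs_determined fs" using signs_determined[OF fs(1,2)] .
  then obtain G where G: "finite G" "\<forall>p\<in>G. polyfun p"
    "\<And>e e'. same_signs G e e' \<Longrightarrow> \<exists>h. \<forall>F\<in>fs. \<forall>x. sgn (poly (F e) x) = sgn (poly (F e') (h x))"
    unfolding signs_determined_def by meson
  have "\<exists>c. Q e' c" if "same_signs G e e'" "Q e c" for e e' c
    using G(3)[OF that(1)] fs(3)[of e c e'] that(2) by blast
  then have "(\<exists>c. Q e c) = (\<exists>c. Q e' c)" if "same_signs G e e'" for e e'
    using that same_signs_sym[OF that] by (metis (full_types))
  then show ?thesis
    unfolding semialg_def using G(1,2) by (intro exI[of _ G] conjI allI impI)
qed

lemma semialg_all [semialg_intros]: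
  fixes Q :: "'a::coordinates \<Rightarrow> real \<Rightarrow> bool"
  assumes "semialg (\<lambda>z. Q (fst z) (snd z))"
  shows "semialg (\<lambda>e. \<forall>c. Q e c)"
  using semialg_not[OF semialg_ex[OF semialg_not[OF assms]]] by simp

lemma polymap_tm_val: "polymap (\<lambda>e. tm_val e t)"
  proof (induction t)
  case (Var i)
  show ?case unfolding tm_val.simps by (rule polymap_rules)+
qed (auto simp: polymap_real intro: polyfun_arith)

theorem semialg_sat: "semialg (\<lambda>e. sat e \<phi>)"
proof (induction \<phi>)
  case (Exi i \<phi>)
  have "semialg (\<lambda>z. sat ((fst z)(i := snd z)) \<phi>)"
    by (rule semialg_comp[OF Exi]) (rule polymap_rules)+
  then show ?case by (simp add: semialg_ex)
qed (auto intro: semialg_intros polymap_tm_val)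

section \<open>Bounded alternation\<close>

text \<open>
  \<open>alternates P k s\<close> means that to the left of \<open>s\<close> there are points \<open>v\<^sub>1 < u\<^sub>1 < \<dots> < v\<^sub>k < u\<^sub>k\<close> such
  that \<open>P\<close> holds at every \<open>v\<^sub>i\<close> and fails at every \<open>u\<^sub>i\<close>.
\<close>

primrec alternates :: "(real \<Rightarrow> bool) \<Rightarrow> nat \<Rightarrow> real \<Rightarrow> bool" where
  "alternates P 0 s = True"
| "alternates P (Suc k) s = (\<exists>u. u < s \<and> \<not> P u \<and> (\<exists>v. v < u \<and> P v \<and> alternates P k v))"

text \<open>
  The points of \<open>P\<close> in its convex component with exactly \<open>k\<close> components to the left. Numbering the
  components in this way makes each of them definable.
\<close>

definition level :: "(real \<Rightarrow> bool) \<Rightarrow> nat \<Rightarrow> real \<Rightarrow> bool" where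
  "level P k s \<longleftrightarrow> P s \<and> alternates P k s \<and> \<not> alternates P (Suc k) s"

lemma alternates_mono: "alternates P k s \<Longrightarrow> s \<le> t \<Longrightarrow> alternates P k t"
  by (cases k) (auto intro: less_le_trans)

lemma level_convex:
  assumes "level P k s" "level P k t" "s \<le> w" "w \<le> t"
  shows "level P k w"
proof -
  have "P w"
  proof (rule ccontr)
    assume "\<not> P w"
    then have "s < w" "w < t" using assms by (auto simp: level_def less_le)
    then have "alternates P (Suc k) t" using assms(1) \<open>\<not> P w\<close> by (auto simp: level_def)
    then show False using assms(2) by (simp add: level_def)
  qed
  then show ?thesis
    using assms alternates_mono[of P k s w] alternates_mono[of P "Suc k" w t]
    unfolding level_def by blast
qed

lemma level_exists:
  assumes "P s" "\<not> alternates P N s"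
  obtains k where "k < N" "level P k s"
proof -
  let ?m = "LEAST m. \<not> alternates P m s"
  have m: "\<not> alternates P ?m s" using assms(2) by (rule LeastI)
  then obtain k where k: "?m = Suc k" by (cases ?m) auto
  have "alternates P k s" using not_less_Least[of k "\<lambda>m. \<not> alternates P m s"] k by auto
  moreover have "?m \<le> N" using assms(2) by (rule Least_le)
  ultimately show ?thesis using that[of k] k m assms(1) by (auto simp: level_def)
qed

text \<open>
  Each interval from some \<open>v\<^sub>i\<close> to the next \<open>u\<^sub>i\<close> contains an element of \<open>R\<close>, and these intervals are
  disjoint.
\<close>

lemma alternates_card_le:
  assumes "finite R" "\<And>v u. v < u \<Longrightarrow> P v \<Longrightarrow> \<not> P u \<Longrightarrow> \<exists>r\<in>R. v \<le> r \<and> r \<le> u"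
    and "alternates P k s"
  shows "k \<le> card {r\<in>R. r < s}"
  using assms(3)
proof (induction k arbitrary: s)
  case (Suc k)
  then obtain u v where uv: "u < s" "\<not> P u" "v < u" "P v" "alternates P k v" by auto
  then obtain r where r: "r \<in> R" "v \<le> r" "r \<le> u" using assms(2) by blast
  have "Suc k \<le> Suc (card {r\<in>R. r < v})" using Suc.IH[OF uv(5)] by simp
  also have "\<dots> = card (insert r {r\<in>R. r < v})" using r assms(1) by simp
  also have "\<dots> \<le> card {r\<in>R. r < s}" using r uv assms(1) by (intro card_mono) auto
  finally show ?case .
qed simp

text \<open>
  Uniform o-minimality. Where the truth value changes, one of finitely many polynomials of bounded
  degree changes its sign and therefore has a root.
\<close>

theorem semialg_alternates_bounded:
  fixes Q :: "'a::coordinates \<times> real \<Rightarrow> bool"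
  assumes "semialg Q"
  obtains N where "\<And>e s. \<not> alternates (\<lambda>c. Q (e, c)) N s"
proof -
  obtain fs d where fs: "finite fs" "\<And>F. F \<in> fs \<Longrightarrow> param_poly d F"
    "\<And>e e' c c'. (\<And>F. F \<in> fs \<Longrightarrow> sgn (poly (F e) c) = sgn (poly (F e') c')) \<Longrightarrow> Q (e, c) = Q (e', c')"
    using semialg_fibre_polys[OF assms] by metis
  have "\<not> alternates (\<lambda>c. Q (e, c)) (Suc (card fs * d)) s" for e s
  proof
    assume alt: "alternates (\<lambda>c. Q (e, c)) (Suc (card fs * d)) s"
    define rts where "rts F = {x. F e \<noteq> 0 \<and> poly (F e) x = 0}" for F :: "'a \<Rightarrow> real poly"
    have rts: "finite (rts F) \<and> card (rts F) \<le> d" if "F \<in> fs" for F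
    proof (cases "F e = 0")
      case False
      then show ?thesis
        using poly_roots_finite[OF False] card_poly_roots_bound[OF False] fs(2)[OF that]
        unfolding param_poly_def rts_def by (auto intro: order_trans)
    qed (simp add: rts_def)
    define R where "R = (\<Union>F\<in>fs. rts F)"
    have R: "finite R" using fs(1) rts by (simp add: R_def)
    have "card R \<le> (\<Sum>F\<in>fs. card (rts F))" unfolding R_def by (rule card_UN_le[OF fs(1)])
    also have "\<dots> \<le> (\<Sum>F\<in>fs. d)" using rts by (intro sum_mono) auto
    finally have "card R \<le> card fs * d" by simp
    moreover have "Suc (card fs * d) \<le> card {r\<in>R. r < s}"
    proof (rule alternates_card_le[OF R _ alt])
      fix v u assume vu: "v < u" "Q (e, v)" "\<not> Q (e, u)"
      then obtain F where F: "F \<in> fs" "sgn (poly (F e) v) \<noteq> sgn (poly (F e) u)"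
        using fs(3)[of e v e u] by blast
      obtain r where "v \<le> r" "r \<le> u" "poly (F e) r = 0"
        using poly_sgn_change[OF F(2)] vu by auto
      moreover have "F e \<noteq> 0" using F(2) by auto
      ultimately show "\<exists>r\<in>R. v \<le> r \<and> r \<le> u" using F(1) by (auto simp: R_def rts_def)
    qed
    moreover have "card {r\<in>R. r < s} \<le> card R" using R by (intro card_mono) auto
    ultimately show False by simp
  qed
  then show ?thesis by (rule that)
qed

lemma semialg_alternates:
  fixes Q :: "'a::coordinates \<times> real \<Rightarrow> bool"
  assumes "semialg Q"
  shows "semialg (\<lambda>z. alternates (\<lambda>c. Q (fst z, c)) k (snd z))"
proof (induction k)
  case 0
  show ?case by (simp add: semialg_const)
next
  case (Suc k)
  let ?A = "\<lambda>z. alternates (\<lambda>c. Q (fst z, c)) k (snd z)"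
  have "semialg (\<lambda>z. \<exists>u. u < snd z \<and> \<not> Q (fst z, u) \<and>
      (\<exists>v. v < u \<and> Q (fst z, v) \<and> ?A (fst z, v)))"
    by (intro semialg_intros semialg_comp[OF assms] semialg_comp[OF Suc.IH]; (rule polymap_rules)+)
  then show ?case by simp
qed

lemma semialg_level:
  fixes Q :: "'a::coordinates \<times> real \<Rightarrow> bool"
  assumes "semialg Q"
  shows "semialg (\<lambda>z. level (\<lambda>c. Q (fst z, c)) k (snd z))"
  unfolding level_def
  by (intro semialg_intros semialg_alternates assms) (simp add: assms)

section \<open>Uniformly definable cells\<close>

text \<open>
  To the right of a common point \<open>t\<close>, the intervals form a chain under inclusion, so one of them is the
  smallest.
\<close>

lemma finite_intervals_upper:
  fixes t :: real
  assumes "finite A" "A \<noteq> {}"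
    and "\<And>a. a \<in> A \<Longrightarrow> t \<in> I a"
    and "\<And>a s s' w. a \<in> A \<Longrightarrow> s \<in> I a \<Longrightarrow> s' \<in> I a \<Longrightarrow> s \<le> w \<Longrightarrow> w \<le> s' \<Longrightarrow> w \<in> I a"
  shows "\<exists>a\<in>A. \<forall>s\<ge>t. s \<in> I a \<longrightarrow> (\<forall>a'\<in>A. s \<in> I a')"
  using assms
proof (induction A rule: finite_ne_induct)
  case (singleton x)
  show ?case by blast
next
  case (insert x F)
  have "\<exists>a\<in>F. \<forall>s\<ge>t. s \<in> I a \<longrightarrow> (\<forall>a'\<in>F. s \<in> I a')"
  proof (rule insert.IH)
    show "t \<in> I a" if "a \<in> F" for a using insert.prems(1) that by simp
    show "w \<in> I a" if "a \<in> F" "s \<in> I a" "s' \<in> I a" "s \<le> w" "w \<le> s'" for a s s' w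
      using insert.prems(2)[OF insertI2 that(2-5)] that(1) .
  qed
  then obtain a where a: "a \<in> F" "\<forall>s\<ge>t. s \<in> I a \<longrightarrow> (\<forall>a'\<in>F. s \<in> I a')" by blast
  show ?case
  proof (cases "\<forall>s\<ge>t. s \<in> I a \<longrightarrow> s \<in> I x")
    case True
    then have "\<forall>s\<ge>t. s \<in> I a \<longrightarrow> (\<forall>a'\<in>insert x F. s \<in> I a')" using a(2) by blast
    then show ?thesis using a(1) by blast
  next
    case False
    then obtain s0 where s0: "s0 \<ge> t" "s0 \<in> I a" "s0 \<notin> I x" by blast
    have "s \<in> I a" if "s \<ge> t" "s \<in> I x" for s
    proof -
      have tx: "t \<in> I x" "t \<in> I a" using insert.prems(1) a by auto
      have "s \<le> s0"
        using insert.prems(2)[OF insertI1 tx(1) that(2) s0(1)] s0(3) by linarith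
      then show ?thesis using insert.prems(2)[OF insertI2[OF a(1)] tx(2) s0(2) that(1)] by simp
    qed
    then have "\<forall>s\<ge>t. s \<in> I x \<longrightarrow> (\<forall>a'\<in>insert x F. s \<in> I a')" using a(2) by blast
    then show ?thesis by blast
  qed
qed

text \<open>
  The intersection of finitely many intervals with a common point is the intersection of two of them:
  one has the smallest upper end, the other one the largest lower end.
\<close>

lemma finite_intervals_intersection:
  fixes t :: real
  assumes "finite A" "A \<noteq> {}"
    and t: "\<And>a. a \<in> A \<Longrightarrow> t \<in> I a"
    and convex: "\<And>a s s' w. a \<in> A \<Longrightarrow> s \<in> I a \<Longrightarrow> s' \<in> I a \<Longrightarrow> s \<le> w \<Longrightarrow> w \<le> s' \<Longrightarrow> w \<in> I a"
  obtains a1 a2 where "a1 \<in> A" "a2 \<in> A" "\<And>s a. s \<in> I a1 \<Longrightarrow> s \<in> I a2 \<Longrightarrow> a \<in> A \<Longrightarrow> s \<in> I a"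
proof -
  have "\<exists>a\<in>A. \<forall>s\<ge>t. s \<in> I a \<longrightarrow> (\<forall>a'\<in>A. s \<in> I a')"
  proof (rule finite_intervals_upper[OF assms(1,2) t])
    show "w \<in> I a" if "a \<in> A" "s \<in> I a" "s' \<in> I a" "s \<le> w" "w \<le> s'" for a s s' w
      using convex[OF that] .
  qed
  then obtain a1 where a1: "a1 \<in> A" "\<forall>s\<ge>t. s \<in> I a1 \<longrightarrow> (\<forall>a'\<in>A. s \<in> I a')" by blast
  have "\<exists>a\<in>A. \<forall>s\<ge>-t. s \<in> {x. - x \<in> I a} \<longrightarrow> (\<forall>a'\<in>A. s \<in> {x. - x \<in> I a'})"
  proof (rule finite_intervals_upper[OF assms(1,2)])
    show "w \<in> {x. - x \<in> I a}"
      if "a \<in> A" "s \<in> {x. - x \<in> I a}" "s' \<in> {x. - x \<in> I a}" "s \<le> w" "w \<le> s'" for a s s' w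
      using that convex[of a "- s'" "- s" "- w"] by simp
  qed (simp add: t)
  then obtain a2 where a2: "a2 \<in> A" "\<And>s a'. s \<ge> -t \<Longrightarrow> - s \<in> I a2 \<Longrightarrow> a' \<in> A \<Longrightarrow> - s \<in> I a'" by auto
  show ?thesis
  proof (rule that[OF a1(1) a2(1)])
    fix s a assume s: "s \<in> I a1" "s \<in> I a2" "a \<in> A"
    show "s \<in> I a"
    proof (cases "s \<ge> t")
      case True
      then show ?thesis using a1(2) s by blast
    next
      case False
      then show ?thesis using a2(2)[of "- s", simplified, OF _ s(2,3)] by simp
    qed
  qed
qed

text \<open>
  The cell of \<open>b\<close> is cut out by finitely many conditions whose number and shape depend on \<open>E\<close> and \<open>q\<close>
  only, with parameters taken from \<open>A\<close>; all points of the cell are related to all of \<open>A\<close>. In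
  model-theoretic terms this is one half of a distal cell decomposition. The parameters are given as a sequence \<open>c'\<close>, of
  which a semialgebraic predicate can use only a finite part. The cell allows only the first \<open>q\<close>
  coordinates of \<open>b\<close> to vary, which makes induction on \<open>q\<close> possible.

  On the line through \<open>b\<close> in the direction of the new coordinate, each \<open>a \<in> A\<close> singles out the
  component around \<open>b\<close> of the points related to \<open>a\<close>. By \<open>finite_intervals_intersection\<close>, the
  intersection of all these components is given by two elements \<open>a\<^sub>1, a\<^sub>2\<close> of \<open>A\<close>. That this
  intersection is related to \<open>a\<close> is a semialgebraic condition on the remaining coordinates, with
  the parameters \<open>a\<^sub>1, a\<^sub>2\<close> added to \<open>c\<close>; the induction hypothesis for this condition yields the
  cell in the remaining coordinates.
\<close>

theorem uniform_cells:
  fixes E :: "(nat \<Rightarrow> 'p::coordinates) \<times> 'p \<times> (nat \<Rightarrow> real) \<Rightarrow> bool"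
  assumes "semialg E"
  shows "\<exists>FF. finite FF \<and> (\<forall>F\<in>FF. semialg F) \<and>
    (\<forall>A c b. finite A \<and> range c \<subseteq> A \<and> (\<forall>a\<in>A. E (c, a, b)) \<longrightarrow>
      (\<exists>F\<in>FF. \<exists>c' :: nat \<Rightarrow> 'p. range c' \<subseteq> A \<and> F (c', b) \<and>
        (\<forall>y. (\<forall>i\<ge>q. y i = b i) \<and> F (c', y) \<longrightarrow> (\<forall>a\<in>A. E (c, a, y)))))"
  using assms
proof (induction q arbitrary: E)
  case 0
  \<comment> \<open>Without coordinates that may vary, the cell is the single point \<open>b\<close>, and the
    trivial condition defines it.\<close>
  define F0 where "F0 z = True" for z :: "(nat \<Rightarrow> 'p) \<times> (nat \<Rightarrow> real)"
  have "semialg F0" unfolding F0_def by (rule semialg_const)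
  have key: "\<exists>F\<in>{F0}. \<exists>c'. range c' \<subseteq> A \<and> F (c', b) \<and>
      (\<forall>y. (\<forall>i\<ge>0. y i = b i) \<and> F (c', y) \<longrightarrow> (\<forall>a\<in>A. E (c, a, y)))"
    if A: "finite A \<and> range c \<subseteq> A \<and> (\<forall>a\<in>A. E (c, a, b))" for A c b
  proof (intro bexI[of _ F0] exI[of _ c] conjI allI impI ballI)
    fix y a assume y: "(\<forall>i\<ge>0. y i = b i) \<and> F0 (c, y)" and a: "a \<in> A"
    then have "y = b" by auto
    then show "E (c, a, y)" using A a by blast
  qed (use A in \<open>simp_all add: F0_def\<close>)
  show ?case
  proof (rule exI[of _ "{F0}"], intro conjI)
    show "\<forall>F\<in>{F0}. semialg F" using \<open>semialg F0\<close> by simp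
    show "\<forall>A c b. finite A \<and> range c \<subseteq> A \<and> (\<forall>a\<in>A. E (c, a, b)) \<longrightarrow>
      (\<exists>F\<in>{F0}. \<exists>c'. range c' \<subseteq> A \<and> F (c', b) \<and>
        (\<forall>y. (\<forall>i\<ge>0. y i = b i) \<and> F (c', y) \<longrightarrow> (\<forall>a\<in>A. E (c, a, y))))"
      by (intro allI impI) (rule key)
  qed simp
next
  case (Suc q)
  define Q where "Q z = E (fst (fst z), fst (snd (fst z)), (snd (snd (fst z)))(q := snd z))"
    for z :: "((nat \<Rightarrow> 'p) \<times> 'p \<times> (nat \<Rightarrow> real)) \<times> real"
  have Q: "semialg Q"
    unfolding Q_def by (rule semialg_comp[OF Suc.prems]) (rule polymap_rules)+
  obtain N where N: "\<And>e s. \<not> alternates (\<lambda>c. Q (e, c)) N s"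
    using semialg_alternates_bounded[OF Q] by blast
  define lev where "lev i z = level (\<lambda>s. Q (z, s)) i (snd (snd z) q)" for i z
  have lev: "semialg (lev i)" for i
    proof -
    have "polymap (\<lambda>z :: (nat \<Rightarrow> 'p) \<times> 'p \<times> (nat \<Rightarrow> real). (z, snd (snd z) q))"
      by (rule polymap_rules)+
    from semialg_comp[OF semialg_level[OF Q] this] show ?thesis by (simp add: lev_def[abs_def])
  qed
  have lev_upd: "lev i (c, a, y(q := t)) = level (\<lambda>s. Q ((c, a, y), s)) i t" for i c a y t
    by (simp add: lev_def Q_def)
  \<comment> \<open>The parameter sequence starts with the two elements \<open>a\<^sub>1, a\<^sub>2\<close> and
    continues with \<open>c\<close>.\<close>
  define E' where "E' i j z = (case z of (d, a, y) \<Rightarrow>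
      \<forall>t. lev i (\<lambda>k. d (k + 2), d 0, y(q := t)) \<and> lev j (\<lambda>k. d (k + 2), d 1, y(q := t)) \<longrightarrow>
        E (\<lambda>k. d (k + 2), a, y(q := t)))" for i j z
  have "semialg (E' i j)" for i j
    unfolding E'_def case_prod_beta
    by (intro semialg_intros semialg_comp[OF lev] semialg_comp[OF Suc.prems]; (rule polymap_rules)+)
  note IH = Suc.IH[OF this]
  define cells where "cells i j FF \<longleftrightarrow> finite FF \<and> (\<forall>F\<in>FF. semialg F) \<and>
    (\<forall>A c b. finite A \<and> range c \<subseteq> A \<and> (\<forall>a\<in>A. E' i j (c, a, b)) \<longrightarrow>
      (\<exists>F\<in>FF. \<exists>c' :: nat \<Rightarrow> 'p. range c' \<subseteq> A \<and> F (c', b) \<and>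
        (\<forall>y. (\<forall>i\<ge>q. y i = b i) \<and> F (c', y) \<longrightarrow> (\<forall>a\<in>A. E' i j (c, a, y)))))"
    for i j FF
  have "\<exists>FF. cells i j FF" for i j unfolding cells_def by (rule IH)
  then obtain FF where "\<And>i j. cells i j (FF i j)" by metis
  note cells = this[unfolded cells_def]
  note FF = cells[THEN conjunct1] cells[THEN conjunct2, THEN conjunct1]
    cells[THEN conjunct2, THEN conjunct2]
  \<comment> \<open>The even entries of the parameter sequence are those of the cell in the remaining
    coordinates, the odd ones are \<open>a\<^sub>1, a\<^sub>2\<close> followed by \<open>c\<close>. Setting the
    new coordinate to \<open>0\<close> makes the first condition independent of it.\<close>
  define new where "new i j F z = (case z of (c, y) \<Rightarrow> F (\<lambda>k. c (2 * k), y(q := 0)) \<and>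
      lev i (\<lambda>k. c (2 * (k + 2) + 1), c 1, y) \<and> lev j (\<lambda>k. c (2 * (k + 2) + 1), c 3, y))"
    for i j and F :: "(nat \<Rightarrow> 'p) \<times> (nat \<Rightarrow> real) \<Rightarrow> bool" and z
  have new: "semialg (new i j F)" if "semialg F" for i j F
    unfolding new_def case_prod_beta
    by (intro semialg_intros semialg_comp[OF lev] semialg_comp[OF that]; (rule polymap_rules)+)
  define GG where "GG = (\<Union>i<N. \<Union>j<N. new i j ` FF i j)"
  have GG: "finite GG" "\<forall>F\<in>GG. semialg F" using FF(1,2) new by (auto simp: GG_def)
  have cell: "\<exists>F\<in>GG. \<exists>c'. range c' \<subseteq> A \<and> F (c', b) \<and>
      (\<forall>y. (\<forall>i\<ge>Suc q. y i = b i) \<and> F (c', y) \<longrightarrow> (\<forall>a\<in>A. E (c, a, y)))"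
    if "finite A \<and> range c \<subseteq> A \<and> (\<forall>a\<in>A. E (c, a, b))" for A c b
  proof -
    from that have A: "finite A" "range c \<subseteq> A" "\<And>a. a \<in> A \<Longrightarrow> E (c, a, b)" by auto
    have "\<exists>i<N. level (\<lambda>s. Q ((c, a, b), s)) i (b q)" if "a \<in> A" for a
    proof -
      have "Q ((c, a, b), b q)" using A(3)[OF that] by (simp add: Q_def)
      then show ?thesis using level_exists[OF _ N] by metis
    qed
    then obtain L where L: "\<And>a. a \<in> A \<Longrightarrow> L a < N"
      "\<And>a. a \<in> A \<Longrightarrow> level (\<lambda>s. Q ((c, a, b), s)) (L a) (b q)" by metis
    define I where "I a = {s. level (\<lambda>s. Q ((c, a, b), s)) (L a) s}" for a
    have "A \<noteq> {}" using A(2) by auto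
    obtain a1 a2 where a: "a1 \<in> A" "a2 \<in> A"
      "\<And>s a. s \<in> I a1 \<Longrightarrow> s \<in> I a2 \<Longrightarrow> a \<in> A \<Longrightarrow> s \<in> I a"
    proof (rule finite_intervals_intersection[OF A(1) \<open>A \<noteq> {}\<close>])
      show "b q \<in> I a" if "a \<in> A" for a using L(2)[OF that] by (simp add: I_def)
      show "w \<in> I a" if "a \<in> A" "s \<in> I a" "s' \<in> I a" "s \<le> w" "w \<le> s'" for a s s' w
        using that level_convex unfolding I_def by blast
    qed blast
    define d where "d = case_nat a1 (case_nat a2 c)"
    have d: "(\<lambda>k. d (k + 2)) = c" "d 0 = a1" "d 1 = a2" "range d \<subseteq> A"
      using A(2) a(1,2) by (auto simp: d_def image_subset_iff split: nat.splits)
    have E'b: "E' (L a1) (L a2) (d, a, b(q := 0))" if "a \<in> A" for a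
      unfolding E'_def prod.case d
    proof (intro allI impI)
      fix t assume "lev (L a1) (c, a1, b(q := 0, q := t)) \<and> lev (L a2) (c, a2, b(q := 0, q := t))"
      then have "t \<in> I a1" "t \<in> I a2" by (auto simp: lev_upd I_def)
      then have "t \<in> I a" using a that by blast
      then show "E (c, a, b(q := 0, q := t))" by (simp add: I_def level_def Q_def)
    qed
    have "finite A \<and> range d \<subseteq> A \<and> (\<forall>a\<in>A. E' (L a1) (L a2) (d, a, b(q := 0)))"
      using A(1) d(4) E'b by blast
    from FF(3)[rule_format, OF this] obtain F c' where F: "F \<in> FF (L a1) (L a2)"
      "range c' \<subseteq> A" "F (c', b(q := 0))"
      "\<And>y a. (\<forall>i\<ge>q. y i = (b(q := 0)) i) \<Longrightarrow> F (c', y) \<Longrightarrow> a \<in> A \<Longrightarrow> E' (L a1) (L a2) (d, a, y)"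
      by (elim bexE exE conjE) (rule that, blast+)
    define c2 where "c2 k = (if even k then c' (k div 2) else d (k div 2))" for k
    have c2: "(\<lambda>k. c2 (2 * k)) = c'" "(\<lambda>k. c2 (2 * (k + 2) + 1)) = c" "c2 1 = a1" "c2 3 = a2"
      "range c2 \<subseteq> A"
      proof -
      show "(\<lambda>k. c2 (2 * k)) = c'" by (simp add: c2_def)
      have "c2 (2 * (k + 2) + 1) = d (k + 2)" for k by (simp add: c2_def)
      then show "(\<lambda>k. c2 (2 * (k + 2) + 1)) = c" using d(1) by simp
      show "c2 1 = a1" "c2 3 = a2" using d(2,3) by (simp_all add: c2_def)
      show "range c2 \<subseteq> A" using F(2) d(4) by (auto simp: c2_def)
    qed
    let ?F = "new (L a1) (L a2) F"
    have "?F \<in> GG" using F(1) L(1) a by (auto simp: GG_def)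
    moreover have "?F (c2, b)"
      unfolding new_def prod.case c2
      using F(3) L(2) a lev_upd[of _ c _ b "b q"] by auto
    moreover have "E (c, a, y)" if y: "\<forall>i\<ge>Suc q. y i = b i" "?F (c2, y)" "a \<in> A" for y a
    proof -
      have yF: "F (c', y(q := 0))" "lev (L a1) (c, a1, y)" "lev (L a2) (c, a2, y)"
        using y(2) unfolding new_def prod.case c2 by auto
      have "\<forall>i\<ge>q. (y(q := 0)) i = (b(q := 0)) i" using y(1) by auto
      from F(4)[OF this yF(1) y(3)] have "E' (L a1) (L a2) (d, a, y(q := 0))" .
      from this[unfolded E'_def prod.case d, rule_format, of "y q"] yF(2,3)
      show ?thesis by simp
    qed
    ultimately show ?thesis using c2(5) by blast
  qed
  show ?case
  proof (rule exI[of _ GG], intro conjI GG)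
    show "\<forall>A c b. finite A \<and> range c \<subseteq> A \<and> (\<forall>a\<in>A. E (c, a, b)) \<longrightarrow>
      (\<exists>F\<in>GG. \<exists>c'. range c' \<subseteq> A \<and> F (c', b) \<and>
        (\<forall>y. (\<forall>i\<ge>Suc q. y i = b i) \<and> F (c', y) \<longrightarrow> (\<forall>a\<in>A. E (c, a, y))))"
      by (intro allI impI) (rule cell)
  qed
qed

section \<open>Uniform finiteness\<close>

text \<open>
  If no two points of \<open>P\<close> are joined by an interval inside \<open>P\<close>, then between any two of them \<open>P\<close> fails
  somewhere, so the points of \<open>P\<close> themselves form an alternating chain.
\<close>

lemma few_alternations_dichotomy:
  assumes "\<And>s. \<not> alternates P N s"
  shows "(finite {s. P s} \<and> card {s. P s} \<le> N) \<or> (\<exists>s t. s < t \<and> (\<forall>w. s \<le> w \<and> w \<le> t \<longrightarrow> P w))"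
proof (rule ccontr)
  assume neg: "\<not> ?thesis"
  then have gap: "\<exists>w>s. w < t \<and> \<not> P w" if "P s" "P t" "s < t" for s t
    using that by (metis less_le)
  have chain: "P s \<longrightarrow> (\<forall>x\<in>X. P x \<and> x < s) \<longrightarrow> alternates P (card X) s" if "finite X" for X s
    using that
  proof (induction X arbitrary: s rule: finite_linorder_max_induct)
    case (insert b A)
    show ?case
    proof (intro impI)
      assume s: "P s" "\<forall>x\<in>insert b A. P x \<and> x < s"
      then have "alternates P (card A) b" using insert.IH[of b] insert.hyps by auto
      moreover obtain w where "b < w" "w < s" "\<not> P w" using gap[of b s] s by auto
      ultimately have "alternates P (Suc (card A)) s" using s by auto
      moreover have "b \<notin> A" using insert.hyps by auto
      ultimately show "alternates P (card (insert b A)) s" using insert.hyps by simp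
    qed
  qed simp
  obtain X where X: "X \<subseteq> {s. P s}" "finite X" "card X = Suc N"
  proof (cases "finite {s. P s}")
    case True
    then have "Suc N \<le> card {s. P s}" using neg by auto
    then show ?thesis using that obtain_subset_with_card_n by metis
  next
    case False
    then show ?thesis using that infinite_arbitrarily_large by metis
  qed
  define m where "m = Max X"
  have m: "m \<in> X" "\<And>x. x \<in> X \<Longrightarrow> x \<le> m"
    using X by (auto simp: m_def intro!: Max_in)
  have "alternates P (card (X - {m})) m"
    using chain[of "X - {m}" m] X m by (force simp: less_le)
  then show False using X m assms[of m] by (simp add: card_Diff_singleton)
qed

text \<open>
  Vectors of length \<open>n\<close> are represented as sequences that vanish from \<open>n\<close> on. The induction eliminates the
  last coordinate first, which keeps the type of the remaining variables unchanged.
\<close>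

lemma semialg_ex_finite_block:
  fixes F :: "'a::coordinates \<times> (nat \<Rightarrow> real) \<Rightarrow> bool"
  assumes "semialg F"
  shows "semialg (\<lambda>e. \<exists>y. (\<forall>j\<ge>n. y j = 0) \<and> F (e, y))"
  using assms
proof (induction n arbitrary: F)
  case 0
  have "(\<exists>y. (\<forall>j\<ge>0. y j = 0) \<and> F (e, y)) \<longleftrightarrow> F (e, \<lambda>_. 0)" for e
    by (metis ext zero_le)
  moreover have "semialg (\<lambda>e. F (e, \<lambda>_. 0))"
    by (rule semialg_comp[OF 0]) (rule polymap_rules)+
  ultimately show ?case by simp
next
  case (Suc n)
  have "semialg (\<lambda>z. \<exists>t. F (fst z, (snd z)(n := t)))"
    by (intro semialg_ex semialg_comp[OF Suc.prems]; (rule polymap_rules)+)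
  from Suc.IH[OF this]
  have "semialg (\<lambda>e. \<exists>y. (\<forall>j\<ge>n. y j = 0) \<and> (\<exists>t. F (e, y(n := t))))" by simp
  moreover have "(\<exists>y. (\<forall>j\<ge>Suc n. y j = 0) \<and> F (e, y)) \<longleftrightarrow>
      (\<exists>y. (\<forall>j\<ge>n. y j = 0) \<and> (\<exists>t. F (e, y(n := t))))" for e
  proof (intro iffI; elim exE conjE)
    fix y assume "\<forall>j\<ge>Suc n. y j = 0" "F (e, y)"
    then show "\<exists>y. (\<forall>j\<ge>n. y j = 0) \<and> (\<exists>t. F (e, y(n := t)))"
      by (intro exI[of _ "y(n := 0)"]) (auto intro!: exI[of _ "y n"])
  next
    fix y t assume "\<forall>j\<ge>n. y j = 0" "F (e, y(n := t))"
    then show "\<exists>y. (\<forall>j\<ge>Suc n. y j = 0) \<and> F (e, y)"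
      by (intro exI[of _ "y(n := t)"]) auto
  qed
  ultimately show ?case by simp
qed

lemma nat_sets_into_interval:
  fixes s t :: real
  assumes "s < t"
  obtains g :: "nat set \<Rightarrow> real" where "inj g" "\<And>X. s \<le> g X" "\<And>X. g X \<le> t"
proof -
  obtain f :: "nat set \<Rightarrow> real" where f: "inj f" "range f \<subseteq> {0..<1}"
    using nat_sets_lepoll_reals01 unfolding lepoll_def by blast
  show ?thesis
  proof (rule that[of "\<lambda>X. s + (t - s) * f X"])
    show "inj (\<lambda>X. s + (t - s) * f X)" using f(1) assms by (auto simp: inj_def)
    fix X
    have "0 \<le> f X" "f X \<le> 1" using f(2) by (auto simp: image_subset_iff less_imp_le)
    then have *: "0 \<le> (t - s) * f X" "(t - s) * f X \<le> (t - s) * 1"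
      using assms by (auto intro!: mult_nonneg_nonneg mult_left_mono simp del: mult_1_right)
    show "s \<le> s + (t - s) * f X" using *(1) by simp
    show "s + (t - s) * f X \<le> t" using *(2) unfolding mult_1_right by (simp only: le_diff_eq add.commute)
  qed
qed

text \<open>
  A set is finite precisely if its coordinate projections are. If one projection exceeds its bound, then it
  contains an interval, and choosing a preimage of each point of the interval gives continuum many
  elements.
\<close>

theorem semialg_uniform_finiteness:
  fixes F :: "'a::coordinates \<times> (nat \<Rightarrow> real) \<Rightarrow> bool"
  assumes F: "semialg F"
  shows "\<exists>N. \<forall>e. (finite {y. (\<forall>j\<ge>n. y j = 0) \<and> F (e, y)} \<and>
      card {y. (\<forall>j\<ge>n. y j = 0) \<and> F (e, y)} \<le> N) \<or>
      (\<exists>g :: nat set \<Rightarrow> nat \<Rightarrow> real. inj g \<and> range g \<subseteq> {y. (\<forall>j\<ge>n. y j = 0) \<and> F (e, y)})"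
proof -
  define proj where "proj i z = (\<exists>y. (\<forall>j\<ge>n. y j = 0) \<and> F (fst z, y) \<and> y i = snd z)"
    for i and z :: "'a \<times> real"
  have "semialg (proj i)" for i
  proof -
    have "semialg (\<lambda>z. F (fst (fst z), snd z) \<and> snd z i = snd (fst z))"
      by (intro semialg_intros semialg_comp[OF F]; (rule polymap_rules)+)
    from semialg_ex_finite_block[OF this, of n] show ?thesis by (simp add: proj_def[abs_def])
  qed
  then have "\<exists>N. \<forall>e s. \<not> alternates (\<lambda>c. proj i (e, c)) N s" for i
    using semialg_alternates_bounded by metis
  then obtain N where N: "\<And>i e s. \<not> alternates (\<lambda>c. proj i (e, c)) (N i) s" by metis
  show ?thesis
  proof (intro exI[of _ "\<Prod>i<n. N i"] allI)
    fix e
    let ?S = "{y. (\<forall>j\<ge>n. y j = 0) \<and> F (e, y)}"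
    let ?T = "\<lambda>i. {s. proj i (e, s)}"
    show "(finite ?S \<and> card ?S \<le> (\<Prod>i<n. N i)) \<or>
      (\<exists>g :: nat set \<Rightarrow> nat \<Rightarrow> real. inj g \<and> range g \<subseteq> ?S)"
    proof (cases "\<forall>i<n. finite (?T i) \<and> card (?T i) \<le> N i")
      case True
      let ?r = "\<lambda>y. restrict y {..<n}"
      have inj: "inj_on ?r ?S"
      proof (rule inj_onI)
        fix y z assume yz: "y \<in> ?S" "z \<in> ?S" "?r y = ?r z"
        have "y j = z j" for j
        proof (cases "j < n")
          case True
          moreover have "?r y j = ?r z j" using yz(3) by simp
          ultimately show ?thesis by simp
        qed (use yz in auto)
        then show "y = z" by auto
      qed
      have sub: "?r ` ?S \<subseteq> PiE {..<n} ?T"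
        by (intro image_subsetI) (auto simp: proj_def restrict_PiE_iff)
      have fin: "finite (PiE {..<n} ?T)" using True by (intro finite_PiE) auto
      have "card ?S \<le> card (PiE {..<n} ?T)" using card_inj_on_le[OF inj sub fin] .
      also have "\<dots> = (\<Prod>i<n. card (?T i))" by (simp add: card_PiE)
      also have "\<dots> \<le> (\<Prod>i<n. N i)" using True by (intro prod_mono) auto
      finally show ?thesis using inj_on_finite[OF inj sub fin] by blast
    next
      case False
      then obtain i where i: "i < n" "\<not> (finite (?T i) \<and> card (?T i) \<le> N i)" by blast
      then obtain s t where st: "s < t" "\<And>w. s \<le> w \<Longrightarrow> w \<le> t \<Longrightarrow> proj i (e, w)"
        using few_alternations_dichotomy[of "\<lambda>c. proj i (e, c)", OF N] by blast
      obtain h :: "nat set \<Rightarrow> real" where h: "inj h" "\<And>X. s \<le> h X" "\<And>X. h X \<le> t"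
        using nat_sets_into_interval[OF st(1)] by blast
      have "\<exists>y. (\<forall>j\<ge>n. y j = 0) \<and> F (e, y) \<and> y i = h X" for X
        using st(2)[OF h(2,3)] by (simp add: proj_def)
      then obtain g where g: "\<And>X. (\<forall>j\<ge>n. g X j = 0) \<and> F (e, g X) \<and> g X i = h X" by metis
      then have "inj g" using h(1) by (metis injD injI)
      moreover have "range g \<subseteq> ?S" using g by auto
      ultimately show ?thesis by blast
    qed
  qed
qed

section \<open>Large complete bipartite subgraphs\<close>

text \<open>
  This is what bounds the number of cells over a finite parameter set.
\<close>

lemma semialg_finite_support:
  fixes F :: "(nat \<Rightarrow> 'p::coordinates) \<times> 'b::coordinates \<Rightarrow> bool"
  assumes "semialg F"
  shows "\<exists>K. \<forall>c c' y. (\<forall>k<K. c k = c' k) \<longrightarrow> F (c, y) = F (c', y)"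
proof -
  have poly: "\<exists>K. \<forall>c c' y. (\<forall>k<K. c k = c' k) \<longrightarrow> p (c, y) = p (c', y)"
    if "polyfun p" for p :: "(nat \<Rightarrow> 'p) \<times> 'b \<Rightarrow> real"
    using that
  proof (induction p rule: polyfun.induct)
    case (coord x)
    then consider (1) u k where "x = (\<lambda>z. u (fst z k))" | (2) u where "x = (\<lambda>z. u (snd z))"
      by (auto simp: coords_prod_def coords_fun_def o_def)
    then show ?case
    proof cases
      case 1
      then show ?thesis by (intro exI[of _ "Suc k"]) auto
    qed auto
  next
    case (add p q)
    then obtain K L where KL: "\<And>c c' y. (\<forall>k<K. c k = c' k) \<longrightarrow> p (c, y) = p (c', y)"
      "\<And>c c' y. (\<forall>k<L. c k = c' k) \<longrightarrow> q (c, y) = q (c', y)" by blast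
    have "p (c, y) + q (c, y) = p (c', y) + q (c', y)" if "\<forall>k<max K L. c k = c' k" for c c' y
      using KL[of c c' y] that by simp
    then show ?case by blast
  next
    case (mult p q)
    then obtain K L where KL: "\<And>c c' y. (\<forall>k<K. c k = c' k) \<longrightarrow> p (c, y) = p (c', y)"
      "\<And>c c' y. (\<forall>k<L. c k = c' k) \<longrightarrow> q (c, y) = q (c', y)" by blast
    have "p (c, y) * q (c, y) = p (c', y) * q (c', y)" if "\<forall>k<max K L. c k = c' k" for c c' y
      using KL[of c c' y] that by simp
    then show ?case by blast
  qed auto
  obtain G where G: "finite G" "\<And>p. p \<in> G \<Longrightarrow> polyfun p"
    "\<And>z z'. same_signs G z z' \<Longrightarrow> F z = F z'"
    using assms unfolding semialg_def by blast
  obtain K where K: "\<And>p c c' y. p \<in> G \<Longrightarrow> (\<forall>k<K p. c k = c' k) \<Longrightarrow> p (c, y) = p (c', y)"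
    using poly[OF G(2)] by metis
  show ?thesis
  proof (intro exI[of _ "\<Sum>p\<in>G. K p"] allI impI)
    fix c c' :: "nat \<Rightarrow> 'p" and y :: 'b
    assume eq: "\<forall>k<(\<Sum>p\<in>G. K p). c k = c' k"
    have "p (c, y) = p (c', y)" if "p \<in> G" for p
    proof (rule K[OF that])
      have "K p \<le> (\<Sum>p\<in>G. K p)" using that G(1) by (simp add: member_le_sum)
      then show "\<forall>k<K p. c k = c' k" using eq by auto
    qed
    then have "same_signs G (c, y) (c', y)"
      unfolding same_signs_def by (intro ballI arg_cong[of _ _ sgn])
    then show "F (c, y) = F (c', y)" by (rule G(3))
  qed
qed

text \<open>
  Each vertex \<open>b\<close> lies in a cell with parameters from the finite set \<open>A\<close>, and there are at most
  \<open>m ^ K F\<close> cells of shape \<open>F\<close>. If all these cells were finite, uniform finiteness would bound the number of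
  vertices \<open>b\<close>. So one cell has continuum many points, and so has the set of all vertices related to
  the whole cell, because it contains \<open>A\<close>.
\<close>

theorem semialg_complete_bipartite:
  fixes E :: "(nat \<Rightarrow> real) \<times> (nat \<Rightarrow> real) \<Rightarrow> bool"
  assumes E: "semialg E"
    and finite_K: "\<And>m. \<exists>A B. finite A \<and> card A = m \<and> finite B \<and> card B = m \<and>
      (\<forall>x\<in>A \<union> B. \<forall>j\<ge>n. x j = 0) \<and> (\<forall>a\<in>A. \<forall>b\<in>B. E (a, b))"
  obtains f g :: "nat set \<Rightarrow> nat \<Rightarrow> real" where "inj f" "inj g"
    "\<And>X j. j \<ge> n \<Longrightarrow> f X j = 0" "\<And>X j. j \<ge> n \<Longrightarrow> g X j = 0" "\<And>X Y. E (f X, g Y)"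
proof (rule ccontr)
  assume contra: "\<not> thesis"
  note found = that
  define E3 where "E3 z = E (fst (snd z), snd (snd z))"
    for z :: "(nat \<Rightarrow> nat \<Rightarrow> real) \<times> (nat \<Rightarrow> real) \<times> (nat \<Rightarrow> real)"
  have "semialg E3" unfolding E3_def by (rule semialg_comp[OF E]) (rule polymap_rules)+
  from uniform_cells[OF this, of n] obtain FF where FF0: "finite FF \<and> (\<forall>F\<in>FF. semialg F) \<and>
      (\<forall>A c b. finite A \<and> range c \<subseteq> A \<and> (\<forall>a\<in>A. E3 (c, a, b)) \<longrightarrow>
        (\<exists>F\<in>FF. \<exists>c' :: nat \<Rightarrow> nat \<Rightarrow> real. range c' \<subseteq> A \<and> F (c', b) \<and>
          (\<forall>y. (\<forall>i\<ge>n. y i = b i) \<and> F (c', y) \<longrightarrow> (\<forall>a\<in>A. E3 (c, a, y)))))"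
    by (rule exE)
  then have FF: "finite FF" "\<And>F. F \<in> FF \<Longrightarrow> semialg F" by simp_all
  have cell: "\<exists>F\<in>FF. \<exists>c' :: nat \<Rightarrow> nat \<Rightarrow> real. range c' \<subseteq> A \<and> F (c', b) \<and>
      (\<forall>y. (\<forall>i\<ge>n. y i = b i) \<and> F (c', y) \<longrightarrow> (\<forall>a\<in>A. E (a, y)))"
    if "finite A" "a0 \<in> A" "\<forall>a\<in>A. E (a, b)" for A a0 b
    using FF0[THEN conjunct2, THEN conjunct2, rule_format, of A "\<lambda>_. a0" b] that
    by (simp add: E3_def image_subset_iff)
  define Q where "Q F c = {y. (\<forall>j\<ge>n. y j = 0) \<and> F (c, y)}"
    for F :: "(nat \<Rightarrow> nat \<Rightarrow> real) \<times> (nat \<Rightarrow> real) \<Rightarrow> bool" and c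
  define common where "common F z \<longleftrightarrow> \<not> (\<exists>y. (\<forall>j\<ge>n. y j = 0) \<and> (F (fst z, y) \<and> \<not> E (snd z, y)))"
    for F :: "(nat \<Rightarrow> nat \<Rightarrow> real) \<times> (nat \<Rightarrow> real) \<Rightarrow> bool" and z
  have common: "semialg (common F)" if "F \<in> FF" for F
  proof -
    have "semialg (\<lambda>w. F (fst (fst w), snd w) \<and> \<not> E (snd (fst w), snd w))"
      by (intro semialg_intros semialg_comp[OF FF(2)[OF that]] semialg_comp[OF E]; (rule polymap_rules)+)
    from semialg_not[OF semialg_ex_finite_block[OF this, of n]] show ?thesis
      by (simp add: common_def[abs_def])
  qed
  define P where "P F c = {x. (\<forall>j\<ge>n. x j = 0) \<and> common F (c, x)}"
    for F :: "(nat \<Rightarrow> nat \<Rightarrow> real) \<times> (nat \<Rightarrow> real) \<Rightarrow> bool" and c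
  define big where "big S \<longleftrightarrow> (\<exists>g :: nat set \<Rightarrow> nat \<Rightarrow> real. inj g \<and> range g \<subseteq> S)" for S
  define small where "small S N \<longleftrightarrow> finite S \<and> card S \<le> N" for S :: "(nat \<Rightarrow> real) set" and N
  have "\<exists>N. \<forall>c. small (Q F c) N \<or> big (Q F c)" if "F \<in> FF" for F
    unfolding small_def big_def Q_def by (rule semialg_uniform_finiteness[OF FF(2)[OF that]])
  then obtain N1 where N1: "\<And>F c. F \<in> FF \<Longrightarrow> small (Q F c) (N1 F) \<or> big (Q F c)" by metis
  have "\<exists>N. \<forall>c. small (P F c) N \<or> big (P F c)" if "F \<in> FF" for F
    unfolding small_def big_def P_def by (rule semialg_uniform_finiteness[OF common[OF that]])
  then obtain N2 where N2: "\<And>F c. F \<in> FF \<Longrightarrow> small (P F c) (N2 F) \<or> big (P F c)" by metis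
  define supp where "supp F K \<longleftrightarrow> (\<forall>c c' y. (\<forall>k<K. c k = c' k) \<longrightarrow> F (c, y) = F (c', y))"
    for F :: "(nat \<Rightarrow> nat \<Rightarrow> real) \<times> (nat \<Rightarrow> real) \<Rightarrow> bool" and K :: nat
  have "\<exists>K. supp F K" if "F \<in> FF" for F
    unfolding supp_def by (rule semialg_finite_support[OF FF(2)[OF that]])
  then obtain K where "\<And>F. F \<in> FF \<Longrightarrow> supp F (K F)" by metis
  then have K: "F (c, y) = F (c', y)" if "F \<in> FF" "\<forall>k<K F. c k = c' k" for F c c' y
    using that unfolding supp_def by blast
  \<comment> \<open>With \<open>m\<close> vertices \<open>a\<close> on one side, the set of all vertices related
    to a whole cell is too large to be finite; with \<open>M\<close> vertices \<open>b\<close> on the other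
    side, there are too many for all cells to be finite.\<close>
  define m where "m = Suc (\<Sum>F\<in>FF. N2 F)"
  define M where "M = Suc (\<Sum>F\<in>FF. m ^ K F * N1 F)"
  obtain A0 B where AB0: "finite A0" "card A0 = max m M" "finite B" "card B = max m M"
    "\<forall>x\<in>A0 \<union> B. \<forall>j\<ge>n. x j = 0" "\<forall>a\<in>A0. \<forall>b\<in>B. E (a, b)" using finite_K by metis
  obtain A where A: "A \<subseteq> A0" "card A = m" "finite A"
    using obtain_subset_with_card_n[of m A0] AB0 by (metis max.cobounded1)
  have pad: "\<And>x j. x \<in> A \<Longrightarrow> j \<ge> n \<Longrightarrow> x j = 0" "\<And>x j. x \<in> B \<Longrightarrow> j \<ge> n \<Longrightarrow> x j = 0"
    using A AB0 by auto
  have "A \<noteq> {}" using A by (auto simp: m_def)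
  then obtain a0 where a0: "a0 \<in> A" by blast
  \<comment> \<open>Entries beyond the relevant ones are frozen to \<open>a0\<close>, so that only finitely many
    parameter sequences remain.\<close>
  define tup where "tup k l = (\<lambda>i. if i < k then l ! i else a0)" for k l
  define T where "T k = tup k ` {l. set l \<subseteq> A \<and> length l = k}" for k
  have T: "finite (T k) \<and> card (T k) \<le> m ^ k" for k
    unfolding T_def using A card_image_le[OF finite_lists_length_eq[OF A(3), of k], of "tup k"]
    by (simp add: finite_lists_length_eq card_lists_length_eq)
  define U where "U F = (\<Union>c\<in>{c \<in> T (K F). small (Q F c) (N1 F)}. Q F c)" for F
  have U: "finite (U F) \<and> card (U F) \<le> m ^ K F * N1 F" for F
  proof -
    let ?C = "{c \<in> T (K F). small (Q F c) (N1 F)}"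
    have fin: "finite ?C" using T by simp
    have "card (U F) \<le> (\<Sum>c\<in>?C. card (Q F c))" unfolding U_def by (rule card_UN_le[OF fin])
    also have "\<dots> \<le> (\<Sum>c\<in>?C. N1 F)" by (rule sum_mono) (simp add: small_def)
    also have "\<dots> = card ?C * N1 F" by simp
    also have "\<dots> \<le> m ^ K F * N1 F"
      using card_mono[of "T (K F)" ?C] T[of "K F"] by (intro mult_right_mono) auto
    finally show ?thesis using fin by (simp add: U_def small_def)
  qed
  have "b \<in> (\<Union>F\<in>FF. U F)" if b: "b \<in> B" for b
  proof -
    have "\<forall>a\<in>A. E (a, b)" using AB0 A b by auto
    from cell[OF A(3) a0 this] obtain F c' where F: "F \<in> FF" "range c' \<subseteq> A" "F (c', b)"
      "\<And>y a. (\<forall>i\<ge>n. y i = b i) \<Longrightarrow> F (c', y) \<Longrightarrow> a \<in> A \<Longrightarrow> E (a, y)"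
      by (elim bexE exE conjE) (rule that, blast+)
    define c where "c = tup (K F) (map c' [0..<K F])"
    have "c \<in> T (K F)" unfolding T_def c_def using F(2) by (intro imageI) auto
    have Fc: "F (c, y) = F (c', y)" for y
      by (rule K[OF F(1)]) (simp add: c_def tup_def)
    have "A \<subseteq> P F c"
    proof
      fix x assume x: "x \<in> A"
      have "E (x, y)" if "\<forall>j\<ge>n. y j = 0" "F (c', y)" for y
        by (rule F(4)[OF _ that(2) x]) (use that(1) pad(2)[OF b] in simp)
      then show "x \<in> P F c" using pad(1)[OF x] by (auto simp: P_def common_def Fc)
    qed
    have "\<not> (small (P F c) (N2 F))"
    proof
      assume *: "small (P F c) (N2 F)"
      then have "m \<le> N2 F" using card_mono[OF _ \<open>A \<subseteq> P F c\<close>] A * by (simp add: small_def)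
      moreover have "N2 F \<le> (\<Sum>F\<in>FF. N2 F)" using F(1) FF(1) by (simp add: member_le_sum)
      ultimately show False by (simp add: m_def)
    qed
    then obtain f :: "nat set \<Rightarrow> nat \<Rightarrow> real" where f: "inj f" "range f \<subseteq> P F c"
      using N2[OF F(1), of c] unfolding big_def by blast
    have "\<not> big (Q F c)"
    proof
      assume "big (Q F c)"
      then obtain g :: "nat set \<Rightarrow> nat \<Rightarrow> real" where g: "inj g" "range g \<subseteq> Q F c"
        unfolding big_def by blast
      have "E (f X, g Y)" for X Y
      proof -
        have "f X \<in> P F c" "g Y \<in> Q F c" using f(2) g(2) by auto
        then show ?thesis unfolding P_def Q_def common_def by auto
      qed
      then have thesis using found[OF f(1) g(1)] f(2) g(2) by (simp add: P_def Q_def image_subset_iff)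
      then show False using contra by contradiction
    qed
    then have "small (Q F c) (N1 F)" using N1[OF F(1)] by blast
    moreover have "b \<in> Q F c" using F(3) pad(2)[OF b] by (simp add: Q_def Fc)
    ultimately show ?thesis using \<open>c \<in> T (K F)\<close> F(1) unfolding U_def by blast
  qed
  then have "card B \<le> card (\<Union>F\<in>FF. U F)" using FF(1) U by (intro card_mono) auto
  also have "\<dots> \<le> (\<Sum>F\<in>FF. card (U F))" by (rule card_UN_le[OF FF(1)])
  also have "\<dots> \<le> (\<Sum>F\<in>FF. m ^ K F * N1 F)" using U by (intro sum_mono) auto
  finally show False using AB0(4) by (simp add: M_def)
qed

section \<open>Coloring number of graphs without large complete bipartite subgraphs\<close>

definition common_nbrs :: "'a set \<Rightarrow> 'a rel \<Rightarrow> 'a set \<Rightarrow> 'a set" where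
  "common_nbrs V E F = {y \<in> V. \<forall>x\<in>F. (x, y) \<in> E}"

definition nbr_closed :: "nat \<Rightarrow> 'a set \<Rightarrow> 'a rel \<Rightarrow> 'a set \<Rightarrow> bool" where
  "nbr_closed m V E T \<longleftrightarrow> (\<forall>F. F \<subseteq> T \<and> finite F \<and> card F = m \<longrightarrow> common_nbrs V E F \<subseteq> T)"

text \<open>
  The closure under common neighbors of \<open>m\<close> vertices is built in countably many steps, so that its
  cardinality can be bounded.
\<close>

definition nbr_step :: "nat \<Rightarrow> 'a set \<Rightarrow> 'a rel \<Rightarrow> 'a set \<Rightarrow> 'a set" where
  "nbr_step m V E T = T \<union> (\<Union>F\<in>{F. F \<subseteq> T \<and> finite F \<and> card F = m}. common_nbrs V E F)"

definition nbr_closure :: "nat \<Rightarrow> 'a set \<Rightarrow> 'a rel \<Rightarrow> 'a set \<Rightarrow> 'a set" where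
  "nbr_closure m V E S = (\<Union>n. (nbr_step m V E ^^ n) S)"

lemma nbr_step_mono: "S \<subseteq> T \<Longrightarrow> nbr_step m V E S \<subseteq> nbr_step m V E T"
  unfolding nbr_step_def by blast

lemma nbr_step_iterate_mono: "S \<subseteq> T \<Longrightarrow> (nbr_step m V E ^^ n) S \<subseteq> (nbr_step m V E ^^ n) T"
  by (induction n) (auto dest: nbr_step_mono simp: nbr_step_mono)

lemma nbr_closure_mono: "S \<subseteq> T \<Longrightarrow> nbr_closure m V E S \<subseteq> nbr_closure m V E T"
  unfolding nbr_closure_def by (intro UN_mono nbr_step_iterate_mono) auto

lemma subset_nbr_closure: "S \<subseteq> nbr_closure m V E S"
  unfolding nbr_closure_def by (metis UN_upper UNIV_I funpow_0)

lemma nbr_closed_nbr_closure: "nbr_closed m V E (nbr_closure m V E S)"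
  unfolding nbr_closed_def
proof (intro allI impI)
  fix F assume F: "F \<subseteq> nbr_closure m V E S \<and> finite F \<and> card F = m"
  let ?T = "\<lambda>n. (nbr_step m V E ^^ n) S"
  have "?T n \<subseteq> ?T (Suc n)" for n by (auto simp: nbr_step_def)
  then have mono: "i \<le> j \<Longrightarrow> ?T i \<subseteq> ?T j" for i j by (rule lift_Suc_mono_le)
  have "\<exists>n. F \<subseteq> ?T n"
  proof -
    have "finite F" "F \<subseteq> \<Union> (range ?T)" using F by (auto simp: nbr_closure_def)
    then obtain C where "C \<in> range ?T" "F \<subseteq> C"
    proof (rule finite_subset_Union_chain)
      show "subset.chain UNIV (range ?T)"
        unfolding subset_chain_def using mono by (auto, metis nat_le_linear subsetD)
    qed auto
    then show ?thesis by auto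
  qed
  then obtain n where "F \<subseteq> ?T n" by blast
  then have "common_nbrs V E F \<subseteq> ?T (Suc n)" using F by (auto simp: nbr_step_def)
  then show "common_nbrs V E F \<subseteq> nbr_closure m V E S" unfolding nbr_closure_def by blast
qed

lemma card_of_subsets_of_size:
  assumes "infinite T"
  shows "|{F. F \<subseteq> T \<and> finite F \<and> card F = k}| \<le>o |T|"
proof (induction k)
  case 0
  have "{F. F \<subseteq> T \<and> finite F \<and> card F = 0} = {{}}" by auto
  moreover have "T \<noteq> {}" using assms by auto
  ultimately show ?case by (simp add: card_of_singl_ordLeq)
next
  case (Suc k)
  let ?B = "{F. F \<subseteq> T \<and> finite F \<and> card F = k}"
  have "{F. F \<subseteq> T \<and> finite F \<and> card F = Suc k} \<subseteq> (\<lambda>(x, F). insert x F) ` (T \<times> ?B)"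
  proof
    fix F assume F: "F \<in> {F. F \<subseteq> T \<and> finite F \<and> card F = Suc k}"
    then obtain x where "x \<in> F" by fastforce
    then have "F = insert x (F - {x})" "x \<in> T" "F - {x} \<in> ?B" using F by auto
    then show "F \<in> (\<lambda>(x, F). insert x F) ` (T \<times> ?B)" by blast
  qed
  from ordLeq_transitive[OF card_of_mono1[OF this] card_of_image]
  have "|{F. F \<subseteq> T \<and> finite F \<and> card F = Suc k}| \<le>o |T \<times> ?B|" .
  also have "|T \<times> ?B| \<le>o |T \<times> T|" using Suc.IH by (rule card_of_Times_mono2)
  also have "|T \<times> T| =o |T|" using assms by (rule card_of_Times_same_infinite)
  finally show ?case .
qed

lemma card_of_countable_ordLeq: "countable C \<Longrightarrow> infinite T \<Longrightarrow> |C| \<le>o |T|"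
  unfolding countable_def infinite_iff_card_of_nat
  by (metis card_of_ordLeq ordLeq_transitive subset_UNIV)

lemma card_of_nbr_closure:
  assumes S: "infinite S" "S \<subseteq> V"
    and few: "\<And>F. F \<subseteq> V \<Longrightarrow> finite F \<Longrightarrow> card F = m \<Longrightarrow> countable (common_nbrs V E F)"
  shows "|nbr_closure m V E S| \<le>o |S|"
proof -
  have step: "|nbr_step m V E T| \<le>o |T|" if T: "infinite T" "T \<subseteq> V" for T
  proof -
    have "|\<Union>F\<in>{F. F \<subseteq> T \<and> finite F \<and> card F = m}. common_nbrs V E F| \<le>o |T|"
      proof (intro card_of_UNION_ordLeq_infinite card_of_subsets_of_size ballI T(1))
      fix F assume F: "F \<in> {F. F \<subseteq> T \<and> finite F \<and> card F = m}"
      then have "countable (common_nbrs V E F)" using T(2) by (intro few) auto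
      then show "|common_nbrs V E F| \<le>o |T|" by (rule card_of_countable_ordLeq[OF _ T(1)])
    qed
    then show ?thesis
      unfolding nbr_step_def using T(1)
      by (intro card_of_Un_ordLeq_infinite_Field)
        (auto simp: Field_card_of card_of_card_order_on card_of_refl ordIso_imp_ordLeq)
  qed
  have iter: "S \<subseteq> (nbr_step m V E ^^ n) S \<and> (nbr_step m V E ^^ n) S \<subseteq> V \<and>
      |(nbr_step m V E ^^ n) S| \<le>o |S|" for n
  proof (induction n)
    case 0
    show ?case using S by (simp add: ordIso_imp_ordLeq card_of_refl)
  next
    case (Suc n)
    let ?T = "(nbr_step m V E ^^ n) S"
    have "infinite ?T" using Suc S by (meson finite_subset)
    then have "|nbr_step m V E ?T| \<le>o |?T|" using step Suc by blast
    then have "|nbr_step m V E ?T| \<le>o |S|" using Suc ordLeq_transitive by blast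
    moreover have "T \<subseteq> nbr_step m V E T" for T by (auto simp: nbr_step_def)
    moreover have "T \<subseteq> V \<Longrightarrow> nbr_step m V E T \<subseteq> V" for T by (auto simp: nbr_step_def common_nbrs_def)
    ultimately show ?case using Suc by (metis (no_types) funpow.simps(2) o_apply subset_trans)
  qed
  show ?thesis
    unfolding nbr_closure_def
    by (rule card_of_UNION_ordLeq_infinite[OF S(1)]) (use S(1) iter in \<open>auto simp: infinite_iff_card_of_nat\<close>)
qed

text \<open>
  The lexicographic order: first by the index \<open>\<rho> x\<close> of the piece, then within the piece.
\<close>

lemma well_order_on_lex:
  assumes r0: "well_order_on A r0" and \<rho>: "\<And>x. x \<in> V \<Longrightarrow> \<rho> x \<in> A"
    and s: "\<And>a. a \<in> A \<Longrightarrow> well_order_on {x\<in>V. \<rho> x = a} (s a)"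
  shows "well_order_on V {(x, y). x \<in> V \<and> y \<in> V \<and>
    (\<rho> x \<noteq> \<rho> y \<and> (\<rho> x, \<rho> y) \<in> r0 \<or> \<rho> x = \<rho> y \<and> (x, y) \<in> s (\<rho> x))}" (is "well_order_on V ?r")
proof -
  note defs = well_order_on_def linear_order_on_def partial_order_on_def preorder_on_def
  have r0': "trans r0" "antisym r0" "total_on A r0" "wf (r0 - Id)" using r0 by (auto simp: defs)
  have s': "refl_on {x\<in>V. \<rho> x = a} (s a)" "trans (s a)" "antisym (s a)"
    "total_on {x\<in>V. \<rho> x = a} (s a)" "wf (s a - Id)" if "a \<in> A" for a
    using s[OF that] by (auto simp: defs)
  have "refl_on V ?r" using s'(1) \<rho> by (auto simp: refl_on_def)
  moreover have "trans ?r"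
  proof (rule transI)
    fix x y z assume xy: "(x, y) \<in> ?r" and yz: "(y, z) \<in> ?r"
    have V: "x \<in> V" "y \<in> V" "z \<in> V" using xy yz by auto
    consider "\<rho> x = \<rho> y" "\<rho> y = \<rho> z" | "\<rho> x = \<rho> y" "\<rho> y \<noteq> \<rho> z" | "\<rho> x \<noteq> \<rho> y" "\<rho> y = \<rho> z"
      | "\<rho> x \<noteq> \<rho> y" "\<rho> y \<noteq> \<rho> z" by blast
    then show "(x, z) \<in> ?r"
    proof cases
      case 1
      then show ?thesis using xy yz s'(2)[OF \<rho>[OF V(1)]] by (auto dest: transD)
    next
      case 4
      then have "(\<rho> x, \<rho> y) \<in> r0" "(\<rho> y, \<rho> z) \<in> r0" using xy yz by auto
      moreover from this have "\<rho> x \<noteq> \<rho> z" using 4 r0'(2) by (metis antisymD)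
      ultimately show ?thesis using V r0'(1) by (auto dest: transD)
    qed (use xy yz in auto)
  qed
  moreover have "antisym ?r"
  proof (rule antisymI)
    fix x y assume xy: "(x, y) \<in> ?r" "(y, x) \<in> ?r"
    have V: "x \<in> V" using xy by auto
    have "\<rho> x = \<rho> y" using xy r0'(2) by (auto dest: antisymD)
    then show "x = y" using xy s'(3)[OF \<rho>[OF V]] by (auto dest: antisymD)
  qed
  moreover have "total_on V ?r"
    unfolding total_on_def
  proof (intro ballI impI)
    fix x y assume V: "x \<in> V" "y \<in> V" and ne: "x \<noteq> y"
    show "(x, y) \<in> ?r \<or> (y, x) \<in> ?r"
    proof (cases "\<rho> x = \<rho> y")
      case True
      then have "(x, y) \<in> s (\<rho> x) \<or> (y, x) \<in> s (\<rho> x)"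
        using s'(4)[OF \<rho>[OF V(1)]] V ne unfolding total_on_def by auto
      then show ?thesis using True V by auto
    next
      case False
      then show ?thesis using r0'(3) \<rho> V unfolding total_on_def by auto
    qed
  qed
  moreover have "wf (?r - Id)"
  proof (rule wfI_min)
    fix x Q assume x: "x \<in> (Q :: 'b set)"
    show "\<exists>z\<in>Q. \<forall>y. (y, z) \<in> ?r - Id \<longrightarrow> y \<notin> Q"
    proof (cases "Q \<inter> V = {}")
      case True
      then show ?thesis using x by auto
    next
      case False
      then obtain a where a: "a \<in> \<rho> ` (Q \<inter> V)" "\<And>b. (b, a) \<in> r0 - Id \<Longrightarrow> b \<notin> \<rho> ` (Q \<inter> V)"
        using wfE_min[OF r0'(4)] by (metis (no_types, lifting) equals0I imageI)
      then have "a \<in> A" using \<rho> by auto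
      obtain x1 where "x1 \<in> {x \<in> Q \<inter> V. \<rho> x = a}" using a(1) by auto
      from wfE_min[OF s'(5)[OF \<open>a \<in> A\<close>] this] obtain z where
        z: "z \<in> {x \<in> Q \<inter> V. \<rho> x = a}" "\<And>y. (y, z) \<in> s a - Id \<Longrightarrow> y \<notin> {x \<in> Q \<inter> V. \<rho> x = a}"
        by blast
      have "y \<notin> Q" if "(y, z) \<in> ?r - Id" for y
        using that z a(2)[of "\<rho> y"] by auto
      then show ?thesis using z(1) by blast
    qed
  qed
  ultimately show ?thesis by (auto simp: defs)
qed

text \<open>
  Induction on the cardinality of \<open>V\<close>. For countable \<open>V\<close>, an order of type at most \<open>\<omega>\<close> has
  finite initial segments.
  Otherwise well-order \<open>V\<close> in order type \<open>|V|\<close> and let \<open>D a\<close> be the closure of the initial segment up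
  to \<open>a\<close> under common neighbors of \<open>m\<close> vertices. As \<open>m\<close> vertices have only countably many common
  neighbors, \<open>D a\<close> is smaller than \<open>V\<close>. The piece of index \<open>a\<close> consists of the vertices that enter
  with \<open>D a\<close>. The union of all earlier \<open>D b\<close> is again closed, so a vertex outside it has fewer than
  \<open>m\<close> neighbors in it. Put the pieces one after the other, each ordered by the induction
  hypothesis.
\<close>

theorem erdos_hajnal_coloring_number:
  fixes V :: "'a set"
  assumes E: "sym E" and m: "m > 0"
    and few: "\<And>F. F \<subseteq> V \<Longrightarrow> finite F \<Longrightarrow> card F = m \<Longrightarrow> countable (common_nbrs V E F)"
  shows "has_small_back_degrees V E natLeq"
  using few
proof (induction V rule: wf_induct_rule[OF wf_inv_image[OF wf_ordLess, of card_of]])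
  case (1 V)
  have IH: "has_small_back_degrees W E natLeq" if "W \<subseteq> V" "|W| <o |V|" for W
  proof (rule "1.IH")
    show "(W, V) \<in> inv_image ordLess card_of" using that by simp
    fix F assume F: "F \<subseteq> W" "finite F" "card F = m"
    have "common_nbrs W E F \<subseteq> common_nbrs V E F" using that by (auto simp: common_nbrs_def)
    moreover have "countable (common_nbrs V E F)" using "1.prems" F that by blast
    ultimately show "countable (common_nbrs W E F)" by (rule countable_subset)
  qed
  show ?case
  proof (cases "countable V")
    case True
    then have "|V| \<le>o natLeq"
      by (metis card_of_nat countable_def card_of_ordLeq ordLeq_ordIso_trans subset_UNIV)
    then show ?thesis
      using has_small_back_degrees_card_vertices[of V E] ordLess_ordLeq_trans
      unfolding has_small_back_degrees_def by blast
  next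
    case False
    then have inf: "infinite V" using countable_finite by blast
    define r0 where "r0 = |V|"
    have wo: "well_order_on V r0" unfolding r0_def by (rule card_of_well_order_on)
    have r0: "trans r0" "antisym r0" "total_on V r0" "wf (r0 - Id)" "refl_on V r0" "r0 \<subseteq> V \<times> V"
      using wo by (auto simp: well_order_on_def linear_order_on_def partial_order_on_def preorder_on_def)
    \<comment> \<open>Adding a fixed countable set makes all initial segments infinite, so that the closure does
      not increase their cardinality.\<close>
    obtain C where C: "C \<subseteq> V" "countable C" "infinite C"
      using infinite_countable_subset'[OF inf] by blast
    define S where "S a = C \<union> (insert a (underS r0 a))" for a
    define D where "D a = nbr_closure m V E (S a)" for a
    have S: "S a \<subseteq> V" "infinite (S a)" if "a \<in> V" for a
      using that C r0(6) by (auto simp: S_def underS_def)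
    have "|S a| <o |V|" if a: "a \<in> V" for a
    proof -
      have "|C| <o |V|"
      proof (rule ccontr)
        assume "\<not> |C| <o |V|"
        then have "|V| \<le>o |C|" using not_ordLess_iff_ordLeq card_of_Well_order by blast
        then obtain f where "inj_on f V" "f ` V \<subseteq> C" using card_of_ordLeq by metis
        then show False using False C(2) countable_image_inj_on countable_subset by metis
      qed
      moreover have "|{a}| <o |V|" using inf by (intro finite_ordLess_infinite[OF card_of_Well_order card_of_Well_order]) (simp_all add: Field_card_of)
      moreover have "|underS r0 a| <o |V|"
        unfolding r0_def using card_of_underS[OF card_of_Card_order, of a V] a by (simp add: Field_card_of)
      ultimately have "|C \<union> ({a} \<union> underS r0 a)| <o |V|"
        by (intro card_of_Un_ordLess_infinite[OF inf])
      then show ?thesis by (simp add: S_def)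
    qed
    then have D: "|D a| <o |V|" if "a \<in> V" for a
      unfolding D_def using card_of_nbr_closure[OF S(2,1)[OF that] "1.prems"] that ordLeq_ordLess_trans by blast
    have S_mono: "S a \<subseteq> S b" if "(a, b) \<in> r0" for a b
    proof -
      have "insert a (underS r0 a) \<subseteq> insert b (underS r0 b)"
        using that r0(1,2) unfolding underS_def by (auto dest: transD antisymD)
      then show ?thesis unfolding S_def by blast
    qed
    then have D_mono: "D a \<subseteq> D b" if "(a, b) \<in> r0" for a b
      using that by (simp add: D_def nbr_closure_mono)
    have S_D: "x \<in> D x" for x using subset_nbr_closure[of "S x"] by (auto simp: D_def S_def)
    have "\<exists>a. a \<in> V \<and> x \<in> D a \<and> (\<forall>b. (b, a) \<in> r0 - Id \<longrightarrow> x \<notin> D b)" if x: "x \<in> V" for x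
    proof -
      have "x \<in> {a \<in> V. x \<in> D a}" using x S_D by simp
      from r0(4)[unfolded wf_eq_minimal, rule_format, OF this]
      obtain a where a: "a \<in> {a \<in> V. x \<in> D a}"
        "\<forall>b. (b, a) \<in> r0 - Id \<longrightarrow> b \<notin> {a \<in> V. x \<in> D a}"
        by (rule bexE)
      have "x \<notin> D b" if "(b, a) \<in> r0 - Id" for b
        using a(2)[rule_format, OF that] that r0(6) by auto
      then show ?thesis using a(1) by blast
    qed
    then obtain \<rho> where \<rho>: "\<And>x. x \<in> V \<Longrightarrow> \<rho> x \<in> V" "\<And>x. x \<in> V \<Longrightarrow> x \<in> D (\<rho> x)"
      "\<And>x b. x \<in> V \<Longrightarrow> (b, \<rho> x) \<in> r0 - Id \<Longrightarrow> x \<notin> D b" by metis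
    define B where "B x = (\<Union>b\<in>underS r0 (\<rho> x). D b)" for x
    have few_back: "finite {y \<in> B x. (x, y) \<in> E}" if x: "x \<in> V" for x
    proof (rule ccontr)
      assume "infinite {y \<in> B x. (x, y) \<in> E}"
      from infinite_arbitrarily_large[OF this, of m]
      obtain F where F: "F \<subseteq> {y \<in> B x. (x, y) \<in> E}" "finite F" "card F = m"
        by (elim exE conjE)
      have "F \<noteq> {}" using F m by auto
      have "F \<subseteq> \<Union> (D ` underS r0 (\<rho> x))" using F(1) by (auto simp: B_def)
      then obtain T where "T \<in> D ` underS r0 (\<rho> x)" "F \<subseteq> T"
      proof (rule finite_subset_Union_chain[OF F(2)])
        show "D ` underS r0 (\<rho> x) \<noteq> {}" using F(1) \<open>F \<noteq> {}\<close> by (auto simp: B_def)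
        have "D a \<subseteq> D b \<or> D b \<subseteq> D a" if "a \<in> V" "b \<in> V" for a b
          using that D_mono[of a b] D_mono[of b a] r0(3) unfolding total_on_def by (metis order_refl)
        then show "subset.chain UNIV (D ` underS r0 (\<rho> x))"
          using r0(6) unfolding subset_chain_def underS_def by auto
      qed
      then obtain b where b: "b \<in> underS r0 (\<rho> x)" "F \<subseteq> D b" by blast
      have "x \<in> common_nbrs V E F"
        using F(1) x E by (auto simp: common_nbrs_def dest: symD)
      then have "x \<in> D b"
        using nbr_closed_nbr_closure[of m V E "S b"] b F unfolding nbr_closed_def D_def by blast
      then show False using \<rho>(3)[OF x, of b] b(1) by (auto simp: underS_def)
    qed
    define good where "good a s \<longleftrightarrow> well_order_on {x\<in>V. \<rho> x = a} s \<and> (\<forall>x\<in>{x\<in>V. \<rho> x = a}.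
        |{y \<in> {x\<in>V. \<rho> x = a}. (x, y) \<in> E \<and> y \<in> underS s x}| <o natLeq)" for a s
    have "\<exists>s. good a s" if "a \<in> V" for a
    proof -
      have "{x\<in>V. \<rho> x = a} \<subseteq> D a" using \<rho>(2) by auto
      then have "|{x\<in>V. \<rho> x = a}| <o |V|" using D[OF that] card_of_mono1 ordLeq_ordLess_trans by blast
      then have "has_small_back_degrees {x\<in>V. \<rho> x = a} E natLeq" by (intro IH) auto
      then show ?thesis unfolding has_small_back_degrees_def good_def .
    qed
    then obtain s where good: "\<And>a. a \<in> V \<Longrightarrow> good a (s a)" by metis
    have s: "\<And>a. a \<in> V \<Longrightarrow> well_order_on {x\<in>V. \<rho> x = a} (s a)"
      "\<And>a x. a \<in> V \<Longrightarrow> x \<in> V \<Longrightarrow> \<rho> x = a \<Longrightarrow>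
        finite {y \<in> {x\<in>V. \<rho> x = a}. (x, y) \<in> E \<and> y \<in> underS (s a) x}"
      using good unfolding good_def finite_iff_ordLess_natLeq[symmetric] by auto
    define r where "r = {(x, y). x \<in> V \<and> y \<in> V \<and>
      (\<rho> x \<noteq> \<rho> y \<and> (\<rho> x, \<rho> y) \<in> r0 \<or> \<rho> x = \<rho> y \<and> (x, y) \<in> s (\<rho> x))}"
    have "well_order_on V r" unfolding r_def by (rule well_order_on_lex[OF wo \<rho>(1) s(1)])
    moreover have "finite {y \<in> V. (x, y) \<in> E \<and> y \<in> underS r x}" if x: "x \<in> V" for x
    proof (rule finite_subset)
      let ?P = "{z\<in>V. \<rho> z = \<rho> x}"
      show "{y \<in> V. (x, y) \<in> E \<and> y \<in> underS r x} \<subseteq>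
          {y \<in> B x. (x, y) \<in> E} \<union> {y \<in> ?P. (x, y) \<in> E \<and> y \<in> underS (s (\<rho> x)) x}"
        using \<rho>(2) by (auto simp: r_def underS_def B_def)
      show "finite ({y \<in> B x. (x, y) \<in> E} \<union> {y \<in> ?P. (x, y) \<in> E \<and> y \<in> underS (s (\<rho> x)) x})"
        using few_back[OF x] s(2)[OF \<rho>(1)[OF x] x] by simp
    qed
    ultimately show ?thesis
      unfolding has_small_back_degrees_def finite_iff_ordLess_natLeq[symmetric] by blast
  qed
qed

section \<open>Coloring number and list-chromatic number\<close>

text \<open>
  Larger lists can be shrunk to lists of the smaller size.
\<close>

lemma choosable_mono:
  fixes \<kappa> :: "'k rel" and \<mu> :: "'l rel"
  assumes \<kappa>: "Card_order \<kappa>" "choosable V E \<kappa>" and le: "\<kappa> \<le>o \<mu>"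
  shows "choosable V E \<mu>"
  unfolding choosable_def
proof (intro allI impI)
  fix \<Lambda> :: "'a \<Rightarrow> ('a \<times> 'l) set" assume \<Lambda>: "listing V \<mu> \<Lambda>"
  have "\<exists>B \<subseteq> \<Lambda> x. |B| =o \<kappa>" if "x \<in> V" for x
  proof -
    have "|\<Lambda> x| =o \<mu>" using \<Lambda> that by (simp add: listing_def)
    note ordLeq_ordIso_trans[OF le ordIso_symmetric[OF this]]
    note ordIso_ordLeq_trans[OF card_of_Field_ordIso[OF \<kappa>(1)] this]
    from iffD1[OF internalize_card_of_ordLeq2 this]
    obtain B where B: "B \<subseteq> \<Lambda> x" "|Field \<kappa>| =o |B|" by (elim exE conjE)
    have "|B| =o \<kappa>"
      by (rule ordIso_transitive[OF ordIso_symmetric[OF B(2)] card_of_Field_ordIso[OF \<kappa>(1)]])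
    with B(1) have "B \<subseteq> \<Lambda> x \<and> |B| =o \<kappa>" ..
    then show ?thesis by blast
  qed
  then obtain \<Lambda>' where \<Lambda>': "\<And>x. x \<in> V \<Longrightarrow> \<Lambda>' x \<subseteq> \<Lambda> x" "\<And>x. x \<in> V \<Longrightarrow> |\<Lambda>' x| =o \<kappa>" by metis
  then have "listing V \<kappa> \<Lambda>'" by (simp add: listing_def)
  then obtain \<phi> where "list_coloring V \<Lambda>' \<phi>" "proper_coloring V E \<phi>"
    by (rule choosable_any_color_type[OF \<kappa>])
  then show "\<exists>\<phi>. list_coloring V \<Lambda> \<phi> \<and> proper_coloring V E \<phi>"
    using \<Lambda>'(1) unfolding list_coloring_def by blast
qed

lemma list_chromatic_number_le_natLeq_iff:
  assumes G: "graph V E"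
  shows "list_chromatic_number V E \<le>o natLeq \<longleftrightarrow> choosable V E natLeq"
proof
  have "Card_order (list_chromatic_number V E)" "choosable V E (list_chromatic_number V E)"
    using list_chromatic_number_is_least[OF G] by (simp_all add: is_least_cardinal_def)
  then show "choosable V E natLeq" if "list_chromatic_number V E \<le>o natLeq"
    using that by (rule choosable_mono)
qed (rule list_chromatic_number_least[OF G natLeq_Card_order])

lemma coloring_number_le_natLeq_iff:
  "coloring_number V E \<le>o natLeq \<longleftrightarrow> has_small_back_degrees V E natLeq"
proof
  assume le: "coloring_number V E \<le>o natLeq"
  have "has_small_back_degrees V E (coloring_number V E)"
    using coloring_number_is_least[of V E] by (simp add: is_least_cardinal_def)
  then obtain r where r: "well_order_on V r"
    "\<And>x. x \<in> V \<Longrightarrow> |{y \<in> V. (x, y) \<in> E \<and> y \<in> underS r x}| <o coloring_number V E"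
    unfolding has_small_back_degrees_def by auto
  show "has_small_back_degrees V E natLeq"
    unfolding has_small_back_degrees_def
    by (intro exI[of _ r] conjI ballI r(1)) (rule ordLess_ordLeq_trans[OF r(2) le])
qed (rule coloring_number_least[OF natLeq_Card_order])

text \<open>
  Greedy coloring along the well-order: at each vertex only finitely many colors are excluded.
\<close>

lemma choosable_if_finite_back_degrees:
  assumes G: "graph V E" and small: "has_small_back_degrees V E natLeq"
  shows "choosable V E natLeq"
  unfolding choosable_def
proof (intro allI impI)
  fix \<Lambda> :: "'a \<Rightarrow> ('a \<times> nat) set" assume L: "listing V natLeq \<Lambda>"
  obtain r where r: "well_order_on V r"
    "\<And>x. x \<in> V \<Longrightarrow> finite {y \<in> V. (x, y) \<in> E \<and> y \<in> underS r x}"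
    using small unfolding has_small_back_degrees_def finite_iff_ordLess_natLeq[symmetric] by blast
  define R where "R = r - Id"
  have wf: "wf R" and tot: "total_on V r"
    using r(1) unfolding R_def well_order_on_def linear_order_on_def by blast+
  define Nb where "Nb x = {y \<in> V. (x, y) \<in> E \<and> y \<in> underS r x}" for x
  define F where "F f x = (SOME c. c \<in> \<Lambda> x \<and> c \<notin> f ` Nb x)"
    for f :: "'a \<Rightarrow> 'a \<times> nat" and x
  define \<phi> where "\<phi> = wfrec R F"
  have eq: "\<phi> x = F \<phi> x" for x
  proof -
    have "\<phi> x = F (cut \<phi> R x) x" unfolding \<phi>_def using wf by (simp add: wfrec)
    also have "cut \<phi> R x ` Nb x = \<phi> ` Nb x"
      by (rule image_cong) (auto simp: cut_def R_def underS_def Nb_def)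
    then have "F (cut \<phi> R x) x = F \<phi> x" by (simp add: F_def)
    finally show ?thesis .
  qed
  have \<phi>: "\<phi> x \<in> \<Lambda> x \<and> \<phi> x \<notin> \<phi> ` Nb x" if x: "x \<in> V" for x
  proof -
    have "|\<Lambda> x| =o natLeq" using L x by (simp add: listing_def)
    then have "natLeq \<le>o |\<Lambda> x|" by (rule ordIso_imp_ordLeq[OF ordIso_symmetric])
    then have "infinite (\<Lambda> x)" using infinite_iff_natLeq_ordLeq[of "\<Lambda> x"] by blast
    moreover have "finite (\<phi> ` Nb x)" using r(2)[OF x] by (simp add: Nb_def)
    ultimately have "\<not> \<Lambda> x \<subseteq> \<phi> ` Nb x" using finite_subset by blast
    then have "\<exists>c. c \<in> \<Lambda> x \<and> c \<notin> \<phi> ` Nb x" by blast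
    then show ?thesis unfolding eq[of x] F_def by (rule someI_ex)
  qed
  have "\<phi> x \<noteq> \<phi> y" if xy: "x \<in> V" "y \<in> V" "(x, y) \<in> E" for x y
  proof -
    have "x \<noteq> y" "(y, x) \<in> E" using G xy by (auto simp: graph_def irrefl_def dest: symD)
    moreover from this have "x \<in> underS r y \<or> y \<in> underS r x"
      using xy tot by (auto simp: underS_def total_on_def)
    ultimately have "x \<in> Nb y \<or> y \<in> Nb x" using xy by (auto simp: Nb_def)
    then show ?thesis using \<phi>[OF xy(1)] \<phi>[OF xy(2)] by (metis imageI)
  qed
  then show "\<exists>\<phi>. list_coloring V \<Lambda> \<phi> \<and> proper_coloring V E \<phi>"
    using \<phi> by (auto simp: list_coloring_def proper_coloring_def intro!: exI[of _ \<phi>])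
qed

section \<open>Complete bipartite subgraphs\<close>

lemma graph_isomorphic_sym:
  assumes "graph_isomorphic V E W F" shows "graph_isomorphic W F V E"
proof -
  obtain f where f: "bij_betw f V W" "\<And>x y. x \<in> V \<Longrightarrow> y \<in> V \<Longrightarrow> (x, y) \<in> E \<longleftrightarrow> (f x, f y) \<in> F"
    using assms unfolding graph_isomorphic_def by blast
  let ?g = "inv_into V f"
  have "bij_betw ?g W V" using f(1) by (rule bij_betw_inv_into)
  moreover have "(x, y) \<in> F \<longleftrightarrow> (?g x, ?g y) \<in> E" if "x \<in> W" "y \<in> W" for x y
    using that f(2)[of "?g x" "?g y"] f(1)
    by (metis bij_betw_imp_surj_on f_inv_into_f inv_into_into)
  ultimately show ?thesis unfolding graph_isomorphic_def by blast
qed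

text \<open>
  As subgraphs need not be induced, only the edges between the two sides matter.
\<close>

lemma contains_complete_bipartite_iff:
  assumes G: "graph V E"
  shows "contains_graph (V, E) (complete_bipartite A B) \<longleftrightarrow>
    (\<exists>f g. inj_on f A \<and> inj_on g B \<and> f ` A \<subseteq> V \<and> g ` B \<subseteq> V \<and> f ` A \<inter> g ` B = {} \<and>
      (\<forall>a\<in>A. \<forall>b\<in>B. (f a, g b) \<in> E))" (is "?L \<longleftrightarrow> ?R")
proof
  assume ?L
  then obtain V1 E1 where sub: "subgraph V1 E1 V E"
    and "graph_isomorphic V1 E1 (fst (complete_bipartite A B)) (snd (complete_bipartite A B))"
    unfolding contains_graph_def by auto
  from graph_isomorphic_sym[OF this(2)] obtain k where k: "bij_betw k (A <+> B) V1"
    "\<And>x y. x \<in> A <+> B \<Longrightarrow> y \<in> A <+> B \<Longrightarrow>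
      (x, y) \<in> Inl ` A \<times> Inr ` B \<union> Inr ` B \<times> Inl ` A \<longleftrightarrow> (k x, k y) \<in> E1"
    unfolding graph_isomorphic_def complete_bipartite_def by auto
  have inj: "inj_on k (A <+> B)" and im: "k ` (A <+> B) = V1"
    using k(1) by (auto simp: bij_betw_def)
  have V1: "V1 \<subseteq> V" "E1 \<subseteq> E" using sub by (auto simp: subgraph_def)
  show ?R
  proof (intro exI[of _ "k \<circ> Inl"] exI[of _ "k \<circ> Inr"] conjI ballI)
    show "inj_on (k \<circ> Inl) A" "inj_on (k \<circ> Inr) B"
      by (auto intro!: comp_inj_on inj_on_subset[OF inj])
    show "(k \<circ> Inl) ` A \<subseteq> V" "(k \<circ> Inr) ` B \<subseteq> V" using im V1 by auto
    show "(k \<circ> Inl) ` A \<inter> (k \<circ> Inr) ` B = {}"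
      using inj by (auto dest!: inj_onD)
    show "((k \<circ> Inl) a, (k \<circ> Inr) b) \<in> E" if "a \<in> A" "b \<in> B" for a b
      using k(2)[of "Inl a" "Inr b"] that V1 by auto
  qed
next
  assume ?R
  then obtain f g where "inj_on f A \<and> inj_on g B \<and> f ` A \<subseteq> V \<and> g ` B \<subseteq> V \<and>
    f ` A \<inter> g ` B = {} \<and> (\<forall>a\<in>A. \<forall>b\<in>B. (f a, g b) \<in> E)" by (elim exE)
  then have fg: "inj_on f A" "inj_on g B" "f ` A \<subseteq> V" "g ` B \<subseteq> V" "f ` A \<inter> g ` B = {}"
    "\<And>a b. a \<in> A \<Longrightarrow> b \<in> B \<Longrightarrow> (f a, g b) \<in> E" by simp_all
  define V1 where "V1 = f ` A \<union> g ` B"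
  define E1 where "E1 = f ` A \<times> g ` B \<union> g ` B \<times> f ` A"
  have "graph V1 E1"
    using fg(5) by (auto simp: graph_def V1_def E1_def sym_def irrefl_def)
  moreover have "V1 \<subseteq> V" using fg(3,4) by (simp add: V1_def)
  moreover have "(g b, f a) \<in> E" if "a \<in> A" "b \<in> B" for a b
    using fg(6)[OF that] G unfolding graph_def by (blast dest: symD)
  then have "E1 \<subseteq> E" using fg(6) by (auto simp: E1_def)
  ultimately have sub: "subgraph V1 E1 V E" using G by (simp add: subgraph_def)
  have "graph_isomorphic (A <+> B) (Inl ` A \<times> Inr ` B \<union> Inr ` B \<times> Inl ` A) V1 E1"
    unfolding graph_isomorphic_def
  proof (intro exI[of _ "case_sum f g"] conjI ballI)
    have disj: "f a \<noteq> g b" if "a \<in> A" "b \<in> B" for a b using that fg(5) by blast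
    have "inj_on (case_sum f g) (A <+> B)"
    proof (rule inj_onI)
      fix x y assume "x \<in> A <+> B" "y \<in> A <+> B" "case_sum f g x = case_sum f g y"
      then show "x = y"
        using inj_on_eq_iff[OF fg(1)] inj_on_eq_iff[OF fg(2)] disj by (elim PlusE) (auto, metis)
    qed
    moreover have "case_sum f g ` (A <+> B) = V1" by (force simp: V1_def)
    ultimately show "bij_betw (case_sum f g) (A <+> B) V1" by (simp add: bij_betw_def)
    fix x y assume "x \<in> A <+> B" "y \<in> A <+> B"
    moreover have "f a \<notin> g ` B" if "a \<in> A" for a using that fg(5) by blast
    moreover have "g b \<notin> f ` A" if "b \<in> B" for b using that fg(5) by blast
    ultimately show "(x, y) \<in> Inl ` A \<times> Inr ` B \<union> Inr ` B \<times> Inl ` A \<longleftrightarrow>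
        (case_sum f g x, case_sum f g y) \<in> E1"
      unfolding E1_def by (elim PlusE) (simp_all, blast+)
  qed
  from graph_isomorphic_sym[OF this] sub show ?L
    unfolding contains_graph_def complete_bipartite_def fst_conv snd_conv by blast
qed

text \<open>
  Use pairs \<open>(i, k)\<close> of natural numbers as colors. Countably many vertices \<open>u i\<close> of one side get the
  disjoint lists of all pairs with first component \<open>i\<close>; the vertices of the other side get as lists
  the graphs of all functions \<open>k\<close> on the natural numbers. A coloring of the \<open>u i\<close> is such a function, and the
  vertex belonging to this function has no color left.
\<close>

lemma not_choosable_if_contains_continuum:
  assumes G: "graph V E"
    and K: "contains_graph (V, E) (complete_bipartite (UNIV :: nat set set) (UNIV :: nat set set))"
  shows "\<not> choosable V E natLeq"
proof
  assume ch: "choosable V E natLeq"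
  obtain f g :: "nat set \<Rightarrow> 'a" where fg: "inj f" "inj g" "range f \<subseteq> V" "range g \<subseteq> V"
    "range f \<inter> range g = {}" "\<And>X Y. (f X, g Y) \<in> E"
    using K unfolding contains_complete_bipartite_iff[OF G] by auto
  \<comment> \<open>A surjection from the sets of natural numbers onto the functions: it recovers a function
    from its encoded graph.\<close>
  define \<pi> where "\<pi> X i = (SOME k. prod_encode (i, k) \<in> X)" for X i
  have \<pi>: "\<exists>X. \<pi> X = k" for k
  proof
    show "\<pi> {prod_encode (i, k i) | i. True} = k"
      unfolding \<pi>_def by (auto simp: prod_encode_eq fun_eq_iff)
  qed
  define u where "u i = f {i}" for i :: nat
  have u: "inj u" using fg(1) by (auto simp: u_def inj_def)
  define \<Lambda> where "\<Lambda> x = (if x \<in> range u then {inv u x} \<times> UNIV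
    else (\<lambda>i. (i, \<pi> (inv g x) i)) ` UNIV)" for x
  have "|\<Lambda> x| =o natLeq" for x
  proof -
    have inf: "infinite (\<Lambda> x) \<and> countable (\<Lambda> x)"
    proof (cases "x \<in> range u")
      case True
      then show ?thesis by (auto simp: \<Lambda>_def finite_cartesian_product_iff)
    next
      case False
      have "inj (\<lambda>i. (i, \<pi> (inv g x) i))" by (auto simp: inj_def)
      then show ?thesis using False by (auto simp: \<Lambda>_def finite_image_iff)
    qed
    obtain h :: "nat \<times> nat \<Rightarrow> nat" where "bij_betw h (\<Lambda> x) UNIV"
      by (rule countableE_infinite[OF conjunct2[OF inf] conjunct1[OF inf]])
    then have "|\<Lambda> x| =o |UNIV :: nat set|" by (rule card_of_ordIsoI)
    then show ?thesis using card_of_nat by (rule ordIso_transitive)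
  qed
  then have "listing V natLeq \<Lambda>" by (simp add: listing_def)
  then obtain \<phi> where \<phi>: "list_coloring V \<Lambda> \<phi>" "proper_coloring V E \<phi>"
    by (rule choosable_any_color_type[OF natLeq_Card_order ch])
  have "\<phi> (u i) \<in> {i} \<times> UNIV" for i
  proof -
    have "\<phi> (u i) \<in> \<Lambda> (u i)" using \<phi>(1) fg(3) by (auto simp: list_coloring_def u_def)
    then show ?thesis using u by (auto simp: \<Lambda>_def)
  qed
  then have "\<exists>k. \<phi> (u i) = (i, k)" for i by (metis SigmaE singletonD)
  then obtain k where k: "\<And>i. \<phi> (u i) = (i, k i)" by metis
  obtain X where X: "\<pi> X = k" using \<pi> by blast
  have "g X \<notin> range u" using fg(5) by (auto simp: u_def)
  moreover have "\<phi> (g X) \<in> \<Lambda> (g X)" using \<phi>(1) fg(4) by (auto simp: list_coloring_def)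
  ultimately obtain i where "\<phi> (g X) = (i, k i)" using X fg(2) by (auto simp: \<Lambda>_def)
  then have "\<phi> (u i) = \<phi> (g X)" using k by simp
  moreover have "(u i, g X) \<in> E" using fg(6) by (simp add: u_def)
  ultimately show False
    using \<phi>(2) fg(3,4) unfolding proper_coloring_def u_def by (metis range_subsetD)
qed

section \<open>Semialgebraic graphs\<close>

lemma tm_val_cong: "(\<And>i. i \<in> tm_vars t \<Longrightarrow> e i = e' i) \<Longrightarrow> tm_val e t = tm_val e' t"
  by (induction t) auto

lemma sat_cong: "(\<And>i. i \<in> free_vars \<phi> \<Longrightarrow> e i = e' i) \<Longrightarrow> sat e \<phi> = sat e' \<phi>"
proof (induction \<phi> arbitrary: e e')
  case (Eq s t)
  have "tm_val e s = tm_val e' s" by (rule tm_val_cong) (use Eq in simp)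
  moreover have "tm_val e t = tm_val e' t" by (rule tm_val_cong) (use Eq in simp)
  ultimately show ?case by simp
next
  case (Leq s t)
  have "tm_val e s = tm_val e' s" by (rule tm_val_cong) (use Leq in simp)
  moreover have "tm_val e t = tm_val e' t" by (rule tm_val_cong) (use Leq in simp)
  ultimately show ?case by simp
next
  case (Neg \<phi>)
  have "sat e \<phi> = sat e' \<phi>" by (rule Neg.IH) (use Neg.prems in simp)
  then show ?case by simp
next
  case (And \<phi> \<psi>)
  have "sat e \<phi> = sat e' \<phi>" by (rule And.IH(1)) (use And.prems in simp)
  moreover have "sat e \<psi> = sat e' \<psi>" by (rule And.IH(2)) (use And.prems in simp)
  ultimately show ?case by simp
next
  case (Exi i \<phi>)
  have "sat (e(i := c)) \<phi> = sat (e'(i := c)) \<phi>" for c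
    by (rule Exi.IH) (use Exi.prems in auto)
  then show ?case by simp
qed

text \<open>
  Vertices are lists of length \<open>n\<close>, which correspond to sequences vanishing from \<open>n\<close> on; this
  translates the assertion into \<open>semialg_complete_bipartite\<close>.
\<close>

lemma contains_continuum_if_contains_finite:
  assumes SG: "semialgebraic_graph n V E"
    and finK: "\<And>m. contains_graph (V, E) (complete_bipartite {..<m::nat} {..<m})"
  shows "contains_graph (V, E) (complete_bipartite (UNIV :: nat set set) (UNIV :: nat set set))"
proof -
  have G: "graph V E" using SG by (simp add: semialgebraic_graph_def)
  have len: "length xs = n" if "xs \<in> V" for xs
    using SG that by (auto simp: semialgebraic_graph_def semialgebraic_def)
  obtain \<phi> where \<phi>: "free_vars \<phi> \<subseteq> {..<2 * n}"
    "{xs @ ys | xs ys. (xs, ys) \<in> E} = {zs. length zs = 2 * n \<and> sat (\<lambda>i. zs ! i) \<phi>}"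
    using SG by (auto simp: semialgebraic_graph_def semialgebraic_def)
  define P where "P z = sat (\<lambda>i. if i < n then fst z i else snd z (i - n)) \<phi>"
    for z :: "(nat \<Rightarrow> real) \<times> (nat \<Rightarrow> real)"
  have "semialg P"
    unfolding P_def
    by (rule semialg_comp[OF semialg_sat], rule polymap_abs, rule polymap_If) (rule polymap_rules)+
  have E_iff: "(xs, ys) \<in> E \<longleftrightarrow> P (x, y)"
    if "length xs = n" "length ys = n" "\<And>i. i < n \<Longrightarrow> xs ! i = x i" "\<And>i. i < n \<Longrightarrow> ys ! i = y i"
    for xs ys x y
  proof -
    have "(xs, ys) \<in> E \<longleftrightarrow> xs @ ys \<in> {xs @ ys | xs ys. (xs, ys) \<in> E}"
      using that(1,2) len G by (fastforce simp: graph_def)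
    also have "\<dots> \<longleftrightarrow> sat (\<lambda>i. (xs @ ys) ! i) \<phi>" using that(1,2) by (simp add: \<phi>(2))
    also have "\<dots> \<longleftrightarrow> P (x, y)"
      unfolding P_def using that \<phi>(1) by (intro sat_cong) (auto simp: nth_append)
    finally show ?thesis .
  qed
  define pad where "pad xs i = (if i < n then xs ! i else 0)" for xs :: "real list" and i
  have "\<exists>A B. finite A \<and> card A = m \<and> finite B \<and> card B = m \<and>
      (\<forall>x\<in>A \<union> B. \<forall>j\<ge>n. x j = 0) \<and> (\<forall>a\<in>A. \<forall>b\<in>B. P (a, b))" for m
  proof -
    obtain f g where fg: "inj_on f {..<m}" "inj_on g {..<m}" "f ` {..<m} \<subseteq> V" "g ` {..<m} \<subseteq> V"
      "\<And>a b. a < m \<Longrightarrow> b < m \<Longrightarrow> (f a, g b) \<in> E"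
      using finK[of m] unfolding contains_complete_bipartite_iff[OF G] by auto
    have inj_pad: "inj_on pad V"
    proof (rule inj_onI)
      fix xs ys assume xy: "xs \<in> V" "ys \<in> V" "pad xs = pad ys"
      show "xs = ys"
      proof (rule nth_equalityI)
        fix i assume i: "i < length xs"
        have "pad xs i = pad ys i" using xy(3) by simp
        then show "xs ! i = ys ! i" using i len[OF xy(1)] by (simp add: pad_def)
      qed (use len xy in simp)
    qed
    have "card (pad ` f ` {..<m}) = m" "card (pad ` g ` {..<m}) = m"
      using fg(1-4) inj_on_subset[OF inj_pad] by (simp_all add: card_image)
    moreover have "P (pad (f a), pad (g b))" if "a < m" "b < m" for a b
      using fg(3-5) that len E_iff[of "f a" "g b" "pad (f a)" "pad (g b)"]
      by (auto simp: pad_def image_subset_iff)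
    ultimately show ?thesis
      by (intro exI[of _ "pad ` f ` {..<m}"] exI[of _ "pad ` g ` {..<m}"]) (auto simp: pad_def)
  qed
  from semialg_complete_bipartite[OF \<open>semialg P\<close> this]
  obtain f g :: "nat set \<Rightarrow> nat \<Rightarrow> real" where fg: "inj f" "inj g"
    "\<And>X j. j \<ge> n \<Longrightarrow> f X j = 0" "\<And>X j. j \<ge> n \<Longrightarrow> g X j = 0" "\<And>X Y. P (f X, g Y)" by blast
  define F where "F X = map (f X) [0..<n]" for X
  define H where "H X = map (g X) [0..<n]" for X
  have edge: "(F X, H Y) \<in> E" for X Y
    using fg(5) E_iff[of "F X" "H Y" "f X" "g Y"] by (simp add: F_def H_def)
  have inj: "inj (\<lambda>X. map (h X) [0..<n])"
    if "inj h" "\<And>X j. j \<ge> n \<Longrightarrow> h X j = 0" for h :: "nat set \<Rightarrow> nat \<Rightarrow> real"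
  proof (rule injI)
    fix X Y assume eq: "map (h X) [0..<n] = map (h Y) [0..<n]"
    have "h X j = h Y j" for j
      using eq that(2) by (cases "j < n") (auto simp: map_eq_conv)
    then have "h X = h Y" by (rule ext)
    then show "X = Y" by (rule injD[OF that(1)])
  qed
  have "inj F" "inj H" unfolding F_def H_def using inj fg by blast+
  moreover have "range F \<subseteq> V" "range H \<subseteq> V" "range F \<inter> range H = {}"
    using edge G by (auto simp: graph_def irrefl_def) (metis)
  ultimately show ?thesis
    unfolding contains_complete_bipartite_iff[OF G] using edge
    by (intro exI[of _ F] exI[of _ H] conjI ballI)
qed

text \<open>
  If \<open>m\<close> vertices had infinitely many common neighbors, then \<open>m\<close> of these would complete a \<open>K(m, m)\<close>.
\<close>

lemma finite_back_degrees_if_no_finite_complete_bipartite: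
  assumes G: "graph V E"
    and no: "\<not> contains_graph (V, E) (complete_bipartite {..<m::nat} {..<m})"
  shows "has_small_back_degrees V E natLeq"
proof (rule erdos_hajnal_coloring_number)
  show "sym E" using G by (simp add: graph_def)
  show "m > 0" using no by (cases m) (auto simp: contains_complete_bipartite_iff[OF G])
  fix F assume F: "F \<subseteq> V" "finite F" "card F = m"
  have "finite (common_nbrs V E F)"
  proof (rule ccontr)
    assume "infinite (common_nbrs V E F)"
    from infinite_arbitrarily_large[OF this, of m]
    obtain B where B: "B \<subseteq> common_nbrs V E F" "finite B" "card B = m"
      by (elim exE conjE)
    obtain f g where "bij_betw f {..<m} F" "bij_betw g {..<m} B"
      using F B ex_bij_betw_nat_finite by (metis atLeast0LessThan)
    then have fg: "inj_on f {..<m}" "f ` {..<m} = F" "inj_on g {..<m}" "g ` {..<m} = B"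
      by (auto simp: bij_betw_def)
    have edge: "(x, y) \<in> E" if "x \<in> F" "y \<in> B" for x y
      using that B(1) by (auto simp: common_nbrs_def)
    have "F \<inter> B = {}" using edge G by (auto simp: graph_def irrefl_def)
    moreover have "B \<subseteq> V" using B(1) by (auto simp: common_nbrs_def)
    ultimately have "contains_graph (V, E) (complete_bipartite {..<m} {..<m})"
      unfolding contains_complete_bipartite_iff[OF G] using fg F(1) edge
      by (intro exI[of _ f] exI[of _ g] conjI ballI) auto
    then show False using no by contradiction
  qed
  then show "countable (common_nbrs V E F)" by (rule countable_finite)
qed

theorem theorem1p5:
  fixes n :: nat and V :: "real list set" and E :: "real list rel"
  assumes "semialgebraic_graph n V E"
  shows "(list_chromatic_number V E \<le>o natLeq \<longleftrightarrow> coloring_number V E \<le>o natLeq)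
    \<and> (coloring_number V E \<le>o natLeq \<longleftrightarrow>
         (\<exists>m::nat. \<not> contains_graph (V, E) (complete_bipartite {..<m} {..<m})))
    \<and> ((\<exists>m::nat. \<not> contains_graph (V, E) (complete_bipartite {..<m} {..<m})) \<longleftrightarrow>
         \<not> contains_graph (V, E)
             (complete_bipartite (UNIV :: nat set set) (UNIV :: nat set set)))"
proof -
  let ?finite_K = "\<lambda>m::nat. contains_graph (V, E) (complete_bipartite {..<m} {..<m})"
  let ?continuum_K = "contains_graph (V, E)
    (complete_bipartite (UNIV :: nat set set) (UNIV :: nat set set))"
  have G: "graph V E" using assms by (simp add: semialgebraic_graph_def)
  have "coloring_number V E \<le>o natLeq \<Longrightarrow> list_chromatic_number V E \<le>o natLeq"
    using G choosable_if_finite_back_degrees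
    by (simp add: list_chromatic_number_le_natLeq_iff coloring_number_le_natLeq_iff)
  moreover have "list_chromatic_number V E \<le>o natLeq \<Longrightarrow> \<not> ?continuum_K"
    using G not_choosable_if_contains_continuum by (auto simp: list_chromatic_number_le_natLeq_iff)
  moreover have "\<not> ?continuum_K \<Longrightarrow> \<exists>m. \<not> ?finite_K m"
    using contains_continuum_if_contains_finite[OF assms] by blast
  moreover have "\<exists>m. \<not> ?finite_K m \<Longrightarrow> coloring_number V E \<le>o natLeq"
    using finite_back_degrees_if_no_finite_complete_bipartite[OF G]
    by (auto simp: coloring_number_le_natLeq_iff)
  ultimately show ?thesis by blast
qed

end
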